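(* Let $M=I\times_{\phi^{p_1}}F_1\times_{\phi^{p_2}}F_2\cdots\times_{\phi^{p_m}}F_m$ be a generalized Kasner space-time with $\dim M=\overline n$, $\dim F_i=l_i$, and put $\zeta=\sum_{i=1}^ml_ip_i$, $\eta=\sum_{i=1}^ml_ip_i^2$. Let $\lambda_1,\lambda_2$ be nonzero real constants, $P=\frac{\partial}{\partial t}$, and let $\overline\nabla$ be the quarter-symmetric connection on $M$ determined by $P,\lambda_1,\lambda_2$. Then $(M,\overline\nabla)$ is Einstein with Einstein constant $\alpha$ if and only if the following conditions are satisfied for every $i\in\{1,\dots,m\}$: (1) $(F_i,\nabla^{F_i})$ is Einstein with Einstein constant $\alpha_i$; (2) $\zeta\left(\lambda_2\frac{\phi'}{\phi}-\frac{\phi''}{\phi}\right)-(\eta-\zeta)\frac{(\phi')^2}{\phi^2}+(\lambda_1^2-\lambda_1\lambda_2)(\overline n-1)=\alpha$; (3) $\frac{\alpha_i}{\phi^{2p_i}}-p_i\frac{\phi''}{\phi}-(\zeta-1)p_i\frac{(\phi')^2}{\phi^2}+\{\lambda_2\zeta+[(\overline n-1)\lambda_1-\lambda_2]p_i\}\frac{\phi'}{\phi}=\alpha-\lambda_2^2+(\overline n-1)\lambda_1\lambda_2$.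
   Context: A generalized Kasner space-time is a Lorentzian multiply warped product $M=I\times_{\phi^{p_1}}F_1\cdots\times_{\phi^{p_m}}F_m$, i.e. the product manifold $I\times F_1\times\cdots\times F_m$ with metric $g=-dt^2\oplus\phi^{2p_1}g_{F_1}\oplus\cdots\oplus\phi^{2p_m}g_{F_m}$, where $I=(t_1,t_2)$ is an open interval, $\phi:I\to(0,\infty)$ is smooth, $p_i\in\mathbb{R}$, and $(F_i,g_{F_i})$ are Riemannian manifolds. On a pseudo-Riemannian manifold $(M,g)$ with Levi-Civita connection $\nabla$, a vector field $P$, the 1-form $\pi(X)=g(X,P)$ and nonzero real constants $\lambda_1,\lambda_2$, the quarter-symmetric connection is $\overline\nabla_XY=\nabla_XY+\lambda_1\pi(Y)X-\lambda_2g(X,Y)P$. Its curvature is $\overline R(X,Y)=\overline\nabla_X\overline\nabla_Y-\overline\nabla_Y\overline\nabla_X-\overline\nabla_{[X,Y]}$ and its Ricci tensor is $\overline{Ric}(X,Y)=\sum_k\varepsilon_k\,g(\overline R(X,E_k)Y,E_k)$, where $(E_k)$ is a local orthonormal frame with $g(E_k,E_k)=\varepsilon_k=\pm1$ (note the sign convention; $\overline{Ric}$ need not be symmetric). The same formulas with the Levi-Civita connection $\nabla^{F_i}$ of $(F_i,g_{F_i})$ define $Ric^{F_i}$ (same sign convention). $(M,\overline\nabla)$ is Einstein with Einstein constant $\alpha\in\mathbb{R}$ if $\overline{Ric}(X,Y)=\alpha g(X,Y)$ for all vector fields $X,Y$; $(F_i,\nabla^{F_i})$ is Einstein with constant $\alpha_i\in\mathbb{R}$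 if $Ric^{F_i}=\alpha_ig_{F_i}$. Primes denote $d/dt$. *)

theory Defs
  imports "HOL-Analysis.Analysis"
begin

section \<open>Smooth functions on open subsets of a coordinate space\<close>

text \<open>
  The model space of a manifold is \<^term>\<open>powertop_real K\<close>, i.e. \<open>\<real>\<^sup>K\<close> with the product topology,
  for a finite index set \<open>K\<close>; its points are the extensional functions on \<open>K\<close>. Finite index sets
  are used instead of \<open>{..<n}\<close> because the dimension is a number that varies with the manifold
  and because coordinates on a product are indexed by the disjoint union of the index sets.
\<close>

definition partial_deriv :: "'k \<Rightarrow> (('k \<Rightarrow> real) \<Rightarrow> real) \<Rightarrow> ('k \<Rightarrow> real) \<Rightarrow> real" where
  "partial_deriv k f x = deriv (\<lambda>s. f (x(k := s))) (x k)"

primrec Ck_on :: "nat \<Rightarrow> 'k set \<Rightarrow> ('k \<Rightarrow> real) set \<Rightarrow> (('k \<Rightarrow> real) \<Rightarrow> real) \<Rightarrow> bool" where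
  "Ck_on 0 K W f \<longleftrightarrow> continuous_map (subtopology (powertop_real K) W) euclideanreal f"
| "Ck_on (Suc r) K W f \<longleftrightarrow>
     continuous_map (subtopology (powertop_real K) W) euclideanreal f \<and>
     (\<forall>k\<in>K. (\<forall>x\<in>W. (\<lambda>s. f (x(k := s))) differentiable (at (x k))) \<and>
             Ck_on r K W (partial_deriv k f))"

definition Cinf_on :: "'k set \<Rightarrow> ('k \<Rightarrow> real) set \<Rightarrow> (('k \<Rightarrow> real) \<Rightarrow> real) \<Rightarrow> bool" where
  "Cinf_on K W f \<longleftrightarrow> openin (powertop_real K) W \<and> (\<forall>r. Ck_on r K W f)"


section \<open>Manifolds, tangent vectors, vector fields\<close>

text \<open>
  A tangent vector at a point is represented by its action on real functions that are smooth near
  that point; by convention it sends all other functions to \<open>0\<close>, so that equality of tangent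
  vectors is equality in HOL.
\<close>

type_synonym 'a tvec = "('a \<Rightarrow> real) \<Rightarrow> real"
type_synonym 'a vfield = "'a \<Rightarrow> 'a tvec"

text \<open>
  A chart is a pair \<open>(U, c)\<close> of its domain and the coordinate map. The last component
  is the metric, \<open>mmetric M p u v\<close> being \<open>g\<^sub>p(u, v)\<close>.
\<close>

record ('a, 'k) manifold =
  mtop :: "'a topology"
  midx :: "'k set"
  matlas :: "('a set \<times> ('a \<Rightarrow> 'k \<Rightarrow> real)) set"
  mmetric :: "'a \<Rightarrow> 'a tvec \<Rightarrow> 'a tvec \<Rightarrow> real"

definition mdim :: "('a, 'k) manifold \<Rightarrow> nat" where
  "mdim M = card (midx M)"

definition smooth_manifold :: "('a, 'k) manifold \<Rightarrow> bool" where
  "smooth_manifold M \<longleftrightarrow>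
     finite (midx M) \<and> topspace (mtop M) \<noteq> {} \<and> Hausdorff_space (mtop M) \<and>
     (\<exists>\<B>. countable \<B> \<and> openin (mtop M) = arbitrary union_of (\<lambda>B. B \<in> \<B>)) \<and>
     (\<Union>(U, c)\<in>matlas M. U) = topspace (mtop M) \<and>
     (\<forall>(U, c)\<in>matlas M.
        openin (mtop M) U \<and> openin (powertop_real (midx M)) (c ` U) \<and>
        homeomorphic_map (subtopology (mtop M) U) (subtopology (powertop_real (midx M)) (c ` U)) c) \<and>
     (\<forall>(U, c)\<in>matlas M. \<forall>(U', c')\<in>matlas M. \<forall>k\<in>midx M.
        Cinf_on (midx M) (c ` (U \<inter> U')) (\<lambda>x. c' (inv_into U c x) k))"

definition smooth_fun_on :: "('a, 'k) manifold \<Rightarrow> 'a set \<Rightarrow> ('a \<Rightarrow> real) \<Rightarrow> bool" where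
  "smooth_fun_on M V f \<longleftrightarrow>
     openin (mtop M) V \<and>
     (\<forall>(U, c)\<in>matlas M. Cinf_on (midx M) (c ` (U \<inter> V)) (\<lambda>x. f (inv_into U c x)))"

definition smooth_near :: "('a, 'k) manifold \<Rightarrow> 'a \<Rightarrow> ('a \<Rightarrow> real) \<Rightarrow> bool" where
  "smooth_near M p f \<longleftrightarrow> (\<exists>V. p \<in> V \<and> smooth_fun_on M V f)"

definition coord_vec ::
  "('a, 'k) manifold \<Rightarrow> 'a set \<times> ('a \<Rightarrow> 'k \<Rightarrow> real) \<Rightarrow> 'k \<Rightarrow> 'a vfield" where
  "coord_vec M = (\<lambda>(U, c) k p f.
     if smooth_near M p f then partial_deriv k (\<lambda>x. f (inv_into U c x)) (c p) else 0)"

definition tangent_space :: "('a, 'k) manifold \<Rightarrow> 'a \<Rightarrow> 'a tvec set" where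
  "tangent_space M p =
     {\<lambda>f. (\<Sum>k\<in>midx M. a k * coord_vec M (U, c) k p f) | U c a. (U, c) \<in> matlas M \<and> p \<in> U}"

definition smooth_field_on :: "('a, 'k) manifold \<Rightarrow> 'a set \<Rightarrow> 'a vfield \<Rightarrow> bool" where
  "smooth_field_on M U X \<longleftrightarrow>
     openin (mtop M) U \<and> (\<forall>q\<in>U. X q \<in> tangent_space M q) \<and>
     (\<forall>V f. V \<subseteq> U \<and> smooth_fun_on M V f \<longrightarrow> smooth_fun_on M V (\<lambda>q. X q f))"

definition lie_bracket :: "('a, 'k) manifold \<Rightarrow> 'a vfield \<Rightarrow> 'a vfield \<Rightarrow> 'a vfield" where
  "lie_bracket M X Y = (\<lambda>p f.
     if smooth_near M p f then X p (\<lambda>q. Y q f) - Y p (\<lambda>q. X q f) else 0)"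

text \<open>The differential at \<open>p\<close> of a map \<open>h\<close> into \<open>N\<close>.\<close>

definition differential_at :: "('b, 'l) manifold \<Rightarrow> ('a \<Rightarrow> 'b) \<Rightarrow> 'a \<Rightarrow> 'a tvec \<Rightarrow> 'b tvec" where
  "differential_at N h p u = (\<lambda>f. if smooth_near N (h p) f then u (\<lambda>q. f (h q)) else 0)"

definition riemannian_manifold :: "('a, 'k) manifold \<Rightarrow> bool" where
  "riemannian_manifold M \<longleftrightarrow>
     smooth_manifold M \<and>
     (\<forall>p\<in>topspace (mtop M). \<forall>u\<in>tangent_space M p. \<forall>v\<in>tangent_space M p. \<forall>w\<in>tangent_space M p.
        \<forall>a b. mmetric M p (\<lambda>f. a * u f + b * v f) w = a * mmetric M p u w + b * mmetric M p v w) \<and>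
     (\<forall>p\<in>topspace (mtop M). \<forall>u\<in>tangent_space M p. \<forall>v\<in>tangent_space M p.
        mmetric M p u v = mmetric M p v u) \<and>
     (\<forall>p\<in>topspace (mtop M). \<forall>u\<in>tangent_space M p. u \<noteq> (\<lambda>f. 0) \<longrightarrow> mmetric M p u u > 0) \<and>
     (\<forall>U X Y. smooth_field_on M U X \<and> smooth_field_on M U Y \<longrightarrow>
        smooth_fun_on M U (\<lambda>q. mmetric M q (X q) (Y q)))"


section \<open>Connections and curvature\<close>

text \<open>
  A connection acts on vector fields on arbitrary open subsets of \<open>M\<close>, compatibly with
  restriction. Since vector fields are total functions in HOL, the result is only constrained on
  open sets on which the arguments are smooth.
\<close>

definition affine_connection :: "('a, 'k) manifold \<Rightarrow> ('a vfield \<Rightarrow> 'a vfield \<Rightarrow> 'a vfield) \<Rightarrow> bool" where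
  "affine_connection M D \<longleftrightarrow>
     (\<forall>U X Y. smooth_field_on M U X \<and> smooth_field_on M U Y \<longrightarrow> smooth_field_on M U (D X Y)) \<and>
     (\<forall>U X X' Y Y'.
        smooth_field_on M U X \<and> smooth_field_on M U Y \<and>
        (\<forall>q\<in>U. X' q = X q) \<and> (\<forall>q\<in>U. Y' q = Y q) \<longrightarrow> (\<forall>q\<in>U. D X' Y' q = D X Y q)) \<and>
     (\<forall>U X Y Z. smooth_field_on M U X \<and> smooth_field_on M U Y \<and> smooth_field_on M U Z \<longrightarrow>
        (\<forall>q\<in>U. D (\<lambda>q f. X q f + Y q f) Z q = (\<lambda>f. D X Z q f + D Y Z q f)) \<and>
        (\<forall>q\<in>U. D Z (\<lambda>q f. X q f + Y q f) q = (\<lambda>f. D Z X q f + D Z Y q f))) \<and>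
     (\<forall>U X Y h. smooth_field_on M U X \<and> smooth_field_on M U Y \<and> smooth_fun_on M U h \<longrightarrow>
        (\<forall>q\<in>U. D (\<lambda>q f. h q * X q f) Y q = (\<lambda>f. h q * D X Y q f)) \<and>
        (\<forall>q\<in>U. D X (\<lambda>q f. h q * Y q f) q = (\<lambda>f. X q h * Y q f + h q * D X Y q f)))"

definition levi_civita :: "('a, 'k) manifold \<Rightarrow> ('a vfield \<Rightarrow> 'a vfield \<Rightarrow> 'a vfield) \<Rightarrow> bool" where
  "levi_civita M D \<longleftrightarrow>
     affine_connection M D \<and>
     (\<forall>U X Y. smooth_field_on M U X \<and> smooth_field_on M U Y \<longrightarrow>
        (\<forall>q\<in>U. (\<lambda>f. D X Y q f - D Y X q f) = lie_bracket M X Y q)) \<and>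
     (\<forall>U X Y Z. smooth_field_on M U X \<and> smooth_field_on M U Y \<and> smooth_field_on M U Z \<longrightarrow>
        (\<forall>p\<in>U. X p (\<lambda>q. mmetric M q (Y q) (Z q)) =
           mmetric M p (D X Y p) (Z p) + mmetric M p (Y p) (D X Z p)))"

definition quarter_symmetric ::
  "('a, 'k) manifold \<Rightarrow> 'a vfield \<Rightarrow> real \<Rightarrow> real \<Rightarrow>
   ('a vfield \<Rightarrow> 'a vfield \<Rightarrow> 'a vfield) \<Rightarrow> ('a vfield \<Rightarrow> 'a vfield \<Rightarrow> 'a vfield)" where
  "quarter_symmetric M P lam1 lam2 D = (\<lambda>X Y p f.
     D X Y p f + lam1 * mmetric M p (Y p) (P p) * X p f - lam2 * mmetric M p (X p) (Y p) * P p f)"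

definition curvature ::
  "('a, 'k) manifold \<Rightarrow> ('a vfield \<Rightarrow> 'a vfield \<Rightarrow> 'a vfield) \<Rightarrow>
   'a vfield \<Rightarrow> 'a vfield \<Rightarrow> 'a vfield \<Rightarrow> 'a vfield" where
  "curvature M D X Y Z = (\<lambda>p f.
     D X (D Y Z) p f - D Y (D X Z) p f - D (lie_bracket M X Y) Z p f)"

definition orthonormal_frame_on :: "('a, 'k) manifold \<Rightarrow> 'a set \<Rightarrow> ('k \<Rightarrow> 'a vfield) \<Rightarrow> bool" where
  "orthonormal_frame_on M U E \<longleftrightarrow>
     (\<forall>k\<in>midx M. smooth_field_on M U (E k)) \<and>
     (\<forall>q\<in>U. \<forall>j\<in>midx M. \<forall>k\<in>midx M. j \<noteq> k \<longrightarrow> mmetric M q (E j q) (E k q) = 0) \<and>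
     (\<forall>q\<in>U. \<forall>k\<in>midx M. mmetric M q (E k q) (E k q) \<in> {-1, 1})"

text \<open>
  With this sign the unit sphere of dimension \<open>n\<close> has Ricci tensor \<open>-(n - 1) g\<close>. The local
  orthonormal frame around \<open>p\<close> is picked by \<open>SOME\<close>; the value does not depend on it.
\<close>

definition ricci ::
  "('a, 'k) manifold \<Rightarrow> ('a vfield \<Rightarrow> 'a vfield \<Rightarrow> 'a vfield) \<Rightarrow>
   'a vfield \<Rightarrow> 'a vfield \<Rightarrow> 'a \<Rightarrow> real" where
  "ricci M D X Y p =
     (let E = (SOME E. \<exists>U. openin (mtop M) U \<and> p \<in> U \<and> orthonormal_frame_on M U E)
      in \<Sum>k\<in>midx M. mmetric M p (E k p) (E k p) *
                     mmetric M p (curvature M D X (E k) Y p) (E k p))"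

text \<open>
  The identity is pointwise in \<open>X\<close> and \<open>Y\<close>, so it is required of vector fields on all open subsets.
\<close>

definition einstein ::
  "('a, 'k) manifold \<Rightarrow> ('a vfield \<Rightarrow> 'a vfield \<Rightarrow> 'a vfield) \<Rightarrow> real \<Rightarrow> bool" where
  "einstein M D \<alpha> \<longleftrightarrow>
     (\<forall>U X Y. smooth_field_on M U X \<and> smooth_field_on M U Y \<longrightarrow>
        (\<forall>p\<in>U. ricci M D X Y p = \<alpha> * mmetric M p (X p) (Y p)))"


section \<open>Generalized Kasner space-times\<close>

text \<open>
  Points are pairs \<open>(t, x)\<close> with \<open>x i \<in> F i\<close> for \<open>i \<in> {1..m}\<close>. In the product charts the coordinate
  \<open>None\<close> is \<open>t\<close>, and \<open>Some (i, a)\<close> is the \<open>a\<close>-th coordinate of \<open>x i\<close> in the chart chosen on \<open>F i\<close>.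
\<close>

definition kasner_idx :: "nat \<Rightarrow> (nat \<Rightarrow> ('a, 'k) manifold) \<Rightarrow> (nat \<times> 'k) option set" where
  "kasner_idx m F = insert None (Some ` (SIGMA i:{1..m}. midx (F i)))"

definition product_chart ::
  "real set \<Rightarrow> nat \<Rightarrow> (nat \<Rightarrow> ('a, 'k) manifold) \<Rightarrow> (nat \<Rightarrow> 'a set \<times> ('a \<Rightarrow> 'k \<Rightarrow> real)) \<Rightarrow>
   (real \<times> (nat \<Rightarrow> 'a)) set \<times> (real \<times> (nat \<Rightarrow> 'a) \<Rightarrow> (nat \<times> 'k) option \<Rightarrow> real)" where
  "product_chart I m F C =
     (I \<times> (\<Pi>\<^sub>E i\<in>{1..m}. fst (C i)),
      \<lambda>(t, x). restrict (case_option t (\<lambda>(i, a). snd (C i) (x i) a)) (kasner_idx m F))"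

definition kasner ::
  "real set \<Rightarrow> (real \<Rightarrow> real) \<Rightarrow> nat \<Rightarrow> (nat \<Rightarrow> real) \<Rightarrow> (nat \<Rightarrow> ('a, 'k) manifold) \<Rightarrow>
   (real \<times> (nat \<Rightarrow> 'a), (nat \<times> 'k) option) manifold" where
  "kasner I \<phi> m p F =
     \<lparr> mtop = prod_topology (top_of_set I) (product_topology (\<lambda>i. mtop (F i)) {1..m}),
       midx = kasner_idx m F,
       matlas = {product_chart I m F C | C. \<forall>i\<in>{1..m}. C i \<in> matlas (F i)},
       mmetric = (\<lambda>(t, x) u v.
         - (u fst * v fst) +
         (\<Sum>i=1..m. \<phi> t powr (2 * p i) *
            mmetric (F i) (x i)
              (differential_at (F i) (\<lambda>q. snd q i) (t, x) u)
              (differential_at (F i) (\<lambda>q. snd q i) (t, x) v))) \<rparr>"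

definition time_field :: "(real \<times> 'b, 'k) manifold \<Rightarrow> (real \<times> 'b) vfield" where
  "time_field M = (\<lambda>(t, x) f. if smooth_near M (t, x) f then deriv (\<lambda>s. f (s, x)) t else 0)"

definition smooth_on_interval :: "real set \<Rightarrow> (real \<Rightarrow> real) \<Rightarrow> bool" where
  "smooth_on_interval I \<phi> \<longleftrightarrow> (\<forall>k. \<forall>t\<in>I. (deriv ^^ k) \<phi> differentiable (at t))"

end

theory Submission
  imports Defs "Jordan_Normal_Form.Determinant"
begin

text \<open>
  Everything is computed in charts. In a chart, a connection \<open>D\<close> is given by coefficient functions \<open>G i k l\<close>, and
  expanding \<open>D X (D Y Z) - D Y (D X Z) - D [X, Y] Z\<close> in components yields the usual coordinate formula for the
  curvature: the second derivatives of the components of \<open>Z\<close> cancel against those hidden in the bracket, so no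
  symmetry of second partial derivatives is needed. An orthonormal frame of \<open>n\<close> vectors is a basis, so the
  frame sum that defines the Ricci tensor is the trace of \<open>V \<mapsto> R(X, V)Y\<close> in the coordinate basis.

  The Christoffel symbols of a metric are the unique symmetric coefficients compatible with it. In a
  product chart of the Kasner space-time this identifies the given Levi-Civita connection: its coefficients
  are those of the fibres together with terms in the logarithmic derivatives \<open>p\<^sub>i \<phi>' / \<phi>\<close> of the warping functions.
  The quarter-symmetric Ricci tensor is then block diagonal, its \<open>dt\<^sup>2\<close> entry gives condition (2), and its \<open>i\<close>-th
  block is \<open>Ric\<close> of \<open>F\<^sub>i\<close> plus a function of \<open>t\<close> times the metric; since \<open>Ric\<close> of \<open>F\<^sub>i\<close> does not depend on \<open>t\<close>, the
  equation of the block separates into (1) and (3).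
\<close>

section \<open>Smooth functions on open subsets of a coordinate space\<close>

text \<open>The space-time is never shown to be a \<open>smooth_manifold\<close>: what chart
  computations consume is collected in the locale \<open>atlas_manifold\<close> and established for
  it directly. A general field on the product is not a sum of lifts from the factors, so it is
  components in product charts that separate them. No Levi-Civita connection is constructed;
  everything is extracted from the axioms of the given ones. Torsion-freeness does double duty:
  besides symmetry of the coefficients it shows that the bracket of smooth fields is a smooth field,
  without which \<open>D\<close> applied to a bracket is unconstrained. No inverse metric is
  introduced. Orthonormal frames take its place, both in traces and for nondegeneracy, so they have
  to be produced: by Gram-Schmidt on the fibres, and by rescaling fibre frames on the space-time,
  whose indefinite metric does not guarantee the positive norms that Gram-Schmidt divides by. The
  constant of a fibre is read off at one fixed instant, and a positive diagonal entry of the fibre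
  metric transfers it to all other instants.\<close>

lemma powertop_open_box:
  fixes W :: "('k \<Rightarrow> real) set"
  assumes K: "finite K" and W: "openin (powertop_real K) W" and x: "x \<in> W"
  obtains d where "d > 0" "\<And>y. y \<in> extensional K \<Longrightarrow> (\<And>k. k \<in> K \<Longrightarrow> \<bar>y k - x k\<bar> < d) \<Longrightarrow> y \<in> W"
proof -
  obtain U where U: "\<And>i. i \<in> K \<Longrightarrow> open (U i)" "x \<in> Pi\<^sub>E K U" "Pi\<^sub>E K U \<subseteq> W"
    using W x unfolding openin_product_topology_alt by (metis open_openin)
  have "\<exists>e>0. \<forall>s. \<bar>s - x i\<bar> < e \<longrightarrow> s \<in> U i" if "i \<in> K" for i
  proof -
    have "x i \<in> U i" using U(2) that by auto
    with U(1)[OF that] obtain e where "e > 0" "ball (x i) e \<subseteq> U i"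
      using openE by blast
    then show ?thesis by (intro exI[of _ e]) (auto simp: subset_iff dist_real_def abs_minus_commute)
  qed
  then obtain e where e: "\<And>i. i \<in> K \<Longrightarrow> e i > 0" "\<And>i s. i \<in> K \<Longrightarrow> \<bar>s - x i\<bar> < e i \<Longrightarrow> s \<in> U i"
    by metis
  \<comment> \<open>The inserted 1 keeps the minimum defined when \<open>K\<close> is empty.\<close>
  define d where "d = Min (insert 1 (e ` K))"
  have d: "d > 0" "\<And>i. i \<in> K \<Longrightarrow> d \<le> e i"
    using K e(1) by (auto simp: d_def)
  have "y \<in> W" if "y \<in> extensional K" "\<And>k. k \<in> K \<Longrightarrow> \<bar>y k - x k\<bar> < d" for y
  proof -
    have "y k \<in> U k" if k: "k \<in> K" for k
      using e(2)[OF k] d(2)[OF k] \<open>\<And>k. k \<in> K \<Longrightarrow> \<bar>y k - x k\<bar> < d\<close>[OF k] by force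
    with that(1) have "y \<in> Pi\<^sub>E K U" by (auto simp: PiE_def)
    with U(3) show ?thesis by blast
  qed
  with d(1) that show thesis by blast
qed

text \<open>Updating one coordinate is a continuous map into the product space;
  \<open>k \<in> K\<close> keeps the update extensional. All local arguments about slices rest on
  this.\<close>

lemma eventually_slice_in:
  assumes W: "openin (powertop_real K) W" and x: "x \<in> W" and k: "k \<in> K"
  shows "\<forall>\<^sub>F s in nhds (x k). x(k := s) \<in> W"
proof -
  have xe: "x \<in> extensional K"
    using openin_subset[OF W] x by (auto simp: PiE_def)
  have c: "continuous_map euclideanreal (powertop_real K) (\<lambda>s. x(k := s))"
    unfolding continuous_map_componentwise
  proof (intro conjI ballI)
    show "(\<lambda>s. x(k := s)) ` topspace euclideanreal \<subseteq> extensional K"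
      using xe k by (auto simp: extensional_def)
    show "continuous_map euclideanreal euclideanreal (\<lambda>s. (x(k := s)) i)" for i
      by (cases "i = k") auto
  qed
  have "open {s. x(k := s) \<in> W}"
    using openin_continuous_map_preimage[OF c W] by simp
  then have "\<forall>\<^sub>F s in nhds (x k). s \<in> {s. x(k := s) \<in> W}"
    by (rule eventually_nhds_in_open) (use x in auto)
  then show ?thesis by simp
qed

text \<open>Functions are total, but only their values on the open set \<open>W\<close> carry
  meaning. The derivative of a slice sees just a neighbourhood, so values off \<open>W\<close>
  cannot influence it.\<close>

lemma partial_deriv_cong:
  assumes "openin (powertop_real K) W" "x \<in> W" "k \<in> K" "\<And>y. y \<in> W \<Longrightarrow> f y = g y"
  shows "partial_deriv k f x = partial_deriv k g x"
  unfolding partial_deriv_def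
  by (rule deriv_cong_ev, rule eventually_mono[OF eventually_slice_in[OF assms(1-3)]])
     (use assms(4) in auto)

lemma slice_differentiable_cong:
  fixes f g :: "('k \<Rightarrow> real) \<Rightarrow> real"
  assumes "openin (powertop_real K) W" "x \<in> W" "k \<in> K" "\<And>y. y \<in> W \<Longrightarrow> f y = g y"
    and "(\<lambda>s. f (x(k := s))) differentiable (at (x k))"
  shows "(\<lambda>s. g (x(k := s))) differentiable (at (x k))"
proof -
  obtain D where "((\<lambda>s. f (x(k := s))) has_real_derivative D) (at (x k))"
    using assms(5) real_differentiable_def by blast
  moreover have "\<forall>\<^sub>F s in nhds (x k). f (x(k := s)) = g (x(k := s))"
    by (rule eventually_mono[OF eventually_slice_in[OF assms(1-3)]]) (use assms(4) in auto)
  ultimately have "((\<lambda>s. g (x(k := s))) has_real_derivative D) (at (x k))"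
    by (subst (asm) DERIV_cong_ev[OF refl _ refl]) auto
  then show ?thesis using real_differentiable_def by blast
qed

lemma Ck_on_Suc_differentiable:
  assumes "Ck_on (Suc r) K W f" "k \<in> K" "x \<in> W"
  shows "(\<lambda>s. f (x(k := s))) differentiable (at (x k))"
proof -
  from assms(1) have "\<forall>k\<in>K. (\<forall>x\<in>W. (\<lambda>s. f (x(k := s))) differentiable (at (x k))) \<and>
             Ck_on r K W (partial_deriv k f)"
    unfolding Ck_on.simps by (rule conjunct2)
  from bspec[OF conjunct1[OF bspec[OF this assms(2)]] assms(3)] show ?thesis .
qed

lemma Ck_on_Suc_partial: "Ck_on (Suc r) K W f \<Longrightarrow> k \<in> K \<Longrightarrow> Ck_on r K W (partial_deriv k f)"
  by simp

lemma Ck_on_cong: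
  assumes W: "openin (powertop_real K) W" and "\<And>y. y \<in> W \<Longrightarrow> f y = g y" "Ck_on r K W f"
  shows "Ck_on r K W g"
  using assms(2,3)
proof (induction r arbitrary: f g)
  case 0
  then show ?case using openin_subset[OF W]
    by (auto intro!: continuous_map_eq[of _ _ f])
next
  case (Suc r)
  have "continuous_map (subtopology (powertop_real K) W) euclideanreal g"
    by (rule continuous_map_eq[of _ _ f]) (use Suc.prems in simp_all)
  moreover have "Ck_on r K W (partial_deriv k g)" if k: "k \<in> K" for k
  proof (rule Suc.IH[of "partial_deriv k f"])
    show "partial_deriv k f y = partial_deriv k g y" if "y \<in> W" for y
      by (rule partial_deriv_cong[OF W that k Suc.prems(1)])
  qed (use Suc.prems(2) k in simp)
  moreover have "(\<lambda>s. g (x(k := s))) differentiable (at (x k))" if "k \<in> K" "x \<in> W" for k x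
    by (rule slice_differentiable_cong[OF W that(2,1) Suc.prems(1) Ck_on_Suc_differentiable[OF Suc.prems(2) that]])
  ultimately show ?case unfolding Ck_on.simps by blast
qed

lemma Ck_on_subset:
  assumes "W' \<subseteq> W" "Ck_on r K W f"
  shows "Ck_on r K W' f"
  using assms(2)
proof (induction r arbitrary: f)
  case 0
  then show ?case using assms(1) continuous_map_from_subtopology_mono by auto
next
  case (Suc r)
  then show ?case using assms(1) continuous_map_from_subtopology_mono by auto blast+
qed

lemma Ck_on_SucD: "Ck_on (Suc r) K W f \<Longrightarrow> Ck_on r K W f"
proof (induction r arbitrary: f)
  case (Suc r)
  then have "\<And>k. k \<in> K \<Longrightarrow> Ck_on r K W (partial_deriv k f)" by auto
  with Suc.prems show ?case by simp
qed simp

lemma Ck_on_continuous: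
  "Ck_on r K W f \<Longrightarrow> continuous_map (subtopology (powertop_real K) W) euclideanreal f"
  by (cases r) auto

lemma Ck_on_slice_deriv:
  assumes "Ck_on (Suc r) K W f" "k \<in> K" "x \<in> W"
  shows "((\<lambda>s. f (x(k := s))) has_real_derivative partial_deriv k f x) (at (x k))"
  unfolding partial_deriv_def
  using Ck_on_Suc_differentiable[OF assms] by (simp only: DERIV_deriv_iff_real_differentiable)

text \<open>The candidates \<open>f'\<close> are only compared with \<open>partial_deriv\<close> on \<open>W\<close>, outside of which the latter may be junk.\<close>

lemma Ck_on_SucI:
  assumes W: "openin (powertop_real K) W"
    and "continuous_map (subtopology (powertop_real K) W) euclideanreal f"
    and der: "\<And>k x. k \<in> K \<Longrightarrow> x \<in> W \<Longrightarrow> ((\<lambda>s. f (x(k := s))) has_real_derivative f' k x) (at (x k))"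
    and "\<And>k. k \<in> K \<Longrightarrow> Ck_on r K W (f' k)"
  shows "Ck_on (Suc r) K W f"
proof -
  have "Ck_on r K W (partial_deriv k f)" if "k \<in> K" for k
    by (rule Ck_on_cong[OF W _ assms(4)[OF that]])
       (use DERIV_imp_deriv[OF der[OF that]] in \<open>auto simp: partial_deriv_def\<close>)
  moreover have "(\<lambda>s. f (x(k := s))) differentiable (at (x k))" if "k \<in> K" "x \<in> W" for k x
    unfolding real_differentiable_def using der[OF that] by blast
  ultimately show ?thesis using assms(2) unfolding Ck_on.simps by blast
qed

section \<open>Algebra of \<open>r\<close> times continuously differentiable functions\<close>

lemma Ck_on_const:
  assumes W: "openin (powertop_real K) W"
  shows "Ck_on r K W (\<lambda>x. c)"
proof (induction r arbitrary: c)
  case (Suc r)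
  show ?case by (rule Ck_on_SucI[OF W, where f' = "\<lambda>k x. 0"]) (use Suc in auto)
qed simp

lemma Ck_on_proj:
  assumes W: "openin (powertop_real K) W" and k: "k \<in> K"
  shows "Ck_on r K W (\<lambda>x. x k)"
proof (cases r)
  case 0
  then show ?thesis using k by (auto intro: continuous_map_from_subtopology continuous_map_product_projection)
next
  case (Suc r')
  have "Ck_on (Suc r') K W (\<lambda>x. x k)"
  proof (rule Ck_on_SucI[OF W, where f' = "\<lambda>j x. if j = k then 1 else 0"])
    show "continuous_map (subtopology (powertop_real K) W) euclideanreal (\<lambda>x. x k)"
      using k by (auto intro: continuous_map_from_subtopology continuous_map_product_projection)
    show "((\<lambda>s. (x(j := s)) k) has_real_derivative (if j = k then 1 else 0)) (at (x j))" for j x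
      by auto
  qed (auto intro: Ck_on_const[OF W])
  with Suc show ?thesis by simp
qed

lemma Ck_on_add:
  assumes W: "openin (powertop_real K) W" and "Ck_on r K W f" "Ck_on r K W g"
  shows "Ck_on r K W (\<lambda>x. f x + g x)"
  using assms(2,3)
proof (induction r arbitrary: f g)
  case (Suc r)
  show ?case
  proof (rule Ck_on_SucI[OF W, where f' = "\<lambda>k x. partial_deriv k f x + partial_deriv k g x"])
    show "((\<lambda>s. f (x(k := s)) + g (x(k := s))) has_real_derivative
            partial_deriv k f x + partial_deriv k g x) (at (x k))"
      if "k \<in> K" "x \<in> W" for k x
      by (rule DERIV_add[OF Ck_on_slice_deriv[OF Suc.prems(1) that] Ck_on_slice_deriv[OF Suc.prems(2) that]])
  qed (use Suc in \<open>auto intro!: continuous_map_add\<close>)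
qed (auto intro: continuous_map_add)

lemma Ck_on_mult:
  assumes W: "openin (powertop_real K) W" and "Ck_on r K W f" "Ck_on r K W g"
  shows "Ck_on r K W (\<lambda>x. f x * g x)"
  using assms(2,3)
proof (induction r arbitrary: f g)
  case (Suc r)
  show ?case
  proof (rule Ck_on_SucI[OF W, where f' = "\<lambda>k x. partial_deriv k f x * g x + partial_deriv k g x * f x"])
    show "((\<lambda>s. f (x(k := s)) * g (x(k := s))) has_real_derivative
            partial_deriv k f x * g x + partial_deriv k g x * f x) (at (x k))"
      if "k \<in> K" "x \<in> W" for k x
      using DERIV_mult[OF Ck_on_slice_deriv[OF Suc.prems(1) that] Ck_on_slice_deriv[OF Suc.prems(2) that]]
      by (simp only: fun_upd_triv)
    show "Ck_on r K W (\<lambda>x. partial_deriv k f x * g x + partial_deriv k g x * f x)" if "k \<in> K" for k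
      by (intro Ck_on_add[OF W] Suc.IH Ck_on_Suc_partial[OF _ that] Suc.prems Ck_on_SucD[OF Suc.prems(1)]
          Ck_on_SucD[OF Suc.prems(2)])
  qed (use Suc.prems in \<open>auto intro!: continuous_map_real_mult\<close>)
qed (auto intro: continuous_map_real_mult)

lemma Ck_on_sum:
  assumes W: "openin (powertop_real K) W" and "\<And>a. a \<in> A \<Longrightarrow> Ck_on r K W (f a)"
  shows "Ck_on r K W (\<lambda>x. \<Sum>a\<in>A. f a x)"
  using assms(2)
  by (induction A rule: infinite_finite_induct) (auto intro: Ck_on_const[OF W] Ck_on_add[OF W])

text \<open>The exponent is generalised in the induction because each derivative lowers it by one;
  positivity of \<open>f\<close> on \<open>W\<close> keeps \<open>powr\<close>
  differentiable.\<close>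

lemma Ck_on_powr:
  assumes W: "openin (powertop_real K) W" and "Ck_on r K W f" and pos: "\<And>x. x \<in> W \<Longrightarrow> f x > 0"
  shows "Ck_on r K W (\<lambda>x. f x powr a)"
  using assms(2)
proof (induction r arbitrary: a)
  case 0
  then have "continuous_on {0<..} (\<lambda>y::real. y powr a)"
    by (intro continuous_intros) auto
  moreover have "continuous_map (subtopology (powertop_real K) W) (top_of_set {0<..}) f"
    using 0 pos by (auto simp: continuous_map_in_subtopology)
  ultimately have "continuous_map (subtopology (powertop_real K) W) euclideanreal ((\<lambda>y. y powr a) \<circ> f)"
    by (intro continuous_map_compose) auto
  then show ?case by (simp add: o_def)
next
  case (Suc r)
  have "continuous_map (subtopology (powertop_real K) W) euclideanreal (\<lambda>x. f x powr a)"
    using Ck_on_continuous[OF Suc.IH[OF Ck_on_SucD[OF Suc.prems]]] .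
  then show ?case
  proof (rule Ck_on_SucI[OF W, where f' = "\<lambda>k x. a * f x powr (a - 1) * partial_deriv k f x"])
    show "((\<lambda>s. f (x(k := s)) powr a) has_real_derivative
            a * f x powr (a - 1) * partial_deriv k f x) (at (x k))"
      if "k \<in> K" "x \<in> W" for k x
      using DERIV_fun_powr[OF Ck_on_slice_deriv[OF Suc.prems that], of a, unfolded fun_upd_triv]
        pos[OF that(2)] by (simp only: of_nat_1)
    show "Ck_on r K W (\<lambda>x. a * f x powr (a - 1) * partial_deriv k f x)" if "k \<in> K" for k
      using Suc.prems that
      by (intro Ck_on_mult[OF W] Ck_on_const[OF W] Suc.IH[OF Ck_on_SucD]) auto
  qed
qed

text \<open>\<open>h\<close> is generalised because the derivative along coordinate \<open>k\<close>
  is \<open>deriv h\<close> of the same coordinate, and \<open>smooth_on_interval\<close> passes to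
  \<open>deriv h\<close> by shifting the iterates.\<close>

lemma Ck_on_fun_of_coord:
  assumes W: "openin (powertop_real K) W" and k: "k \<in> K"
    and I: "\<And>x. x \<in> W \<Longrightarrow> x k \<in> I" and h: "smooth_on_interval I h"
  shows "Ck_on r K W (\<lambda>x. h (x k))"
  using h
proof (induction r arbitrary: h)
  case (0 h)
  have "continuous_on I h"
    using 0 unfolding smooth_on_interval_def
    by (metis continuous_at_imp_continuous_on differentiable_imp_continuous_within funpow_0)
  moreover have "continuous_map (subtopology (powertop_real K) W) (top_of_set I) (\<lambda>x. x k)"
    using I k by (auto simp: continuous_map_in_subtopology
        intro: continuous_map_from_subtopology continuous_map_product_projection)
  ultimately have "continuous_map (subtopology (powertop_real K) W) euclideanreal (h \<circ> (\<lambda>x. x k))"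
    by (intro continuous_map_compose) auto
  then show ?case by (simp add: o_def)
next
  case (Suc r h)
  have h': "smooth_on_interval I (deriv h)"
    using Suc.prems unfolding smooth_on_interval_def
    by (metis comp_apply funpow_Suc_right)
  have "continuous_map (subtopology (powertop_real K) W) euclideanreal (\<lambda>x. h (x k))"
    using Ck_on_continuous[OF Suc.IH[OF Suc.prems]] .
  then show ?case
  proof (rule Ck_on_SucI[OF W, where f' = "\<lambda>j x. if j = k then deriv h (x k) else 0"])
    show "((\<lambda>s. h ((x(j := s)) k)) has_real_derivative (if j = k then deriv h (x k) else 0)) (at (x j))"
      if "x \<in> W" for j x
    proof -
      have "h differentiable (at (x k))"
        using Suc.prems I[OF that] unfolding smooth_on_interval_def by (metis funpow_0)
      then show ?thesis by (auto simp: DERIV_deriv_iff_real_differentiable)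
    qed
    show "Ck_on r K W (\<lambda>x. if j = k then deriv h (x k) else 0)" for j
      using Suc.IH[OF h'] by (cases "j = k") (auto intro: Ck_on_const[OF W])
  qed
qed

text \<open>Continuity of the partial derivatives gives total differentiability: go from
  \<open>x\<close> to \<open>y\<close> one coordinate at a time and apply the mean value inequality
  to each leg. The error is measured in the sum norm since each leg contributes its own coordinate
  difference.\<close>

lemma C1_total_differentiable:
  assumes K: "finite K" and W: "openin (powertop_real K) W" and f: "Ck_on (Suc 0) K W f"
    and x: "x \<in> W" and \<epsilon>: "\<epsilon> > 0"
  obtains d where "d > 0"
    "\<And>y. y \<in> extensional K \<Longrightarrow> (\<And>k. k \<in> K \<Longrightarrow> \<bar>y k - x k\<bar> < d) \<Longrightarrow>
       \<bar>f y - f x - (\<Sum>k\<in>K. partial_deriv k f x * (y k - x k))\<bar> \<le> \<epsilon> * (\<Sum>k\<in>K. \<bar>y k - x k\<bar>)"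
proof -
  \<comment> \<open>On this neighbourhood every partial derivative stays within \<epsilon> of its
    value at \<open>x\<close>; a box inside it will contain the whole path.\<close>
  define V where "V = {y \<in> W. \<forall>k\<in>K. \<bar>partial_deriv k f y - partial_deriv k f x\<bar> < \<epsilon>}"
  have xe: "x \<in> extensional K"
    using openin_subset[OF W] x by (auto simp: PiE_def)
  have Vk: "openin (powertop_real K) {y \<in> W. \<bar>partial_deriv k f y - partial_deriv k f x\<bar> < \<epsilon>}" if "k \<in> K" for k
  proof -
    have cm: "continuous_map (subtopology (powertop_real K) W) euclideanreal (partial_deriv k f)"
      using f that by simp
    have op: "openin euclideanreal {s. \<bar>s - partial_deriv k f x\<bar> < \<epsilon>}"
      unfolding open_openin[symmetric] by (intro open_Collect_less continuous_intros)
    have "openin (subtopology (powertop_real K) W)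
        {y \<in> topspace (subtopology (powertop_real K) W). partial_deriv k f y \<in> {s. \<bar>s - partial_deriv k f x\<bar> < \<epsilon>}}"
      by (rule openin_continuous_map_preimage[OF cm op])
    then have "openin (powertop_real K)
        {y \<in> topspace (subtopology (powertop_real K) W). partial_deriv k f y \<in> {s. \<bar>s - partial_deriv k f x\<bar> < \<epsilon>}}"
      using W openin_trans_full by blast
    moreover have "topspace (subtopology (powertop_real K) W) = W"
      using openin_subset[OF W] by auto
    ultimately show ?thesis by (simp only: mem_Collect_eq)
  qed
  have "openin (powertop_real K) V"
  proof (cases "K = {}")
    case True
    then have "V = W" by (auto simp: V_def)
    with W show ?thesis by simp
  next
    case False
    then have "V = (\<Inter>k\<in>K. {y \<in> W. \<bar>partial_deriv k f y - partial_deriv k f x\<bar> < \<epsilon>})"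
      by (auto simp: V_def)
    then show ?thesis using openin_INT2[OF K False Vk] by (simp only:)
  qed
  then obtain d where d: "d > 0"
    "\<And>y. y \<in> extensional K \<Longrightarrow> (\<And>k. k \<in> K \<Longrightarrow> \<bar>y k - x k\<bar> < d) \<Longrightarrow> y \<in> V"
    using powertop_open_box[OF K, of V x] x \<epsilon> by (auto simp: V_def)
  have "\<bar>f y - f x - (\<Sum>k\<in>K. partial_deriv k f x * (y k - x k))\<bar> \<le> \<epsilon> * (\<Sum>k\<in>K. \<bar>y k - x k\<bar>)"
    if y: "y \<in> extensional K" "\<And>k. k \<in> K \<Longrightarrow> \<bar>y k - x k\<bar> < d" for y
  proof -
    \<comment> \<open>A corner of the path: the coordinates in \<open>J\<close> have already been
      moved to those of \<open>y\<close>.\<close>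
    define z where "z J = (\<lambda>k. if k \<in> J then y k else x k)" for J
    have "\<bar>f (z J) - f x - (\<Sum>k\<in>J. partial_deriv k f x * (y k - x k))\<bar> \<le> \<epsilon> * (\<Sum>k\<in>J. \<bar>y k - x k\<bar>)"
      if "finite J" "J \<subseteq> K" for J
      using that
    proof (induction J rule: finite_induct)
      case empty
      then show ?case by (simp add: z_def)
    next
      case (insert j J)
      \<comment> \<open>Subtracting the linear part leaves a function of one variable whose
        derivative is bounded by \<epsilon>.\<close>
      let ?g = "\<lambda>s. f ((z J)(j := s)) - partial_deriv j f x * s"
      have j: "j \<in> K" using insert.prems by simp
      have inV: "(z J)(j := s) \<in> V" if "\<bar>s - x j\<bar> < d" for s
        by (rule d(2)) (use xe y that j d(1) in \<open>auto simp: z_def extensional_def\<close>)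
      have "norm (?g (y j) - ?g (x j)) \<le> \<epsilon> * norm (y j - x j)"
      proof (rule field_differentiable_bound[of "ball (x j) d" ?g
            "\<lambda>s. partial_deriv j f ((z J)(j := s)) - partial_deriv j f x"])
        fix s assume "s \<in> ball (x j) d"
        then have s: "(z J)(j := s) \<in> V" using inV by (simp add: dist_real_def abs_minus_commute)
        have "((\<lambda>s'. f (((z J)(j := s))(j := s'))) has_real_derivative partial_deriv j f ((z J)(j := s)))
                (at (((z J)(j := s)) j))"
          by (rule Ck_on_slice_deriv[OF f j]) (use s in \<open>simp add: V_def\<close>)
        then have "((\<lambda>s'. f ((z J)(j := s'))) has_real_derivative partial_deriv j f ((z J)(j := s))) (at s)"
          by simp
        then have "(?g has_real_derivative (partial_deriv j f ((z J)(j := s)) - partial_deriv j f x)) (at s)"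
          by (auto intro!: derivative_eq_intros)
        then show "(?g has_real_derivative (partial_deriv j f ((z J)(j := s)) - partial_deriv j f x))
                (at s within ball (x j) d)"
          by (rule DERIV_subset) simp
        show "norm (partial_deriv j f ((z J)(j := s)) - partial_deriv j f x) \<le> \<epsilon>"
          using s j by (auto simp: V_def intro: less_imp_le)
      next
        have "\<bar>y j - x j\<bar> < d" by (rule y(2)[OF j])
        then show "y j \<in> ball (x j) d" by (simp add: dist_real_def abs_minus_commute)
      qed (use d(1) in auto)
      moreover have "(z J)(j := y j) = z (insert j J)" "(z J)(j := x j) = z J"
        using insert.hyps by (auto simp: z_def fun_eq_iff)
      ultimately have "\<bar>f (z (insert j J)) - f (z J) - partial_deriv j f x * (y j - x j)\<bar> \<le> \<epsilon> * \<bar>y j - x j\<bar>"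
        by (simp add: algebra_simps)
      with insert.IH insert.prems insert.hyps show ?case
        by (simp add: distrib_left)
    qed
    from this[OF K order_refl] have "\<bar>f (z K) - f x - (\<Sum>k\<in>K. partial_deriv k f x * (y k - x k))\<bar> \<le> \<epsilon> * (\<Sum>k\<in>K. \<bar>y k - x k\<bar>)" .
    moreover have "z K = y" using xe y(1) by (auto simp: z_def extensional_def fun_eq_iff)
    ultimately show ?thesis by simp
  qed
  with d(1) that show thesis by blast
qed

text \<open>The curve is only differentiable at \<open>s0\<close>, coordinate by coordinate; total
  differentiability of \<open>f\<close> makes up for this. It serves both the composition of maps
  and the change of charts.\<close>

lemma C1_chain_rule:
  fixes \<gamma> :: "real \<Rightarrow> 'k \<Rightarrow> real"
  assumes K: "finite K" and W: "openin (powertop_real K) W" and f: "Ck_on (Suc 0) K W f"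
    and ev: "\<forall>\<^sub>F s in nhds s0. \<gamma> s \<in> W"
    and \<gamma>: "\<And>k. k \<in> K \<Longrightarrow> ((\<lambda>s. \<gamma> s k) has_real_derivative \<gamma>' k) (at s0)"
  shows "((\<lambda>s. f (\<gamma> s)) has_real_derivative (\<Sum>k\<in>K. partial_deriv k f (\<gamma> s0) * \<gamma>' k)) (at s0)"
proof -
  let ?x = "\<gamma> s0"
  have x: "?x \<in> W" using eventually_nhds_x_imp_x[OF ev] .
  have We: "y \<in> extensional K" if "y \<in> W" for y
    using openin_subset[OF W] that by (auto simp: PiE_def)
  \<comment> \<open>The added 1 makes \<open>L\<close> positive and strictly larger than the limit
    of the quotient sums, so that it bounds them near \<open>s0\<close>.\<close>
  define L where "L = (\<Sum>k\<in>K. \<bar>\<gamma>' k\<bar>) + 1"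
  have L: "L > 0" by (simp add: L_def add_nonneg_pos sum_nonneg)
  define q where "q k s = (\<gamma> s k - ?x k) / (s - s0)" for k s
  have q: "(q k \<longlongrightarrow> \<gamma>' k) (at s0)" if "k \<in> K" for k
    using \<gamma>[OF that] unfolding has_field_derivative_iff q_def .
  have "((\<lambda>s. \<Sum>k\<in>K. \<bar>q k s\<bar>) \<longlongrightarrow> (\<Sum>k\<in>K. \<bar>\<gamma>' k\<bar>)) (at s0)"
    by (intro tendsto_sum tendsto_rabs q)
  then have evL: "\<forall>\<^sub>F s in at s0. (\<Sum>k\<in>K. \<bar>q k s\<bar>) < L"
    by (rule order_tendstoD) (simp add: L_def)
  have "((\<lambda>s. (f (\<gamma> s) - f ?x) / (s - s0) - (\<Sum>k\<in>K. partial_deriv k f ?x * q k s)) \<longlongrightarrow> 0) (at s0)"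
  proof (rule tendstoI)
    fix e :: real assume e: "e > 0"
    define \<epsilon> where "\<epsilon> = e / (2 * L)"
    have \<epsilon>: "\<epsilon> > 0" using e L by (simp add: \<epsilon>_def)
    obtain d where d: "d > 0"
      "\<And>y. y \<in> extensional K \<Longrightarrow> (\<And>k. k \<in> K \<Longrightarrow> \<bar>y k - ?x k\<bar> < d) \<Longrightarrow>
       \<bar>f y - f ?x - (\<Sum>k\<in>K. partial_deriv k f ?x * (y k - ?x k))\<bar> \<le> \<epsilon> * (\<Sum>k\<in>K. \<bar>y k - ?x k\<bar>)"
      by (rule C1_total_differentiable[OF K W f x \<epsilon>]) blast
    have near: "\<forall>\<^sub>F s in at s0. \<forall>k\<in>K. \<bar>\<gamma> s k - ?x k\<bar> < d"
    proof (rule eventually_ball_finite[OF K], rule ballI)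
      fix k assume "k \<in> K"
      then have "((\<lambda>s. \<gamma> s k) \<longlongrightarrow> ?x k) (at s0)"
        using DERIV_isCont[OF \<gamma>] by (simp add: isCont_def)
      from tendstoD[OF this d(1)] show "\<forall>\<^sub>F s in at s0. \<bar>\<gamma> s k - ?x k\<bar> < d"
        by (simp add: dist_real_def)
    qed
    have inW: "\<forall>\<^sub>F s in at s0. \<gamma> s \<in> W"
      using ev eventually_nhds_conv_at by blast
    have ne: "\<forall>\<^sub>F s in at s0. s \<noteq> s0"
      by (simp add: eventually_at_filter)
    show "\<forall>\<^sub>F s in at s0. dist ((f (\<gamma> s) - f ?x) / (s - s0) - (\<Sum>k\<in>K. partial_deriv k f ?x * q k s)) 0 < e"
      using evL near inW ne
    proof eventually_elim
      fix s assume s: "(\<Sum>k\<in>K. \<bar>q k s\<bar>) < L" "\<forall>k\<in>K. \<bar>\<gamma> s k - ?x k\<bar> < d" "\<gamma> s \<in> W" "s \<noteq> s0"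
      let ?N = "f (\<gamma> s) - f ?x - (\<Sum>k\<in>K. partial_deriv k f ?x * (\<gamma> s k - ?x k))"
      have "\<bar>?N\<bar> \<le> \<epsilon> * (\<Sum>k\<in>K. \<bar>\<gamma> s k - ?x k\<bar>)"
        using d(2)[OF We[OF s(3)]] s(2) by blast
      then have "\<bar>?N\<bar> / \<bar>s - s0\<bar> \<le> \<epsilon> * (\<Sum>k\<in>K. \<bar>\<gamma> s k - ?x k\<bar>) / \<bar>s - s0\<bar>"
        by (rule divide_right_mono) simp
      also have "\<dots> = \<epsilon> * (\<Sum>k\<in>K. \<bar>q k s\<bar>)"
        by (simp add: q_def abs_divide flip: sum_divide_distrib)
      also have "\<dots> \<le> \<epsilon> * L" using s(1) \<epsilon> by (intro mult_left_mono) auto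
      also have "\<dots> < e" using e L by (simp add: \<epsilon>_def)
      finally have "\<bar>?N / (s - s0)\<bar> < e" by (simp add: abs_divide)
      moreover have "?N / (s - s0) = (f (\<gamma> s) - f ?x) / (s - s0) - (\<Sum>k\<in>K. partial_deriv k f ?x * q k s)"
        unfolding diff_divide_distrib[of _ "sum _ _"] sum_divide_distrib by (simp add: q_def)
      ultimately show "dist ((f (\<gamma> s) - f ?x) / (s - s0) - (\<Sum>k\<in>K. partial_deriv k f ?x * q k s)) 0 < e"
        by (simp add: dist_real_def)
    qed
  qed
  moreover have "((\<lambda>s. \<Sum>k\<in>K. partial_deriv k f ?x * q k s) \<longlongrightarrow> (\<Sum>k\<in>K. partial_deriv k f ?x * \<gamma>' k)) (at s0)"
    by (intro tendsto_sum tendsto_mult tendsto_const q)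
  ultimately have "((\<lambda>s. ((f (\<gamma> s) - f ?x) / (s - s0) - (\<Sum>k\<in>K. partial_deriv k f ?x * q k s))
        + (\<Sum>k\<in>K. partial_deriv k f ?x * q k s)) \<longlongrightarrow> 0 + (\<Sum>k\<in>K. partial_deriv k f ?x * \<gamma>' k)) (at s0)"
    by (rule tendsto_add)
  then show ?thesis by (simp add: has_field_derivative_iff)
qed

text \<open>By the chain rule a partial derivative of the composite is a sum of products of partials
  of \<open>f\<close>, again composed with \<open>T\<close>, and partials of the components of
  \<open>T\<close>; hence \<open>f\<close> varies in the induction while \<open>T\<close> is fixed.
  Two index sets occur because charts of the product are compared with charts of a fibre.\<close>

lemma Ck_on_compose_map:
  fixes T :: "('j \<Rightarrow> real) \<Rightarrow> 'k \<Rightarrow> real"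
  assumes K: "finite K" and W: "openin (powertop_real K) W" and W': "openin (powertop_real K') W'"
    and T: "\<And>y. y \<in> W' \<Longrightarrow> T y \<in> W"
    and Tk: "\<And>k. k \<in> K \<Longrightarrow> Ck_on r K' W' (\<lambda>y. T y k)"
    and f: "Ck_on r K W f"
  shows "Ck_on r K' W' (\<lambda>y. f (T y))"
  using Tk f
proof (induction r arbitrary: f)
  case (0 f)
  have "continuous_map (subtopology (powertop_real K') W') (subtopology (powertop_real K) W) T"
  proof -
    have "topspace (subtopology (powertop_real K') W') = W'"
      using openin_subset[OF W'] by auto
    moreover have "T ` W' \<subseteq> W" using T by blast
    moreover have "W \<subseteq> extensional K" using openin_subset[OF W] by (auto simp: PiE_def)
    ultimately show ?thesis using 0(1)
      by (auto simp: continuous_map_in_subtopology continuous_map_componentwise)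
  qed
  from continuous_map_compose[OF this, of euclideanreal f] 0(2) show ?case by (simp add: o_def)
next
  case (Suc r f)
  have IH: "Ck_on r K' W' (\<lambda>y. g (T y))" if "Ck_on r K W g" for g
    using Suc.IH Suc.prems(1) that Ck_on_SucD by blast
  have "continuous_map (subtopology (powertop_real K') W') euclideanreal (\<lambda>y. f (T y))"
    using Ck_on_continuous[OF IH[OF Ck_on_SucD[OF Suc.prems(2)]]] .
  moreover have "Ck_on (Suc 0) K W f"
    using Ck_on_continuous[OF Ck_on_Suc_partial[OF Suc.prems(2)]] Suc.prems(2) by simp
  ultimately show ?case
  proof (intro Ck_on_SucI[OF W', where f' = "\<lambda>j y. \<Sum>k\<in>K. partial_deriv k f (T y) * partial_deriv j (\<lambda>y. T y k) y"])
    show "((\<lambda>s. f (T (y(j := s)))) has_real_derivative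
            (\<Sum>k\<in>K. partial_deriv k f (T y) * partial_deriv j (\<lambda>y. T y k) y)) (at (y j))"
      if f1: "Ck_on (Suc 0) K W f" and j: "j \<in> K'" and y: "y \<in> W'" for j y
    proof -
      have "((\<lambda>s. f (T (y(j := s)))) has_real_derivative
            (\<Sum>k\<in>K. partial_deriv k f (T (y(j := y j))) * partial_deriv j (\<lambda>y. T y k) y)) (at (y j))"
      proof (rule C1_chain_rule[OF K W f1])
        show "\<forall>\<^sub>F s in nhds (y j). T (y(j := s)) \<in> W"
          by (rule eventually_mono[OF eventually_slice_in[OF W' y j]]) (rule T)
        show "((\<lambda>s. T (y(j := s)) k) has_real_derivative partial_deriv j (\<lambda>y. T y k) y) (at (y j))"
          if "k \<in> K" for k
          by (rule Ck_on_slice_deriv[OF Suc.prems(1)[OF that] j y])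
      qed
      then show ?thesis by simp
    qed
    show "Ck_on r K' W' (\<lambda>y. \<Sum>k\<in>K. partial_deriv k f (T y) * partial_deriv j (\<lambda>y. T y k) y)"
      if j: "j \<in> K'" for j
    proof (intro Ck_on_sum[OF W'] Ck_on_mult[OF W'])
      show "Ck_on r K' W' (\<lambda>y. partial_deriv k f (T y))" if "k \<in> K" for k
        by (rule IH) (use Suc.prems(2) that in simp)
      show "Ck_on r K' W' (partial_deriv j (\<lambda>y. T y k))" if "k \<in> K" for k
        using Suc.prems(1)[OF that] j by simp
    qed
  qed
qed

section \<open>Charts and tangent vectors\<close>

text \<open>What chart computations draw from a manifold, phrased so that it can be verified for
  product charts as well as derived from \<open>smooth_manifold\<close>. Openness of the domains of
  transition functions follows from \<open>chart_image_open\<close>.\<close>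

locale atlas_manifold =
  fixes M :: "('a, 'k) manifold"
  assumes finite_midx: "finite (midx M)"
    and chart_cover: "p \<in> topspace (mtop M) \<Longrightarrow> \<exists>U c. (U, c) \<in> matlas M \<and> p \<in> U"
    and chart_open: "(U, c) \<in> matlas M \<Longrightarrow> openin (mtop M) U"
    and chart_inj: "(U, c) \<in> matlas M \<Longrightarrow> inj_on c U"
    and chart_image_open: "(U, c) \<in> matlas M \<Longrightarrow> openin (mtop M) V \<Longrightarrow> V \<subseteq> U \<Longrightarrow>
          openin (powertop_real (midx M)) (c ` V)"
    and chart_transition: "(U, c) \<in> matlas M \<Longrightarrow> (U', c') \<in> matlas M \<Longrightarrow> k \<in> midx M \<Longrightarrow>
          Ck_on r (midx M) (c ` (U \<inter> U')) (\<lambda>x. c' (inv_into U c x) k)"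

lemma smooth_manifold_atlas_manifold:
  assumes "smooth_manifold M"
  shows "atlas_manifold M"
proof
  note M = assms[unfolded smooth_manifold_def]
  show "finite (midx M)" using M by simp
  show "\<exists>U c. (U, c) \<in> matlas M \<and> p \<in> U" if "p \<in> topspace (mtop M)" for p
    using M that by fast
  show "openin (mtop M) U" if "(U, c) \<in> matlas M" for U c
    using M that by blast
  have h: "homeomorphic_map (subtopology (mtop M) U) (subtopology (powertop_real (midx M)) (c ` U)) c"
    and o: "openin (powertop_real (midx M)) (c ` U)" "openin (mtop M) U" if "(U, c) \<in> matlas M" for U c
    using M that by blast+
  show "inj_on c U" if "(U, c) \<in> matlas M" for U c
    using homeomorphic_imp_injective_map[OF h[OF that]] openin_subset[OF o(2)[OF that]]
    by (simp add: Int_absorb1)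
  show "openin (powertop_real (midx M)) (c ` V)"
    if "(U, c) \<in> matlas M" "openin (mtop M) V" "V \<subseteq> U" for U c V
  proof -
    have "openin (subtopology (mtop M) U) V"
      using that by (simp add: openin_subset_topspace_eq openin_subtopology_alt) blast
    then have "openin (subtopology (powertop_real (midx M)) (c ` U)) (c ` V)"
      using homeomorphic_imp_open_map[OF h[OF that(1)]] by (simp add: open_map_def)
    then show ?thesis using o(1)[OF that(1)] openin_trans_full by blast
  qed
  show "Ck_on r (midx M) (c ` (U \<inter> U')) (\<lambda>x. c' (inv_into U c x) k)"
    if "(U, c) \<in> matlas M" "(U', c') \<in> matlas M" "k \<in> midx M" for U c U' c' k r
  proof -
    have "\<forall>(U, c)\<in>matlas M. \<forall>(U', c')\<in>matlas M. \<forall>k\<in>midx M.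
        Cinf_on (midx M) (c ` (U \<inter> U')) (\<lambda>x. c' (inv_into U c x) k)"
      using M by blast
    then have "Cinf_on (midx M) (c ` (U \<inter> U')) (\<lambda>x. c' (inv_into U c x) k)"
      using that by fast
    then show ?thesis by (simp add: Cinf_on_def)
  qed
qed

context atlas_manifold
begin

section \<open>Smooth functions seen through charts\<close>

lemma chart_Int_image_open:
  "(U, c) \<in> matlas M \<Longrightarrow> openin (mtop M) V \<Longrightarrow> openin (powertop_real (midx M)) (c ` (U \<inter> V))"
  using chart_image_open chart_open by blast

lemma smooth_fun_on_openD: "smooth_fun_on M V f \<Longrightarrow> openin (mtop M) V"
  by (simp add: smooth_fun_on_def)

lemma smooth_fun_on_Ck:
  "smooth_fun_on M V f \<Longrightarrow> (U, c) \<in> matlas M \<Longrightarrow> Ck_on r (midx M) (c ` (U \<inter> V)) (\<lambda>x. f (inv_into U c x))"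
  unfolding smooth_fun_on_def Cinf_on_def by blast

lemma smooth_fun_onI:
  assumes "openin (mtop M) V"
    "\<And>U c r. (U, c) \<in> matlas M \<Longrightarrow> Ck_on r (midx M) (c ` (U \<inter> V)) (\<lambda>x. f (inv_into U c x))"
  shows "smooth_fun_on M V f"
  using assms chart_Int_image_open unfolding smooth_fun_on_def Cinf_on_def by blast

lemma smooth_fun_on_subset:
  assumes "smooth_fun_on M V f" "openin (mtop M) V'" "V' \<subseteq> V"
  shows "smooth_fun_on M V' f"
proof (rule smooth_fun_onI[OF assms(2)])
  show "Ck_on r (midx M) (c ` (U \<inter> V')) (\<lambda>x. f (inv_into U c x))" if "(U, c) \<in> matlas M" for U c r
    using assms(3) by (intro Ck_on_subset[OF _ smooth_fun_on_Ck[OF assms(1) that]]) blast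
qed

lemma smooth_fun_on_cong:
  assumes "smooth_fun_on M V f" "\<And>q. q \<in> V \<Longrightarrow> f q = g q"
  shows "smooth_fun_on M V g"
proof (rule smooth_fun_onI[OF smooth_fun_on_openD[OF assms(1)]])
  fix U c r assume c: "(U, c) \<in> matlas M"
  show "Ck_on r (midx M) (c ` (U \<inter> V)) (\<lambda>x. g (inv_into U c x))"
  proof (rule Ck_on_cong[OF chart_Int_image_open[OF c smooth_fun_on_openD[OF assms(1)]] _ smooth_fun_on_Ck[OF assms(1) c]])
    fix y assume "y \<in> c ` (U \<inter> V)"
    then have "inv_into U c y \<in> V" using chart_inj[OF c] by auto
    with assms(2) show "f (inv_into U c y) = g (inv_into U c y)" by simp
  qed
qed

lemma smooth_fun_on_const: "openin (mtop M) V \<Longrightarrow> smooth_fun_on M V (\<lambda>q. a)"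
  by (rule smooth_fun_onI) (auto intro: Ck_on_const chart_Int_image_open)

lemma smooth_fun_on_add:
  assumes "smooth_fun_on M V f" "smooth_fun_on M V g"
  shows "smooth_fun_on M V (\<lambda>q. f q + g q)"
  using smooth_fun_on_openD[OF assms(1)]
  by (rule smooth_fun_onI)
     (intro Ck_on_add chart_Int_image_open smooth_fun_on_Ck assms smooth_fun_on_openD[OF assms(1)])

lemma smooth_fun_on_mult:
  assumes "smooth_fun_on M V f" "smooth_fun_on M V g"
  shows "smooth_fun_on M V (\<lambda>q. f q * g q)"
  using smooth_fun_on_openD[OF assms(1)]
  by (rule smooth_fun_onI)
     (intro Ck_on_mult chart_Int_image_open smooth_fun_on_Ck assms smooth_fun_on_openD[OF assms(1)])

lemma smooth_fun_on_sum:
  assumes "openin (mtop M) V" "\<And>a. a \<in> A \<Longrightarrow> smooth_fun_on M V (f a)"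
  shows "smooth_fun_on M V (\<lambda>q. \<Sum>a\<in>A. f a q)"
  using assms(1)
  by (rule smooth_fun_onI) (intro Ck_on_sum chart_Int_image_open smooth_fun_on_Ck assms)

lemma smooth_fun_on_diff:
  assumes "smooth_fun_on M V f" "smooth_fun_on M V g"
  shows "smooth_fun_on M V (\<lambda>q. f q - g q)"
  using smooth_fun_on_add[OF assms(1) smooth_fun_on_mult[OF smooth_fun_on_const[of V "-1"] assms(2)]]
    smooth_fun_on_openD[OF assms(1)] by simp

lemma smooth_fun_on_powr:
  assumes "smooth_fun_on M V f" "\<And>q. q \<in> V \<Longrightarrow> f q > 0"
  shows "smooth_fun_on M V (\<lambda>q. f q powr a)"
proof (rule smooth_fun_onI[OF smooth_fun_on_openD[OF assms(1)]])
  fix U c r assume c: "(U, c) \<in> matlas M"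
  show "Ck_on r (midx M) (c ` (U \<inter> V)) (\<lambda>x. f (inv_into U c x) powr a)"
  proof (rule Ck_on_powr[OF chart_Int_image_open[OF c smooth_fun_on_openD[OF assms(1)]] smooth_fun_on_Ck[OF assms(1) c]])
    fix y assume "y \<in> c ` (U \<inter> V)"
    then have "inv_into U c y \<in> V" using chart_inj[OF c] by auto
    with assms(2) show "f (inv_into U c y) > 0" by simp
  qed
qed

lemma smooth_fun_on_coord:
  assumes "(U, c) \<in> matlas M" "k \<in> midx M"
  shows "smooth_fun_on M U (\<lambda>q. c q k)"
  using chart_open[OF assms(1)] by (rule smooth_fun_onI) (rule chart_transition[OF _ assms])

text \<open>One chart suffices: in any other chart the expression differs by a transition map, and
  composition preserves \<open>Ck_on\<close>.\<close>

lemma smooth_fun_on_chartI: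
  assumes c: "(U, c) \<in> matlas M" and V: "openin (mtop M) V" "V \<subseteq> U"
    and f: "\<And>r. Ck_on r (midx M) (c ` V) (\<lambda>x. f (inv_into U c x))"
  shows "smooth_fun_on M V f"
proof (rule smooth_fun_onI[OF V(1)])
  fix U' c' r assume c': "(U', c') \<in> matlas M"
  have o: "openin (powertop_real (midx M)) (c' ` (U' \<inter> V))"
    by (rule chart_Int_image_open[OF c' V(1)])
  have inv: "inv_into U' c' y \<in> U' \<inter> V" if "y \<in> c' ` (U' \<inter> V)" for y
    using that chart_inj[OF c'] by auto
  have "Ck_on r (midx M) (c' ` (U' \<inter> V)) (\<lambda>y. f (inv_into U c (c (inv_into U' c' y))))"
  proof (rule Ck_on_compose_map[OF finite_midx chart_image_open[OF c V] o, where T = "\<lambda>y. c (inv_into U' c' y)"])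
    show "Ck_on r (midx M) (c' ` (U' \<inter> V)) (\<lambda>y. c (inv_into U' c' y) k)" if "k \<in> midx M" for k
      by (rule Ck_on_subset[OF _ chart_transition[OF c' c that]]) (use V in blast)
  qed (use inv f in auto)
  then show "Ck_on r (midx M) (c' ` (U' \<inter> V)) (\<lambda>x. f (inv_into U' c' x))"
  proof (rule Ck_on_cong[OF o, rotated])
    fix y assume "y \<in> c' ` (U' \<inter> V)"
    from inv[OF this] V(2) show "f (inv_into U c (c (inv_into U' c' y))) = f (inv_into U' c' y)"
      using inv_into_f_f[OF chart_inj[OF c]] by (metis IntD2 subsetD)
  qed
qed

lemma smooth_nearI: "smooth_fun_on M V f \<Longrightarrow> p \<in> V \<Longrightarrow> smooth_near M p f"
  by (auto simp: smooth_near_def)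

lemma smooth_nearE:
  assumes "smooth_near M p f" "openin (mtop M) W" "p \<in> W"
  obtains V where "p \<in> V" "V \<subseteq> W" "smooth_fun_on M V f"
proof -
  obtain V where V: "p \<in> V" "smooth_fun_on M V f" using assms(1) by (auto simp: smooth_near_def)
  have "smooth_fun_on M (V \<inter> W) f"
    by (rule smooth_fun_on_subset[OF V(2)]) (use V smooth_fun_on_openD assms(2) in auto)
  with V(1) assms(3) that[of "V \<inter> W"] show thesis by auto
qed

lemma smooth_near_cong:
  assumes "openin (mtop M) W" "p \<in> W" "\<And>q. q \<in> W \<Longrightarrow> f q = g q"
  shows "smooth_near M p f \<longleftrightarrow> smooth_near M p g"
proof -
  have "smooth_near M p g'" if f': "smooth_near M p f'" and eq: "\<And>q. q \<in> W \<Longrightarrow> f' q = g' q" for f' g'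
  proof -
    obtain V where V: "p \<in> V" "V \<subseteq> W" "smooth_fun_on M V f'"
      by (rule smooth_nearE[OF f' assms(1,2)])
    have "smooth_fun_on M V g'"
      by (rule smooth_fun_on_cong[OF V(3)]) (use V(2) eq in blast)
    then show ?thesis using V(1) by (rule smooth_nearI)
  qed
  from this[of f g] this[of g f] assms(3) show ?thesis by auto
qed

lemma smooth_near_common:
  assumes "smooth_near M p f" "smooth_near M p g"
  obtains V where "p \<in> V" "smooth_fun_on M V f" "smooth_fun_on M V g"
proof -
  obtain W where W: "p \<in> W" "smooth_fun_on M W g" using assms(2) by (auto simp: smooth_near_def)
  obtain V where V: "p \<in> V" "V \<subseteq> W" "smooth_fun_on M V f"
    by (rule smooth_nearE[OF assms(1) smooth_fun_on_openD[OF W(2)] W(1)])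
  with that[OF V(1,3) smooth_fun_on_subset[OF W(2) smooth_fun_on_openD[OF V(3)] V(2)]]
  show thesis by simp
qed

lemma smooth_near_add:
  assumes "smooth_near M p f" "smooth_near M p g"
  shows "smooth_near M p (\<lambda>q. f q + g q)"
  by (rule smooth_near_common[OF assms]) (rule smooth_nearI[OF smooth_fun_on_add])

lemma smooth_near_mult:
  assumes "smooth_near M p f" "smooth_near M p g"
  shows "smooth_near M p (\<lambda>q. f q * g q)"
  by (rule smooth_near_common[OF assms]) (rule smooth_nearI[OF smooth_fun_on_mult])

lemma smooth_near_const: "p \<in> topspace (mtop M) \<Longrightarrow> smooth_near M p (\<lambda>q. a)"
  using smooth_fun_on_const[of "topspace (mtop M)"] by (auto intro: smooth_nearI)

lemma smooth_near_sum:
  assumes "p \<in> topspace (mtop M)" "\<And>a. a \<in> A \<Longrightarrow> smooth_near M p (f a)"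
  shows "smooth_near M p (\<lambda>q. \<Sum>a\<in>A. f a q)"
  using assms(2)
  by (induction A rule: infinite_finite_induct) (auto intro: smooth_near_const[OF assms(1)] smooth_near_add)

section \<open>Smooth vector fields\<close>

lemma smooth_field_onD:
  assumes "smooth_field_on M V X"
  shows "openin (mtop M) V" "q \<in> V \<Longrightarrow> X q \<in> tangent_space M q"
    "V' \<subseteq> V \<Longrightarrow> smooth_fun_on M V' f \<Longrightarrow> smooth_fun_on M V' (\<lambda>q. X q f)"
  using assms by (auto simp: smooth_field_on_def)

lemma smooth_field_on_subset:
  assumes "smooth_field_on M V X" "openin (mtop M) V'" "V' \<subseteq> V"
  shows "smooth_field_on M V' X"
  using assms unfolding smooth_field_on_def by (meson subset_iff)

lemma smooth_field_on_cong:
  assumes "smooth_field_on M V X" "\<And>q. q \<in> V \<Longrightarrow> X q = Y q"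
  shows "smooth_field_on M V Y"
  unfolding smooth_field_on_def
proof (intro conjI ballI allI impI)
  show "openin (mtop M) V" by (rule smooth_field_onD[OF assms(1)])
  show "Y q \<in> tangent_space M q" if "q \<in> V" for q
    using smooth_field_onD(2)[OF assms(1) that] assms(2)[OF that] by simp
  show "smooth_fun_on M V' (\<lambda>q. Y q f)" if "V' \<subseteq> V \<and> smooth_fun_on M V' f" for V' f
  proof (rule smooth_fun_on_cong)
    show "smooth_fun_on M V' (\<lambda>q. X q f)" using smooth_field_onD(3)[OF assms(1)] that by blast
    show "X q f = Y q f" if "q \<in> V'" for q using assms(2) that \<open>V' \<subseteq> V \<and> _\<close> by force
  qed
qed

lemma tangent_space_not_smooth: "u \<in> tangent_space M p \<Longrightarrow> \<not> smooth_near M p f \<Longrightarrow> u f = 0"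
  by (auto simp: tangent_space_def coord_vec_def)

end

locale chart = atlas_manifold M for M :: "('a, 'k) manifold" +
  fixes U :: "'a set" and c :: "'a \<Rightarrow> 'k \<Rightarrow> real"
  assumes chart: "(U, c) \<in> matlas M"
begin

abbreviation "K \<equiv> midx M"
abbreviation (input) "crd k \<equiv> (\<lambda>q. c q k)"
abbreviation "pd \<equiv> coord_vec M (U, c)"

lemma U_open: "openin (mtop M) U"
  by (rule chart_open[OF chart])

lemma U_topspace: "p \<in> U \<Longrightarrow> p \<in> topspace (mtop M)"
  using openin_subset[OF U_open] by blast

lemma inv_c [simp]: "q \<in> U \<Longrightarrow> inv_into U c (c q) = q"
  by (rule inv_into_f_f[OF chart_inj[OF chart]])

lemma crd_smooth_near: "p \<in> U \<Longrightarrow> k \<in> K \<Longrightarrow> smooth_near M p (crd k)"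
  by (rule smooth_nearI[OF smooth_fun_on_coord[OF chart]])

section \<open>Coordinate vectors as derivations\<close>

lemma coord_vec_not_smooth: "\<not> smooth_near M p f \<Longrightarrow> pd k p f = 0"
  by (simp add: coord_vec_def)

lemma coord_vec_deriv:
  assumes p: "p \<in> U" and f: "smooth_near M p f" and k: "k \<in> K"
  shows "((\<lambda>s. f (inv_into U c ((c p)(k := s)))) has_real_derivative pd k p f) (at (c p k))"
proof -
  obtain V where V: "p \<in> V" "smooth_fun_on M V f" using f by (auto simp: smooth_near_def)
  have "((\<lambda>s. f (inv_into U c ((c p)(k := s)))) has_real_derivative
      partial_deriv k (\<lambda>x. f (inv_into U c x)) (c p)) (at (c p k))"
    by (rule Ck_on_slice_deriv[OF smooth_fun_on_Ck[OF V(2) chart] k]) (use p V in auto)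
  with f show ?thesis by (simp only: coord_vec_def case_prod_conv if_True)
qed

lemma coord_vec_eqI:
  assumes "p \<in> U" "smooth_near M p f" "k \<in> K"
    and "((\<lambda>s. f (inv_into U c ((c p)(k := s)))) has_real_derivative d) (at (c p k))"
  shows "pd k p f = d"
  by (rule DERIV_unique[OF coord_vec_deriv[OF assms(1-3)] assms(4)])

lemma slice_inv_in:
  assumes "openin (mtop M) V" "p \<in> V" "p \<in> U" "k \<in> K"
  shows "\<forall>\<^sub>F s in nhds (c p k). inv_into U c ((c p)(k := s)) \<in> U \<inter> V \<and> (c p)(k := s) \<in> c ` (U \<inter> V)"
proof -
  have "\<forall>\<^sub>F s in nhds (c p k). (c p)(k := s) \<in> c ` (U \<inter> V)"
    by (rule eventually_slice_in[OF chart_Int_image_open[OF chart assms(1)]]) (use assms in auto)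
  then show ?thesis by (rule eventually_mono) auto
qed

text \<open>The default value 0 on functions that are not smooth near \<open>p\<close> forces a case
  distinction. Being smooth near \<open>p\<close> is itself a local property, so \<open>f\<close>
  and \<open>g\<close> always fall under the same case.\<close>

lemma coord_vec_cong:
  assumes V: "openin (mtop M) V" "p \<in> V" and p: "p \<in> U" and k: "k \<in> K"
    and eq: "\<And>q. q \<in> V \<Longrightarrow> f q = g q"
  shows "pd k p f = pd k p g"
proof (cases "smooth_near M p f")
  case True
  have g: "smooth_near M p g" using smooth_near_cong[OF V, of f g] eq True by blast
  have ev: "\<forall>\<^sub>F s in nhds (c p k). f (inv_into U c ((c p)(k := s))) = g (inv_into U c ((c p)(k := s)))"
    by (rule eventually_mono[OF slice_inv_in[OF V p k]]) (simp add: eq)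
  have "((\<lambda>s. g (inv_into U c ((c p)(k := s)))) has_real_derivative pd k p f) (at (c p k))"
    using coord_vec_deriv[OF p True k] unfolding DERIV_cong_ev[OF refl ev refl] .
  then show ?thesis using coord_vec_eqI[OF p g k] by simp
next
  case False
  moreover have "\<not> smooth_near M p g" using smooth_near_cong[OF V, of f g] eq False by blast
  ultimately show ?thesis by (simp add: coord_vec_not_smooth)
qed

lemma coord_vec_add:
  assumes "p \<in> U" "k \<in> K" "smooth_near M p f" "smooth_near M p g"
  shows "pd k p (\<lambda>q. f q + g q) = pd k p f + pd k p g"
  by (rule coord_vec_eqI[OF assms(1) smooth_near_add[OF assms(3,4)] assms(2)])
     (rule DERIV_add[OF coord_vec_deriv coord_vec_deriv]; fact)

lemma coord_vec_mult:
  assumes "p \<in> U" "k \<in> K" "smooth_near M p f" "smooth_near M p g"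
  shows "pd k p (\<lambda>q. f q * g q) = pd k p f * g p + f p * pd k p g"
proof (rule coord_vec_eqI[OF assms(1) smooth_near_mult[OF assms(3,4)] assms(2)])
  have "((\<lambda>s. f (inv_into U c ((c p)(k := s))) * g (inv_into U c ((c p)(k := s)))) has_real_derivative
      pd k p f * g (inv_into U c ((c p)(k := c p k))) + pd k p g * f (inv_into U c ((c p)(k := c p k)))) (at (c p k))"
    by (rule DERIV_mult[OF coord_vec_deriv coord_vec_deriv]) fact+
  then show "((\<lambda>s. f (inv_into U c ((c p)(k := s))) * g (inv_into U c ((c p)(k := s)))) has_real_derivative
      pd k p f * g p + f p * pd k p g) (at (c p k))"
    using assms(1) by (simp add: mult.commute)
qed

lemma coord_vec_const: "p \<in> U \<Longrightarrow> k \<in> K \<Longrightarrow> pd k p (\<lambda>q. a) = 0"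
  by (rule coord_vec_eqI) (auto intro: smooth_near_const U_topspace)

lemma coord_vec_crd:
  assumes "p \<in> U" "k \<in> K" "j \<in> K"
  shows "pd k p (crd j) = (if j = k then 1 else 0)"
proof (rule coord_vec_eqI[OF assms(1) crd_smooth_near assms(2)])
  \<comment> \<open>\<open>inv_into U c\<close> inverts \<open>c\<close> only on the image of the
    chart, so the coordinates along a slice are known just for \<open>s\<close> near
    \<open>c p k\<close>.\<close>
  have ev: "\<forall>\<^sub>F s in nhds (c p k). (if j = k then s else c p j) = c (inv_into U c ((c p)(k := s))) j"
  proof (rule eventually_mono[OF slice_inv_in[OF U_open assms(1,1,2)]])
    fix s assume "inv_into U c ((c p)(k := s)) \<in> U \<inter> U \<and> (c p)(k := s) \<in> c ` (U \<inter> U)"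
    then have "c (inv_into U c ((c p)(k := s))) = (c p)(k := s)"
      unfolding Int_absorb by (intro f_inv_into_f) (rule conjunct2)
    then show "(if j = k then s else c p j) = c (inv_into U c ((c p)(k := s))) j" by simp
  qed
  show "((\<lambda>s. c (inv_into U c ((c p)(k := s))) j) has_real_derivative (if j = k then 1 else 0)) (at (c p k))"
    unfolding DERIV_cong_ev[OF refl ev refl, symmetric] by auto
qed (use assms in auto)

text \<open>The chain rule for the transition map; the Jacobian entries are the values of the
  vectors of one chart at the coordinate functions of the other.\<close>

lemma coord_vec_change:
  assumes c': "(U', c') \<in> matlas M" and p: "p \<in> U" "p \<in> U'" and j: "j \<in> K" and f: "smooth_near M p f"
  shows "coord_vec M (U', c') j p f = (\<Sum>k\<in>K. coord_vec M (U', c') j p (crd k) * pd k p f)"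
proof -
  interpret C': chart M U' c' by unfold_locales (rule c')
  obtain V where V: "p \<in> V" "V \<subseteq> U \<inter> U'" "smooth_fun_on M V f"
    by (rule smooth_nearE[OF f, of "U \<inter> U'"]) (use p U_open C'.U_open in auto)
  note Vo = smooth_fun_on_openD[OF V(3)]
  have UV: "U \<inter> V = V" "U' \<inter> V = V" using V by auto
  let ?\<gamma> = "\<lambda>s. c (inv_into U' c' ((c' p)(j := s)))"
  have ev: "\<forall>\<^sub>F s in nhds (c' p j). inv_into U' c' ((c' p)(j := s)) \<in> V"
    by (rule eventually_mono[OF C'.slice_inv_in[OF Vo V(1) p(2) j]]) (simp add: UV)
  have "((\<lambda>s. f (inv_into U c (?\<gamma> s))) has_real_derivative
      (\<Sum>k\<in>K. partial_deriv k (\<lambda>x. f (inv_into U c x)) (?\<gamma> (c' p j)) * coord_vec M (U', c') j p (crd k))) (at (c' p j))"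
  proof (rule C1_chain_rule[OF finite_midx chart_Int_image_open[OF chart Vo] smooth_fun_on_Ck[OF V(3) chart]])
    show "\<forall>\<^sub>F s in nhds (c' p j). ?\<gamma> s \<in> c ` (U \<inter> V)"
      by (rule eventually_mono[OF ev]) (simp add: UV)
    show "((\<lambda>s. ?\<gamma> s k) has_real_derivative coord_vec M (U', c') j p (crd k)) (at (c' p j))" if "k \<in> K" for k
      by (rule C'.coord_vec_deriv[OF p(2) crd_smooth_near[OF p(1) that] j])
  qed
  moreover have "?\<gamma> (c' p j) = c p" using p by simp
  moreover have "partial_deriv k (\<lambda>x. f (inv_into U c x)) (c p) = pd k p f" for k
    using f by (simp add: coord_vec_def)
  ultimately have "((\<lambda>s. f (inv_into U c (?\<gamma> s))) has_real_derivative
      (\<Sum>k\<in>K. coord_vec M (U', c') j p (crd k) * pd k p f)) (at (c' p j))"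
    by (simp add: mult.commute)
  moreover have ev': "\<forall>\<^sub>F s in nhds (c' p j). f (inv_into U c (?\<gamma> s)) = f (inv_into U' c' ((c' p)(j := s)))"
    by (rule eventually_mono[OF ev]) (use V(2) in auto)
  ultimately have "((\<lambda>s. f (inv_into U' c' ((c' p)(j := s)))) has_real_derivative
      (\<Sum>k\<in>K. coord_vec M (U', c') j p (crd k) * pd k p f)) (at (c' p j))"
    unfolding DERIV_cong_ev[OF refl ev' refl] by blast
  then show ?thesis by (rule C'.coord_vec_eqI[OF p(2) f j])
qed

text \<open>A tangent vector comes with some chart of its own. After a change to the fixed chart its
  components turn out to be its values at the coordinate functions, so \<open>u (crd k)\<close>
  serves as the \<open>k\<close>-th component from here on.\<close>

lemma tangent_expand:
  assumes "u \<in> tangent_space M p" "p \<in> U"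
  shows "u = (\<lambda>f. \<Sum>k\<in>K. u (crd k) * pd k p f)"
proof
  fix f
  obtain U' c' a where u: "u = (\<lambda>f. \<Sum>j\<in>K. a j * coord_vec M (U', c') j p f)" "(U', c') \<in> matlas M" "p \<in> U'"
    using assms(1) by (auto simp: tangent_space_def)
  show "u f = (\<Sum>k\<in>K. u (crd k) * pd k p f)"
  proof (cases "smooth_near M p f")
    case True
    have "u f = (\<Sum>j\<in>K. a j * (\<Sum>k\<in>K. coord_vec M (U', c') j p (crd k) * pd k p f))"
      unfolding u(1) by (intro sum.cong refl) (simp add: coord_vec_change[OF u(2) assms(2) u(3) _ True])
    also have "\<dots> = (\<Sum>k\<in>K. u (crd k) * pd k p f)"
      unfolding u(1) by (simp add: sum_distrib_left sum_distrib_right mult.assoc) (rule sum.swap)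
    finally show ?thesis .
  next
    case False
    then show ?thesis using tangent_space_not_smooth[OF assms(1)] by (simp add: coord_vec_not_smooth)
  qed
qed

lemma tangent_combination: "p \<in> U \<Longrightarrow> (\<lambda>f. \<Sum>k\<in>K. a k * pd k p f) \<in> tangent_space M p"
  using chart unfolding tangent_space_def by blast

lemma combination_crd:
  assumes "p \<in> U" "j \<in> K"
  shows "(\<Sum>k\<in>K. a k * pd k p (crd j)) = a j"
proof -
  have "(\<Sum>k\<in>K. a k * pd k p (crd j)) = (\<Sum>k\<in>K. if j = k then a k else 0)"
    by (intro sum.cong refl) (simp add: coord_vec_crd assms)
  then show ?thesis using assms finite_midx by simp
qed

lemma coord_vec_tangent:
  assumes "p \<in> U" "j \<in> K"
  shows "pd j p \<in> tangent_space M p"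
proof -
  have "(\<lambda>f. \<Sum>k\<in>K. (if k = j then 1 else 0) * pd k p f) = pd j p"
  proof
    fix f
    have "(\<Sum>k\<in>K. (if k = j then 1 else 0) * pd k p f) = (\<Sum>k\<in>K. if k = j then pd k p f else 0)"
      by (intro sum.cong) auto
    then show "(\<Sum>k\<in>K. (if k = j then 1 else 0) * pd k p f) = pd j p f"
      using assms finite_midx by simp
  qed
  with tangent_combination[OF assms(1), of "\<lambda>k. if k = j then 1 else 0"] show ?thesis by simp
qed

lemma tangent_linear:
  assumes "u \<in> tangent_space M p" "v \<in> tangent_space M p" "p \<in> U"
  shows "(\<lambda>f. a * u f + b * v f) \<in> tangent_space M p"
proof -
  have "(\<lambda>f. a * u f + b * v f) = (\<lambda>f. \<Sum>k\<in>K. (a * u (crd k) + b * v (crd k)) * pd k p f)"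
    by (subst (1) tangent_expand[OF assms(1,3)], subst (1) tangent_expand[OF assms(2,3)])
       (simp add: sum_distrib_left sum.distrib distrib_right mult.assoc)
  then show ?thesis using tangent_combination[OF assms(3)] by simp
qed

lemma tangent_cong:
  assumes u: "u \<in> tangent_space M p" and V: "openin (mtop M) V" "p \<in> V" and p: "p \<in> U"
    and eq: "\<And>q. q \<in> V \<Longrightarrow> f q = g q"
  shows "u f = u g"
proof -
  have "u f = (\<Sum>k\<in>K. u (crd k) * pd k p f)" by (rule fun_cong[OF tangent_expand[OF u p]])
  also have "\<dots> = (\<Sum>k\<in>K. u (crd k) * pd k p g)"
    using coord_vec_cong[OF V p _ eq] by simp
  also have "\<dots> = u g" by (rule fun_cong[OF tangent_expand[OF u p], symmetric])
  finally show ?thesis .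
qed

lemma tangent_add:
  assumes u: "u \<in> tangent_space M p" and p: "p \<in> U" and f: "smooth_near M p f" "smooth_near M p g"
  shows "u (\<lambda>q. f q + g q) = u f + u g"
  unfolding fun_cong[OF tangent_expand[OF u p], of "\<lambda>q. f q + g q"]
    fun_cong[OF tangent_expand[OF u p], of f] fun_cong[OF tangent_expand[OF u p], of g]
  by (simp add: coord_vec_add p f distrib_left sum.distrib)

lemma tangent_mult:
  assumes u: "u \<in> tangent_space M p" and p: "p \<in> U" and f: "smooth_near M p f" "smooth_near M p g"
  shows "u (\<lambda>q. f q * g q) = u f * g p + f p * u g"
  unfolding fun_cong[OF tangent_expand[OF u p], of "\<lambda>q. f q * g q"]
    fun_cong[OF tangent_expand[OF u p], of f] fun_cong[OF tangent_expand[OF u p], of g]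
  by (simp add: coord_vec_mult p f distrib_left sum.distrib sum_distrib_left sum_distrib_right mult_ac)

lemma tangent_const: "u \<in> tangent_space M p \<Longrightarrow> p \<in> U \<Longrightarrow> u (\<lambda>q. a) = 0"
  by (subst tangent_expand) (auto simp: coord_vec_const)

lemma tangent_sum:
  assumes u: "u \<in> tangent_space M p" and p: "p \<in> U" and f: "\<And>a. a \<in> A \<Longrightarrow> smooth_near M p (f a)"
  shows "u (\<lambda>q. \<Sum>a\<in>A. f a q) = (\<Sum>a\<in>A. u (f a))"
  using f
  by (induction A rule: infinite_finite_induct)
     (auto simp: tangent_const[OF u p] tangent_add[OF u p] smooth_near_sum[OF U_topspace[OF p]])

lemma coord_vec_smooth:
  assumes V: "V \<subseteq> U" and f: "smooth_fun_on M V f" and k: "k \<in> K"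
  shows "smooth_fun_on M V (\<lambda>q. pd k q f)"
proof (rule smooth_fun_on_chartI[OF chart smooth_fun_on_openD[OF f] V])
  fix r
  have UV: "U \<inter> V = V" using V by auto
  note o = chart_image_open[OF chart smooth_fun_on_openD[OF f] V]
  have "Ck_on r K (c ` V) (partial_deriv k (\<lambda>x. f (inv_into U c x)))"
    using Ck_on_Suc_partial[OF smooth_fun_on_Ck[OF f chart] k] by (simp add: UV)
  then show "Ck_on r K (c ` V) (\<lambda>x. pd k (inv_into U c x) f)"
  proof (rule Ck_on_cong[OF o, rotated])
    fix y assume "y \<in> c ` V"
    then obtain q where q: "q \<in> V" "y = c q" by blast
    then have "smooth_near M q f" using f smooth_nearI by blast
    with q V show "partial_deriv k (\<lambda>x. f (inv_into U c x)) y = pd k (inv_into U c y) f"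
      by (auto simp: coord_vec_def)
  qed
qed

lemma smooth_field_combination:
  assumes V: "openin (mtop M) V" "V \<subseteq> U" and a: "\<And>k. k \<in> K \<Longrightarrow> smooth_fun_on M V (a k)"
  shows "smooth_field_on M V (\<lambda>q f. \<Sum>k\<in>K. a k q * pd k q f)"
  unfolding smooth_field_on_def
proof (intro conjI ballI allI impI)
  show "(\<lambda>f. \<Sum>k\<in>K. a k q * pd k q f) \<in> tangent_space M q" if "q \<in> V" for q
    by (rule tangent_combination) (use that V in blast)
  show "smooth_fun_on M V' (\<lambda>q. \<Sum>k\<in>K. a k q * pd k q f)" if "V' \<subseteq> V \<and> smooth_fun_on M V' f" for V' f
  proof -
    have "V' \<subseteq> U" "smooth_fun_on M V' f" "openin (mtop M) V'" "V' \<subseteq> V"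
      using that V smooth_fun_on_openD by auto
    then show ?thesis
      by (intro smooth_fun_on_sum smooth_fun_on_mult coord_vec_smooth smooth_fun_on_subset[OF a])
  qed
qed (rule V(1))

lemma smooth_field_coord_vec: "k \<in> K \<Longrightarrow> openin (mtop M) V \<Longrightarrow> V \<subseteq> U \<Longrightarrow> smooth_field_on M V (pd k)"
  unfolding smooth_field_on_def
  using coord_vec_tangent coord_vec_smooth by blast

lemma smooth_field_comp:
  assumes "smooth_field_on M V X" "V \<subseteq> U" "k \<in> K"
  shows "smooth_fun_on M V (\<lambda>q. X q (crd k))"
  by (rule smooth_field_onD(3)[OF assms(1) order_refl])
     (rule smooth_fun_on_subset[OF smooth_fun_on_coord[OF chart assms(3)] smooth_field_onD(1)[OF assms(1)] assms(2)])

lemma smooth_field_linear: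
  assumes X: "smooth_field_on M V X" "smooth_field_on M V Y" and V: "V \<subseteq> U"
    and a: "smooth_fun_on M V a" "smooth_fun_on M V b"
  shows "smooth_field_on M V (\<lambda>q f. a q * X q f + b q * Y q f)"
  unfolding smooth_field_on_def
proof (intro conjI ballI allI impI)
  show "openin (mtop M) V" by (rule smooth_field_onD[OF X(1)])
  show "(\<lambda>f. a q * X q f + b q * Y q f) \<in> tangent_space M q" if "q \<in> V" for q
    by (rule tangent_linear) (use that V smooth_field_onD X in blast)+
  show "smooth_fun_on M V' (\<lambda>q. a q * X q f + b q * Y q f)" if "V' \<subseteq> V \<and> smooth_fun_on M V' f" for V' f
  proof -
    have "V' \<subseteq> V" "smooth_fun_on M V' f" "openin (mtop M) V'"
      using that smooth_fun_on_openD by auto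
    then show ?thesis using smooth_field_onD(3)[OF X(1)] smooth_field_onD(3)[OF X(2)]
      by (intro smooth_fun_on_add smooth_fun_on_mult smooth_fun_on_subset[OF a(1)] smooth_fun_on_subset[OF a(2)]) auto
  qed
qed

end

section \<open>Connections and curvature in a chart\<close>

lemma sum_swap_outer:
  "(\<Sum>k\<in>A. \<Sum>i\<in>B. \<Sum>l\<in>C. h k i l) = (\<Sum>l\<in>C. \<Sum>i\<in>B. \<Sum>k\<in>A. h k i l)"
proof -
  have "(\<Sum>k\<in>A. \<Sum>i\<in>B. \<Sum>l\<in>C. h k i l) = (\<Sum>i\<in>B. \<Sum>k\<in>A. \<Sum>l\<in>C. h k i l)" by (rule sum.swap)
  also have "\<dots> = (\<Sum>i\<in>B. \<Sum>l\<in>C. \<Sum>k\<in>A. h k i l)" by (intro sum.cong refl sum.swap)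
  also have "\<dots> = (\<Sum>l\<in>C. \<Sum>i\<in>B. \<Sum>k\<in>A. h k i l)" by (rule sum.swap)
  finally show ?thesis .
qed

context chart
begin

text \<open>\<open>G i k l\<close> is the \<open>l\<close>-th component of the derivative of the \<open>k\<close>-th coordinate field along the \<open>i\<close>-th one.\<close>

definition conn_coeffs :: "('a vfield \<Rightarrow> 'a vfield \<Rightarrow> 'a vfield) \<Rightarrow> ('k \<Rightarrow> 'k \<Rightarrow> 'k \<Rightarrow> 'a \<Rightarrow> real) \<Rightarrow> bool" where
  "conn_coeffs D G \<longleftrightarrow>
     (\<forall>i\<in>K. \<forall>k\<in>K. \<forall>l\<in>K. smooth_fun_on M U (G i k l)) \<and>
     (\<forall>V X Y q. V \<subseteq> U \<longrightarrow> smooth_field_on M V X \<longrightarrow> smooth_field_on M V Y \<longrightarrow> q \<in> V \<longrightarrow>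
        D X Y q = (\<lambda>f. \<Sum>l\<in>K. (X q (\<lambda>r. Y r (crd l)) +
           (\<Sum>i\<in>K. \<Sum>k\<in>K. X q (crd i) * Y q (crd k) * G i k l q)) * pd l q f))"

section \<open>Expansion of a connection over the coordinate fields\<close>

context
  fixes D :: "'a vfield \<Rightarrow> 'a vfield \<Rightarrow> 'a vfield" and V :: "'a set"
  assumes D: "affine_connection M D" and V: "openin (mtop M) V" "V \<subseteq> U"
begin

lemma connection_smooth:
  "smooth_field_on M V X \<Longrightarrow> smooth_field_on M V Y \<Longrightarrow> smooth_field_on M V (D X Y)"
  using D[unfolded affine_connection_def, THEN conjunct1] by blast

lemma connection_local:
  assumes "smooth_field_on M V X" "smooth_field_on M V Y"
    "\<And>q. q \<in> V \<Longrightarrow> X' q = X q" "\<And>q. q \<in> V \<Longrightarrow> Y' q = Y q" "q \<in> V"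
  shows "D X' Y' q = D X Y q"
  using D[unfolded affine_connection_def, THEN conjunct2, THEN conjunct1] assms by blast

lemma connection_add:
  assumes "smooth_field_on M V X" "smooth_field_on M V Y" "smooth_field_on M V Z" "q \<in> V"
  shows "D (\<lambda>q f. X q f + Y q f) Z q = (\<lambda>f. D X Z q f + D Y Z q f)"
    and "D Z (\<lambda>q f. X q f + Y q f) q = (\<lambda>f. D Z X q f + D Z Y q f)"
  using D[unfolded affine_connection_def, THEN conjunct2, THEN conjunct2, THEN conjunct1] assms by blast+

lemma connection_scale:
  assumes "smooth_field_on M V X" "smooth_field_on M V Y" "smooth_fun_on M V h" "q \<in> V"
  shows "D (\<lambda>q f. h q * X q f) Y q = (\<lambda>f. h q * D X Y q f)"
    and "D X (\<lambda>q f. h q * Y q f) q = (\<lambda>f. X q h * Y q f + h q * D X Y q f)"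
  using D[unfolded affine_connection_def, THEN conjunct2, THEN conjunct2, THEN conjunct2] assms by blast+

lemma smooth_field_scale:
  assumes "smooth_field_on M V X" "smooth_fun_on M V h"
  shows "smooth_field_on M V (\<lambda>q f. h q * X q f)"
  using smooth_field_linear[OF assms(1,1) V(2) assms(2) smooth_fun_on_const[OF V(1), of 0]] by simp

text \<open>Meant for the inductions over \<open>J\<close> below; missing coefficients are filled
  with 0 to fall back on the full coordinate expansion.\<close>

lemma smooth_field_partial_sum:
  assumes "J \<subseteq> K" and "\<And>j. j \<in> J \<Longrightarrow> smooth_fun_on M V (a j)"
  shows "smooth_field_on M V (\<lambda>q f. \<Sum>j\<in>J. a j q * pd j q f)"
proof -
  have "smooth_field_on M V (\<lambda>q f. \<Sum>j\<in>K. (if j \<in> J then a j q else 0) * pd j q f)"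
  proof (rule smooth_field_combination[OF V])
    show "smooth_fun_on M V (\<lambda>q. if k \<in> J then a k q else 0)" for k
      using assms(2) smooth_fun_on_const[OF V(1)] by (cases "k \<in> J") simp_all
  qed
  moreover have "(\<Sum>j\<in>K. (if j \<in> J then a j q else 0) * pd j q f) = (\<Sum>j\<in>J. a j q * pd j q f)" for q f
    by (rule sum.mono_neutral_cong_right) (use assms(1) finite_midx in auto)
  ultimately show ?thesis by simp
qed

lemma connection_sum_left:
  assumes J: "J \<subseteq> K" and Z: "smooth_field_on M V Z" and q: "q \<in> V"
    and a: "\<And>j. j \<in> J \<Longrightarrow> smooth_fun_on M V (a j)"
  shows "D (\<lambda>q f. \<Sum>j\<in>J. a j q * pd j q f) Z q = (\<lambda>f. \<Sum>j\<in>J. a j q * D (pd j) Z q f)"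
proof -
  have "finite J" using J finite_midx finite_subset by blast
  then show ?thesis using J a
  proof (induction J rule: finite_induct)
    case empty
    \<comment> \<open>The empty sum is treated as 0 times \<open>Z\<close>, the axioms having no
      separate rule for the zero field.\<close>
    then show ?case using connection_scale(1)[OF Z Z smooth_fun_on_const[OF V(1)] q, of 0] by simp
  next
    case (insert j J)
    have j: "smooth_field_on M V (pd j)" using smooth_field_coord_vec[OF _ V] insert.prems(1) by blast
    have aj: "smooth_fun_on M V (a j)" using insert.prems(2) by simp
    have S: "smooth_field_on M V (\<lambda>q f. \<Sum>j\<in>J. a j q * pd j q f)"
      by (rule smooth_field_partial_sum) (use insert.prems in auto)
    have IH: "D (\<lambda>q f. \<Sum>j\<in>J. a j q * pd j q f) Z q = (\<lambda>f. \<Sum>j\<in>J. a j q * D (pd j) Z q f)"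
      using insert.IH insert.prems by blast
    have "D (\<lambda>q f. \<Sum>j\<in>insert j J. a j q * pd j q f) Z q =
        D (\<lambda>q f. a j q * pd j q f + (\<Sum>j\<in>J. a j q * pd j q f)) Z q"
      using insert.hyps by simp
    also have "\<dots> = (\<lambda>f. a j q * D (pd j) Z q f + (\<Sum>j\<in>J. a j q * D (pd j) Z q f))"
      unfolding connection_add(1)[OF smooth_field_scale[OF j aj] S Z q]
        connection_scale(1)[OF j Z aj q] IH ..
    finally show ?case using insert.hyps by simp
  qed
qed

text \<open>The axioms give binary additivity, extended here by induction; the Leibniz rule adds the
  derivative of each coefficient.\<close>

lemma connection_sum_right:
  assumes J: "J \<subseteq> K" and Z: "smooth_field_on M V Z" and q: "q \<in> V"
    and a: "\<And>j. j \<in> J \<Longrightarrow> smooth_fun_on M V (a j)"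
  shows "D Z (\<lambda>q f. \<Sum>j\<in>J. a j q * pd j q f) q = (\<lambda>f. \<Sum>j\<in>J. Z q (a j) * pd j q f + a j q * D Z (pd j) q f)"
proof -
  have "finite J" using J finite_midx finite_subset by blast
  then show ?thesis using J a
  proof (induction J rule: finite_induct)
    case empty
    have "Z q (\<lambda>q. 0) = 0" using tangent_const[OF smooth_field_onD(2)[OF Z q]] q V(2) by blast
    then show ?case using connection_scale(2)[OF Z Z smooth_fun_on_const[OF V(1)] q, of 0] by simp
  next
    case (insert j J)
    have j: "smooth_field_on M V (pd j)" using smooth_field_coord_vec[OF _ V] insert.prems(1) by blast
    have aj: "smooth_fun_on M V (a j)" using insert.prems(2) by simp
    have S: "smooth_field_on M V (\<lambda>q f. \<Sum>j\<in>J. a j q * pd j q f)"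
      by (rule smooth_field_partial_sum) (use insert.prems in auto)
    have IH: "D Z (\<lambda>q f. \<Sum>j\<in>J. a j q * pd j q f) q = (\<lambda>f. \<Sum>j\<in>J. Z q (a j) * pd j q f + a j q * D Z (pd j) q f)"
      using insert.IH insert.prems by blast
    have "D Z (\<lambda>q f. \<Sum>j\<in>insert j J. a j q * pd j q f) q =
        D Z (\<lambda>q f. a j q * pd j q f + (\<Sum>j\<in>J. a j q * pd j q f)) q"
      using insert.hyps by simp
    also have "\<dots> = (\<lambda>f. (Z q (a j) * pd j q f + a j q * D Z (pd j) q f) +
        (\<Sum>j\<in>J. Z q (a j) * pd j q f + a j q * D Z (pd j) q f))"
      unfolding connection_add(2)[OF smooth_field_scale[OF j aj] S Z q]
        connection_scale(2)[OF Z j aj q] IH ..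
    finally show ?case using insert.hyps by simp
  qed
qed

end

text \<open>Tensoriality in \<open>X\<close> and the Leibniz rule in \<open>Y\<close> reduce
  \<open>D X Y\<close> to coordinate fields. Locality of \<open>D\<close> is applied first, because
  \<open>X\<close> and \<open>Y\<close> are known to equal their coordinate expansions only on
  \<open>V\<close>.\<close>

lemma affine_connection_coeffs:
  assumes D: "affine_connection M D"
  shows "conn_coeffs D (\<lambda>i k l q. D (pd i) (pd k) q (crd l))"
  unfolding conn_coeffs_def
proof (intro conjI ballI allI impI)
  fix i k l assume "i \<in> K" "k \<in> K" "l \<in> K"
  then show "smooth_fun_on M U (\<lambda>q. D (pd i) (pd k) q (crd l))"
    by (intro smooth_field_comp[OF connection_smooth[OF D U_open order_refl]] smooth_field_coord_vec U_open) auto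
next
  fix V X Y q assume V: "V \<subseteq> U" and X: "smooth_field_on M V X" and Y: "smooth_field_on M V Y" and q: "q \<in> V"
  have Vo: "openin (mtop M) V" by (rule smooth_field_onD[OF X])
  have qU: "q \<in> U" using q V by blast
  have pdV: "smooth_field_on M V (pd j)" if "j \<in> K" for j
    by (rule smooth_field_coord_vec[OF that Vo V])
  have ex: "(\<lambda>f. \<Sum>j\<in>K. Z r (crd j) * pd j r f) = Z r" if "smooth_field_on M V Z" "r \<in> V" for Z r
    using tangent_expand[OF smooth_field_onD(2)[OF that]] that(2) V by (metis (no_types, lifting) subsetD)
  have 1: "D X Y q = D X (\<lambda>q f. \<Sum>j\<in>K. Y q (crd j) * pd j q f) q"
    by (rule connection_local[OF D Vo V X Y _ _ q, symmetric]) (auto simp: ex Y)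
  have 2: "D X (pd k) q = (\<lambda>f. \<Sum>i\<in>K. X q (crd i) * D (pd i) (pd k) q f)" if k: "k \<in> K" for k
  proof -
    have "D X (pd k) q = D (\<lambda>q f. \<Sum>j\<in>K. X q (crd j) * pd j q f) (pd k) q"
      by (rule connection_local[OF D Vo V X pdV[OF k] _ _ q, symmetric]) (auto simp: ex X)
    also have "\<dots> = (\<lambda>f. \<Sum>i\<in>K. X q (crd i) * D (pd i) (pd k) q f)"
      by (rule connection_sum_left[OF D Vo V order_refl pdV[OF k] q smooth_field_comp[OF X V]])
    finally show ?thesis .
  qed
  have 3: "D (pd i) (pd k) q = (\<lambda>f. \<Sum>l\<in>K. D (pd i) (pd k) q (crd l) * pd l q f)" if "i \<in> K" "k \<in> K" for i k
    by (rule tangent_expand[OF smooth_field_onD(2)[OF connection_smooth[OF D Vo V pdV[OF that(1)] pdV[OF that(2)]] q] qU])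
  show "D X Y q = (\<lambda>f. \<Sum>l\<in>K. (X q (\<lambda>r. Y r (crd l)) +
     (\<Sum>i\<in>K. \<Sum>k\<in>K. X q (crd i) * Y q (crd k) * D (pd i) (pd k) q (crd l))) * pd l q f)"
  proof
    fix f
    have 4: "D X (pd k) q f = (\<Sum>i\<in>K. X q (crd i) * (\<Sum>l\<in>K. D (pd i) (pd k) q (crd l) * pd l q f))" if "k \<in> K" for k
      unfolding 2[OF that] by (intro sum.cong refl arg_cong2[where f = times]) (rule fun_cong[OF 3[OF _ that]])
    have "D X Y q f = (\<Sum>k\<in>K. X q (\<lambda>r. Y r (crd k)) * pd k q f + Y q (crd k) * D X (pd k) q f)"
      using fun_cong[OF trans[OF 1 connection_sum_right[where a = "\<lambda>j q. Y q (crd j)", OF D Vo V order_refl X q smooth_field_comp[OF Y V]]]] .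
    also have "\<dots> = (\<Sum>k\<in>K. X q (\<lambda>r. Y r (crd k)) * pd k q f) +
        (\<Sum>k\<in>K. \<Sum>i\<in>K. \<Sum>l\<in>K. X q (crd i) * Y q (crd k) * D (pd i) (pd k) q (crd l) * pd l q f)"
      by (simp add: sum.distrib 4 sum_distrib_left mult_ac)
    also have "(\<Sum>k\<in>K. \<Sum>i\<in>K. \<Sum>l\<in>K. X q (crd i) * Y q (crd k) * D (pd i) (pd k) q (crd l) * pd l q f) =
        (\<Sum>l\<in>K. \<Sum>i\<in>K. \<Sum>k\<in>K. X q (crd i) * Y q (crd k) * D (pd i) (pd k) q (crd l) * pd l q f)"
      by (rule sum_swap_outer)
    also have "(\<Sum>k\<in>K. X q (\<lambda>r. Y r (crd k)) * pd k q f) +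
        (\<Sum>l\<in>K. \<Sum>i\<in>K. \<Sum>k\<in>K. X q (crd i) * Y q (crd k) * D (pd i) (pd k) q (crd l) * pd l q f) =
        (\<Sum>l\<in>K. (X q (\<lambda>r. Y r (crd l)) +
     (\<Sum>i\<in>K. \<Sum>k\<in>K. X q (crd i) * Y q (crd k) * D (pd i) (pd k) q (crd l))) * pd l q f)"
      by (simp add: sum.distrib distrib_right sum_distrib_right)
    finally show "D X Y q f = (\<Sum>l\<in>K. (X q (\<lambda>r. Y r (crd l)) +
     (\<Sum>i\<in>K. \<Sum>k\<in>K. X q (crd i) * Y q (crd k) * D (pd i) (pd k) q (crd l))) * pd l q f)" .
  qed
qed

text \<open>The classical components of the curvature: \<open>i\<close> and \<open>j\<close> index
  the antisymmetric pair, \<open>k\<close> the vector acted on, \<open>l\<close> the result. No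
  symmetry of \<open>G\<close> is presupposed, so connections with torsion are covered.\<close>

definition curv_coeff :: "('k \<Rightarrow> 'k \<Rightarrow> 'k \<Rightarrow> 'a \<Rightarrow> real) \<Rightarrow> 'k \<Rightarrow> 'k \<Rightarrow> 'k \<Rightarrow> 'k \<Rightarrow> 'a \<Rightarrow> real" where
  "curv_coeff G i j k l q = pd i q (G j k l) - pd j q (G i k l) +
     (\<Sum>m\<in>K. G i m l q * G j k m q - G j m l q * G i k m q)"

end

text \<open>The cancellation with all analysis stripped off. \<open>x\<close>, \<open>y\<close>,
  \<open>z\<close> are the components of the fields at a point; \<open>xy i\<close> stands for X
  applied to the \<open>i\<close>-th component of Y, and likewise for the other pairs;
  \<open>xyz\<close> and \<open>yxz\<close> are the second derivatives of the \<open>l\<close>-th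
  component of Z; \<open>dG j i k l\<close> is the \<open>j\<close>-th derivative of
  \<open>g i k l\<close>. The last subtrahend is the bracket term.\<close>

lemma curvature_algebra:
  fixes x y z :: "'k \<Rightarrow> real"
  shows "(xyz + (\<Sum>i\<in>K. \<Sum>k\<in>K. xy i * z k * g i k l + y i * xz k * g i k l + y i * z k * (\<Sum>j\<in>K. x j * dG j i k l))
      + (\<Sum>i\<in>K. \<Sum>k\<in>K. x i * (yz k + (\<Sum>a\<in>K. \<Sum>b\<in>K. y a * z b * g a b k)) * g i k l))
    - (yxz + (\<Sum>i\<in>K. \<Sum>k\<in>K. yx i * z k * g i k l + x i * yz k * g i k l + x i * z k * (\<Sum>j\<in>K. y j * dG j i k l))
      + (\<Sum>i\<in>K. \<Sum>k\<in>K. y i * (xz k + (\<Sum>a\<in>K. \<Sum>b\<in>K. x a * z b * g a b k)) * g i k l))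
    - ((xyz - yxz) + (\<Sum>i\<in>K. \<Sum>k\<in>K. (xy i - yx i) * z k * g i k l))
    = (\<Sum>i\<in>K. \<Sum>j\<in>K. \<Sum>k\<in>K. x i * y j * z k * (dG i j k l - dG j i k l + (\<Sum>m\<in>K. g i m l * g j k m - g j m l * g i k m)))"
proof -
  have A: "(\<Sum>i\<in>K. \<Sum>k\<in>K. v i * z k * (\<Sum>j\<in>K. u j * dG j i k l)) =
      (\<Sum>i\<in>K. \<Sum>j\<in>K. \<Sum>k\<in>K. u i * v j * z k * dG i j k l)" for u v :: "'k \<Rightarrow> real"
  proof -
    have "(\<Sum>i\<in>K. \<Sum>k\<in>K. v i * z k * (\<Sum>j\<in>K. u j * dG j i k l)) =
        (\<Sum>i\<in>K. \<Sum>k\<in>K. \<Sum>j\<in>K. u j * v i * z k * dG j i k l)"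
      by (simp add: sum_distrib_left mult_ac)
    also have "\<dots> = (\<Sum>i\<in>K. \<Sum>j\<in>K. \<Sum>k\<in>K. u j * v i * z k * dG j i k l)"
      by (intro sum.cong refl sum.swap)
    also have "\<dots> = (\<Sum>i\<in>K. \<Sum>j\<in>K. \<Sum>k\<in>K. u i * v j * z k * dG i j k l)"
      by (rule sum.swap)
    finally show ?thesis .
  qed
  have B: "(\<Sum>i\<in>K. \<Sum>k\<in>K. u i * (\<Sum>a\<in>K. \<Sum>b\<in>K. v a * z b * g a b k) * g i k l) =
      (\<Sum>i\<in>K. \<Sum>j\<in>K. \<Sum>k\<in>K. u i * v j * z k * (\<Sum>m\<in>K. g i m l * g j k m))" for u v :: "'k \<Rightarrow> real"
  proof (rule sum.cong[OF refl])
    fix i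
    have "(\<Sum>k\<in>K. u i * (\<Sum>a\<in>K. \<Sum>b\<in>K. v a * z b * g a b k) * g i k l) =
       (\<Sum>m\<in>K. \<Sum>a\<in>K. \<Sum>b\<in>K. u i * v a * z b * (g i m l * g a b m))"
      by (simp add: sum_distrib_left sum_distrib_right mult_ac)
    also have "\<dots> = (\<Sum>a\<in>K. \<Sum>m\<in>K. \<Sum>b\<in>K. u i * v a * z b * (g i m l * g a b m))"
      by (rule sum.swap)
    also have "\<dots> = (\<Sum>a\<in>K. \<Sum>b\<in>K. \<Sum>m\<in>K. u i * v a * z b * (g i m l * g a b m))"
      by (intro sum.cong refl sum.swap)
    finally show "(\<Sum>k\<in>K. u i * (\<Sum>a\<in>K. \<Sum>b\<in>K. v a * z b * g a b k) * g i k l) =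
        (\<Sum>j\<in>K. \<Sum>k\<in>K. u i * v j * z k * (\<Sum>m\<in>K. g i m l * g j k m))"
      by (simp add: sum_distrib_left)
  qed
  have S: "(\<Sum>i\<in>K. \<Sum>j\<in>K. \<Sum>k\<in>K. y i * x j * z k * h i j k) = (\<Sum>i\<in>K. \<Sum>j\<in>K. \<Sum>k\<in>K. x i * y j * z k * h j i k)"
    for h :: "'k \<Rightarrow> 'k \<Rightarrow> 'k \<Rightarrow> real"
    by (subst sum.swap) (simp add: mult_ac)
  show ?thesis
    unfolding distrib_left distrib_right left_diff_distrib right_diff_distrib sum.distrib sum_subtractf A B S
    by (simp add: mult_ac)
qed

context chart
begin

section \<open>Curvature in terms of connection coefficients\<close>

context
  fixes D G
  assumes G: "conn_coeffs D G"
begin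

lemma conn_coeffs_smooth: "i \<in> K \<Longrightarrow> k \<in> K \<Longrightarrow> l \<in> K \<Longrightarrow> smooth_fun_on M U (G i k l)"
  using G by (simp add: conn_coeffs_def)

lemma conn_coeffs_expand:
  assumes "V \<subseteq> U" "smooth_field_on M V X" "smooth_field_on M V Y" "q \<in> V"
  shows "D X Y q = (\<lambda>f. \<Sum>l\<in>K. (X q (\<lambda>r. Y r (crd l)) +
           (\<Sum>i\<in>K. \<Sum>k\<in>K. X q (crd i) * Y q (crd k) * G i k l q)) * pd l q f)"
  using G assms unfolding conn_coeffs_def by blast

lemma conn_coeffs_crd:
  assumes "V \<subseteq> U" "smooth_field_on M V X" "smooth_field_on M V Y" "q \<in> V" "l \<in> K"
  shows "D X Y q (crd l) = X q (\<lambda>r. Y r (crd l)) +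
           (\<Sum>i\<in>K. \<Sum>k\<in>K. X q (crd i) * Y q (crd k) * G i k l q)"
  unfolding conn_coeffs_expand[OF assms(1-4)] by (rule combination_crd) (use assms in auto)

lemma conn_coeffs_smooth_field:
  assumes V: "V \<subseteq> U" and X: "smooth_field_on M V X" and Y: "smooth_field_on M V Y"
  shows "smooth_field_on M V (D X Y)"
proof (rule smooth_field_on_cong)
  have Vo: "openin (mtop M) V" by (rule smooth_field_onD[OF X])
  show "smooth_field_on M V (\<lambda>q f. \<Sum>l\<in>K. (X q (\<lambda>r. Y r (crd l)) +
           (\<Sum>i\<in>K. \<Sum>k\<in>K. X q (crd i) * Y q (crd k) * G i k l q)) * pd l q f)"
    by (intro smooth_field_combination Vo V smooth_fun_on_add smooth_fun_on_sum smooth_fun_on_mult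
        smooth_field_onD(3)[OF X order_refl] smooth_field_comp[OF X V] smooth_field_comp[OF Y V]
        smooth_fun_on_subset[OF conn_coeffs_smooth])
  show "(\<lambda>f. \<Sum>l\<in>K. (X q (\<lambda>r. Y r (crd l)) +
           (\<Sum>i\<in>K. \<Sum>k\<in>K. X q (crd i) * Y q (crd k) * G i k l q)) * pd l q f) = D X Y q" if "q \<in> V" for q
    using conn_coeffs_expand[OF V X Y that] by simp
qed

text \<open>The bracket has to be a smooth field, since \<open>D\<close> is constrained only on such
  arguments; a torsion-free connection will supply this.\<close>

lemma curvature_coeffs:
  assumes V: "V \<subseteq> U" and X: "smooth_field_on M V X" and Y: "smooth_field_on M V Y" and Z: "smooth_field_on M V Z"
    and B: "smooth_field_on M V (lie_bracket M X Y)" and q: "q \<in> V"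
  shows "curvature M D X Y Z q \<in> tangent_space M q"
    and "l \<in> K \<Longrightarrow> curvature M D X Y Z q (crd l) =
      (\<Sum>i\<in>K. \<Sum>j\<in>K. \<Sum>k\<in>K. X q (crd i) * Y q (crd j) * Z q (crd k) * curv_coeff G i j k l q)"
proof -
  have Vo: "openin (mtop M) V" by (rule smooth_field_onD[OF X])
  have qU: "q \<in> U" using q V by blast
  note sf = conn_coeffs_smooth_field[OF V]
  have T: "D X (D Y Z) q \<in> tangent_space M q" "D Y (D X Z) q \<in> tangent_space M q"
    "D (lie_bracket M X Y) Z q \<in> tangent_space M q"
    using smooth_field_onD(2)[OF sf q] sf X Y Z B by blast+
  have "(\<lambda>f. 1 * (1 * D X (D Y Z) q f + (-1) * D Y (D X Z) q f) + (-1) * D (lie_bracket M X Y) Z q f) \<in> tangent_space M q"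
    by (intro tangent_linear T qU)
  then show "curvature M D X Y Z q \<in> tangent_space M q" by (simp add: curvature_def)
  assume l: "l \<in> K"
  have near: "smooth_near M q f" if "smooth_fun_on M V f" for f
    using that q by (rule smooth_nearI)
  have Gs: "smooth_fun_on M V (G i k l)" if "i \<in> K" "k \<in> K" for i k
    by (rule smooth_fun_on_subset[OF conn_coeffs_smooth[OF that l] Vo V])
  \<comment> \<open>The coordinate formula for \<open>D Y Z\<close>, differentiated along
    \<open>X\<close>; proved for arbitrary \<open>X\<close> and \<open>Y\<close> because the
    curvature uses it in both orders.\<close>
  have second: "X q (\<lambda>r. D Y Z r (crd l)) = X q (\<lambda>r. Y r (\<lambda>s. Z s (crd l))) +
      (\<Sum>i\<in>K. \<Sum>k\<in>K. X q (\<lambda>r. Y r (crd i)) * Z q (crd k) * G i k l q + Y q (crd i) * X q (\<lambda>r. Z r (crd k)) * G i k l q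
         + Y q (crd i) * Z q (crd k) * (\<Sum>j\<in>K. X q (crd j) * pd j q (G i k l)))"
    if X: "smooth_field_on M V X" and Y: "smooth_field_on M V Y" for X Y
  proof -
    note Xq = smooth_field_onD(2)[OF X q]
    note sm = smooth_field_onD(3)[OF Y order_refl] smooth_field_comp[OF Y V] smooth_field_comp[OF Z V] Gs l Vo
    have "X q (\<lambda>r. D Y Z r (crd l)) = X q (\<lambda>r. Y r (\<lambda>s. Z s (crd l)) + (\<Sum>i\<in>K. \<Sum>k\<in>K. Y r (crd i) * Z r (crd k) * G i k l r))"
      by (rule tangent_cong[OF Xq Vo q qU]) (rule conn_coeffs_crd[OF V Y Z _ l])
    also have "\<dots> = X q (\<lambda>r. Y r (\<lambda>s. Z s (crd l))) + X q (\<lambda>r. \<Sum>i\<in>K. \<Sum>k\<in>K. Y r (crd i) * Z r (crd k) * G i k l r)"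
      by (intro tangent_add[OF Xq qU] near sm smooth_fun_on_sum smooth_fun_on_mult)
    also have "X q (\<lambda>r. \<Sum>i\<in>K. \<Sum>k\<in>K. Y r (crd i) * Z r (crd k) * G i k l r) =
        (\<Sum>i\<in>K. X q (\<lambda>r. \<Sum>k\<in>K. Y r (crd i) * Z r (crd k) * G i k l r))"
      by (intro tangent_sum[OF Xq qU] near sm smooth_fun_on_sum smooth_fun_on_mult)
    also have "\<dots> = (\<Sum>i\<in>K. \<Sum>k\<in>K. X q (\<lambda>r. Y r (crd i) * Z r (crd k) * G i k l r))"
      by (intro sum.cong refl tangent_sum[OF Xq qU] near sm smooth_fun_on_sum smooth_fun_on_mult)
    also have "\<dots> = (\<Sum>i\<in>K. \<Sum>k\<in>K. X q (\<lambda>r. Y r (crd i)) * Z q (crd k) * G i k l q + Y q (crd i) * X q (\<lambda>r. Z r (crd k)) * G i k l q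
         + Y q (crd i) * Z q (crd k) * (\<Sum>j\<in>K. X q (crd j) * pd j q (G i k l)))"
    proof (intro sum.cong refl)
      fix i k assume ik: "i \<in> K" "k \<in> K"
      note s = near[OF smooth_field_comp[OF Y V ik(1)]] near[OF smooth_field_comp[OF Z V ik(2)]] near[OF Gs[OF ik]]
      have "X q (\<lambda>r. Y r (crd i) * Z r (crd k) * G i k l r) =
          X q (\<lambda>r. Y r (crd i)) * Z q (crd k) * G i k l q + Y q (crd i) * X q (\<lambda>r. Z r (crd k)) * G i k l q
            + Y q (crd i) * Z q (crd k) * X q (G i k l)"
        by (simp only: tangent_mult[OF Xq qU smooth_near_mult[OF s(1,2)] s(3)] tangent_mult[OF Xq qU s(1,2)] distrib_right)
      also have "X q (G i k l) = (\<Sum>j\<in>K. X q (crd j) * pd j q (G i k l))"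
        by (rule fun_cong[OF tangent_expand[OF Xq qU]])
      finally show "X q (\<lambda>r. Y r (crd i) * Z r (crd k) * G i k l r) =
          X q (\<lambda>r. Y r (crd i)) * Z q (crd k) * G i k l q + Y q (crd i) * X q (\<lambda>r. Z r (crd k)) * G i k l q
            + Y q (crd i) * Z q (crd k) * (\<Sum>j\<in>K. X q (crd j) * pd j q (G i k l))" .
    qed
    finally show ?thesis .
  qed
  have DD: "D X (D Y Z) q (crd l) = X q (\<lambda>r. Y r (\<lambda>s. Z s (crd l))) +
      (\<Sum>i\<in>K. \<Sum>k\<in>K. X q (\<lambda>r. Y r (crd i)) * Z q (crd k) * G i k l q + Y q (crd i) * X q (\<lambda>r. Z r (crd k)) * G i k l q
         + Y q (crd i) * Z q (crd k) * (\<Sum>j\<in>K. X q (crd j) * pd j q (G i k l)))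
      + (\<Sum>i\<in>K. \<Sum>k\<in>K. X q (crd i) * (Y q (\<lambda>r. Z r (crd k)) + (\<Sum>a\<in>K. \<Sum>b\<in>K. Y q (crd a) * Z q (crd b) * G a b k q)) * G i k l q)"
    if X: "smooth_field_on M V X" and Y: "smooth_field_on M V Y" for X Y
  proof -
    have "(\<Sum>i\<in>K. \<Sum>k\<in>K. X q (crd i) * D Y Z q (crd k) * G i k l q) =
      (\<Sum>i\<in>K. \<Sum>k\<in>K. X q (crd i) * (Y q (\<lambda>r. Z r (crd k)) + (\<Sum>a\<in>K. \<Sum>b\<in>K. Y q (crd a) * Z q (crd b) * G a b k q)) * G i k l q)"
      by (intro sum.cong refl) (simp only: conn_coeffs_crd[OF V Y Z q])
    then show ?thesis
      unfolding conn_coeffs_crd[OF V X sf[OF Y Z] q l] second[OF X Y] by simp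
  qed
  have br: "lie_bracket M X Y q f = X q (\<lambda>r. Y r f) - Y q (\<lambda>r. X r f)" if "smooth_fun_on M V f" for f
    using near[OF that] by (simp add: lie_bracket_def)
  have crdV: "smooth_fun_on M V (crd i)" if "i \<in> K" for i
    by (rule smooth_fun_on_subset[OF smooth_fun_on_coord[OF chart that] Vo V])
  have BZ: "D (lie_bracket M X Y) Z q (crd l) = (X q (\<lambda>r. Y r (\<lambda>s. Z s (crd l))) - Y q (\<lambda>r. X r (\<lambda>s. Z s (crd l))))
     + (\<Sum>i\<in>K. \<Sum>k\<in>K. (X q (\<lambda>r. Y r (crd i)) - Y q (\<lambda>r. X r (crd i))) * Z q (crd k) * G i k l q)"
    unfolding conn_coeffs_crd[OF V B Z q l] using br[OF smooth_field_comp[OF Z V l]] br[OF crdV] by simp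
  show "curvature M D X Y Z q (crd l) =
      (\<Sum>i\<in>K. \<Sum>j\<in>K. \<Sum>k\<in>K. X q (crd i) * Y q (crd j) * Z q (crd k) * curv_coeff G i j k l q)"
    unfolding curvature_def DD[OF X Y] DD[OF Y X] BZ curv_coeff_def
    by (rule curvature_algebra[where g = "\<lambda>i k l. G i k l q" and dG = "\<lambda>j i k l. pd j q (G i k l)"])
qed

end

end

section \<open>Metrics and the Ricci tensor in a chart\<close>

text \<open>For square matrices a right inverse is a left inverse; enumerating \<open>K\<close>
  transfers the problem to matrices indexed by numbers below \<open>card K\<close>.\<close>

lemma finite_matrix_left_right_inverse:
  fixes A B :: "'k \<Rightarrow> 'k \<Rightarrow> real"
  assumes K: "finite K"
    and AB: "\<And>i k. i \<in> K \<Longrightarrow> k \<in> K \<Longrightarrow> (\<Sum>j\<in>K. A i j * B j k) = (if i = k then 1 else 0)"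
    and ik: "i \<in> K" "k \<in> K"
  shows "(\<Sum>j\<in>K. B i j * A j k) = (if i = k then 1 else 0)"
proof -
  define n where "n = card K"
  obtain b where b: "bij_betw b {0..<n} K"
    using ex_bij_betw_nat_finite[OF K] n_def by blast
  have bK: "b r \<in> K" if "r < n" for r using b that by (auto simp: bij_betw_def)
  have inj: "b r = b s \<longleftrightarrow> r = s" if "r < n" "s < n" for r s
    using b that by (auto simp: bij_betw_def inj_on_def)
  have S: "(\<Sum>j\<in>K. h j) = (\<Sum>r = 0..<n. h (b r))" for h :: "'k \<Rightarrow> real"
    by (rule sum.reindex_bij_betw[OF b, symmetric])
  let ?M = "\<lambda>A. mat n n (\<lambda>(r, s). A (b r) (b s) :: real)"
  have "?M A * ?M B = 1\<^sub>m n"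
  proof (rule eq_matI)
    fix r s assume "r < dim_row (1\<^sub>m n :: real mat)" "s < dim_col (1\<^sub>m n :: real mat)"
    then have rs: "r < n" "s < n" by auto
    then show "(?M A * ?M B) $$ (r, s) = 1\<^sub>m n $$ (r, s)"
      using AB[OF bK[OF rs(1)] bK[OF rs(2)]] inj[OF rs] by (simp add: scalar_prod_def S)
  qed auto
  then have BA: "?M B * ?M A = 1\<^sub>m n"
    by (rule mat_mult_left_right_inverse[rotated 2]) auto
  have "i \<in> b ` {0..<n}" "k \<in> b ` {0..<n}" using b ik by (simp_all add: bij_betw_def)
  then obtain r s where rs: "r < n" "s < n" "b r = i" "b s = k" by auto
  have "(?M B * ?M A) $$ (r, s) = (\<Sum>j\<in>K. B i j * A j k)"
    using rs by (simp add: scalar_prod_def S)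
  then show ?thesis using BA inj[OF rs(1,2)] rs by simp
qed

lemma orthonormal_frame_onD:
  assumes "orthonormal_frame_on M V E"
  shows "k \<in> midx M \<Longrightarrow> smooth_field_on M V (E k)"
    and "j \<in> midx M \<Longrightarrow> k \<in> midx M \<Longrightarrow> q \<in> V \<Longrightarrow> j \<noteq> k \<Longrightarrow> mmetric M q (E j q) (E k q) = 0"
    and "k \<in> midx M \<Longrightarrow> q \<in> V \<Longrightarrow> mmetric M q (E k q) (E k q) = 1 \<or> mmetric M q (E k q) (E k q) = -1"
  using assms by (auto simp: orthonormal_frame_on_def)

text \<open>Positivity is left out so that the Lorentzian product qualifies, and frames are left out
  so that Gram-Schmidt can be carried out at this level, before their existence is known.\<close>

locale bilinear_manifold = atlas_manifold M for M :: "('a, 'k) manifold" +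
  assumes metric_linear: "p \<in> topspace (mtop M) \<Longrightarrow> u \<in> tangent_space M p \<Longrightarrow> v \<in> tangent_space M p \<Longrightarrow>
        w \<in> tangent_space M p \<Longrightarrow> mmetric M p (\<lambda>f. a * u f + b * v f) w = a * mmetric M p u w + b * mmetric M p v w"
    and metric_sym: "p \<in> topspace (mtop M) \<Longrightarrow> u \<in> tangent_space M p \<Longrightarrow> v \<in> tangent_space M p \<Longrightarrow>
        mmetric M p u v = mmetric M p v u"
    and metric_coord_smooth: "(U, c) \<in> matlas M \<Longrightarrow> j \<in> midx M \<Longrightarrow> k \<in> midx M \<Longrightarrow>
        smooth_fun_on M U (\<lambda>q. mmetric M q (coord_vec M (U, c) j q) (coord_vec M (U, c) k q))"

text \<open>Local orthonormal frames play the part of nondegeneracy; they also give the choice by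
  \<open>SOME\<close> in \<open>ricci\<close> something to choose.\<close>

locale metric_manifold = bilinear_manifold M for M :: "('a, 'k) manifold" +
  assumes orthonormal_frame_exists: "p \<in> topspace (mtop M) \<Longrightarrow>
        \<exists>E V. openin (mtop M) V \<and> p \<in> V \<and> orthonormal_frame_on M V E"

locale bilinear_chart = bilinear_manifold M + chart M U c
  for M :: "('a, 'k) manifold" and U c
begin

abbreviation "gm j k q \<equiv> mmetric M q (pd j q) (pd k q)"

lemma tangent_combination_closed:
  assumes p: "p \<in> U" and J: "finite J" and u: "\<And>j. j \<in> J \<Longrightarrow> u j \<in> tangent_space M p"
  shows "(\<lambda>f. \<Sum>j\<in>J. a j * u j f) \<in> tangent_space M p"
  using J u
proof (induction J rule: finite_induct)
  case empty
  show ?case using tangent_combination[OF p, of "\<lambda>k. 0"] by simp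
next
  case (insert j J)
  then show ?case using tangent_linear[OF _ _ p, of "u j" "\<lambda>f. \<Sum>j\<in>J. a j * u j f" "a j" 1] by simp
qed

lemma metric_sum:
  assumes p: "p \<in> U" and J: "finite J" and u: "\<And>j. j \<in> J \<Longrightarrow> u j \<in> tangent_space M p"
    and w: "w \<in> tangent_space M p"
  shows "mmetric M p (\<lambda>f. \<Sum>j\<in>J. a j * u j f) w = (\<Sum>j\<in>J. a j * mmetric M p (u j) w)"
  using J u
proof (induction J rule: finite_induct)
  case empty
  show ?case using metric_linear[OF U_topspace[OF p] w w w, of 0 0] by simp
next
  case (insert j J)
  have "(\<lambda>f. \<Sum>j\<in>J. a j * u j f) \<in> tangent_space M p"
    by (rule tangent_combination_closed[OF p]) (use insert in auto)
  from metric_linear[OF U_topspace[OF p] _ this w, of "u j" "a j" 1] insert show ?case by simp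
qed

lemma metric_expand_left:
  assumes p: "p \<in> U" and u: "u \<in> tangent_space M p" and w: "w \<in> tangent_space M p"
  shows "mmetric M p u w = (\<Sum>j\<in>K. u (crd j) * mmetric M p (pd j p) w)"
  by (subst (1) tangent_expand[OF u p]) (rule metric_sum[OF p finite_midx coord_vec_tangent[OF p] w])

lemma metric_expand_right:
  assumes p: "p \<in> U" and u: "u \<in> tangent_space M p" and w: "w \<in> tangent_space M p"
  shows "mmetric M p u w = (\<Sum>k\<in>K. w (crd k) * mmetric M p u (pd k p))"
proof -
  note sym = metric_sym[OF U_topspace[OF p] u]
  have "mmetric M p u w = (\<Sum>j\<in>K. w (crd j) * mmetric M p (pd j p) u)"
    unfolding sym[OF w] by (rule metric_expand_left[OF p w u])
  also have "\<dots> = (\<Sum>k\<in>K. w (crd k) * mmetric M p u (pd k p))"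
    by (intro sum.cong refl) (simp add: sym coord_vec_tangent p)
  finally show ?thesis .
qed

lemma metric_expand:
  assumes p: "p \<in> U" and u: "u \<in> tangent_space M p" and w: "w \<in> tangent_space M p"
  shows "mmetric M p u w = (\<Sum>j\<in>K. \<Sum>k\<in>K. u (crd j) * w (crd k) * gm j k p)"
  unfolding metric_expand_left[OF assms]
  by (intro sum.cong refl) (simp add: metric_expand_right[OF p coord_vec_tangent[OF p] w] sum_distrib_left mult.assoc)

lemma gm_sym: "q \<in> U \<Longrightarrow> j \<in> K \<Longrightarrow> k \<in> K \<Longrightarrow> gm j k q = gm k j q"
  by (rule metric_sym) (auto intro: U_topspace coord_vec_tangent)

lemma gm_smooth: "j \<in> K \<Longrightarrow> k \<in> K \<Longrightarrow> smooth_fun_on M U (gm j k)"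
  by (rule metric_coord_smooth[OF chart])

lemma metric_smooth:
  assumes V: "V \<subseteq> U" and X: "smooth_field_on M V X" and Y: "smooth_field_on M V Y"
  shows "smooth_fun_on M V (\<lambda>q. mmetric M q (X q) (Y q))"
proof (rule smooth_fun_on_cong)
  have Vo: "openin (mtop M) V" by (rule smooth_field_onD[OF X])
  show "smooth_fun_on M V (\<lambda>q. \<Sum>j\<in>K. \<Sum>k\<in>K. X q (crd j) * Y q (crd k) * gm j k q)"
    by (intro smooth_fun_on_sum smooth_fun_on_mult smooth_field_comp[OF X V] smooth_field_comp[OF Y V] Vo
        smooth_fun_on_subset[OF gm_smooth Vo V])
  show "(\<Sum>j\<in>K. \<Sum>k\<in>K. X q (crd j) * Y q (crd k) * gm j k q) = mmetric M q (X q) (Y q)" if "q \<in> V" for q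
    by (rule metric_expand[symmetric]) (use that V smooth_field_onD[OF X] smooth_field_onD[OF Y] in auto)
qed

end

locale metric_chart = bilinear_chart M U c + metric_manifold M
  for M :: "('a, 'k) manifold" and U c
begin

text \<open>Orthonormality says \<open>e h\<^sup>T = 1\<close> for the matrix \<open>e\<close> of frame components; here it is turned into \<open>h\<^sup>T e = 1\<close>.\<close>

lemma frame_dual:
  assumes E: "orthonormal_frame_on M V E" and p: "p \<in> V" "p \<in> U" and ab: "a \<in> K" "b \<in> K"
  shows "(\<Sum>k\<in>K. mmetric M p (E k p) (E k p) * E k p (crd a) * (\<Sum>d\<in>K. gm b d p * E k p (crd d))) = (if a = b then 1 else 0)"
proof -
  define e where "e k a = E k p (crd a)" for k a
  define \<epsilon> where "\<epsilon> k = mmetric M p (E k p) (E k p)" for k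
  have Et: "E k p \<in> tangent_space M p" if "k \<in> K" for k
    by (rule smooth_field_onD(2)[OF orthonormal_frame_onD(1)[OF E that] p(1)])
  \<comment> \<open>The sign \<open>\<epsilon> k\<close> is its own inverse, so multiplying by it
    turns the diagonal into 1.\<close>
  have on: "mmetric M p (E j p) (E k p) * \<epsilon> k = (if j = k then 1 else 0)" if "j \<in> K" "k \<in> K" for j k
    using orthonormal_frame_onD(2)[OF E that p(1)] orthonormal_frame_onD(3)[OF E that(1) p(1)]
    by (auto simp: \<epsilon>_def)
  have "(\<Sum>k\<in>K. (\<epsilon> k * (\<Sum>d\<in>K. gm b d p * e k d)) * e k a) = (if b = a then 1 else 0)"
  proof (rule finite_matrix_left_right_inverse[where A = e and B = "\<lambda>b k. \<epsilon> k * (\<Sum>d\<in>K. gm b d p * e k d)",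
        OF finite_midx _ ab(2,1)])
    fix j k assume jk: "j \<in> K" "k \<in> K"
    have "(\<Sum>b\<in>K. e j b * (\<epsilon> k * (\<Sum>d\<in>K. gm b d p * e k d))) = mmetric M p (E j p) (E k p) * \<epsilon> k"
      unfolding metric_expand[OF p(2) Et[OF jk(1)] Et[OF jk(2)]] e_def
      by (simp add: sum_distrib_left sum_distrib_right mult_ac)
    with on[OF jk] show "(\<Sum>b\<in>K. e j b * (\<epsilon> k * (\<Sum>d\<in>K. gm b d p * e k d))) = (if j = k then 1 else 0)" by simp
  qed
  then show ?thesis unfolding e_def \<epsilon>_def by (simp add: mult_ac eq_commute)
qed

text \<open>\<open>frame_dual\<close> writes the Kronecker delta through a frame; inserting it
  expands \<open>s a\<close> into multiples of the contractions that vanish.\<close>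

lemma metric_nondegenerate:
  assumes p: "p \<in> U" and s: "\<And>j. j \<in> K \<Longrightarrow> (\<Sum>b\<in>K. s b * gm b j p) = 0" and a: "a \<in> K"
  shows "s a = 0"
proof -
  obtain E V where E: "orthonormal_frame_on M V E" "p \<in> V"
    using orthonormal_frame_exists[OF U_topspace[OF p]] by blast
  let ?\<epsilon> = "\<lambda>k. mmetric M p (E k p) (E k p)"
  have "s a = (\<Sum>b\<in>K. s b * (if a = b then 1 else 0))"
  proof -
    have "(\<Sum>b\<in>K. s b * (if a = b then 1 else 0)) = (\<Sum>b\<in>K. if a = b then s b else 0)"
      by (intro sum.cong) auto
    then show ?thesis using finite_midx a by simp
  qed
  also have "\<dots> = (\<Sum>b\<in>K. s b * (\<Sum>k\<in>K. ?\<epsilon> k * E k p (crd a) * (\<Sum>d\<in>K. gm b d p * E k p (crd d))))"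
    by (intro sum.cong refl) (simp only: frame_dual[OF E p a])
  also have "\<dots> = (\<Sum>b\<in>K. \<Sum>k\<in>K. \<Sum>d\<in>K. ?\<epsilon> k * E k p (crd a) * E k p (crd d) * (s b * gm b d p))"
    by (simp add: sum_distrib_left mult_ac)
  also have "\<dots> = (\<Sum>d\<in>K. \<Sum>k\<in>K. \<Sum>b\<in>K. ?\<epsilon> k * E k p (crd a) * E k p (crd d) * (s b * gm b d p))"
    by (rule sum_swap_outer)
  also have "\<dots> = 0" by (simp add: sum_distrib_left[symmetric] s)
  finally show ?thesis .
qed

text \<open>\<open>R k\<close> is the image of the \<open>k\<close>-th frame vector under an
  endomorphism with matrix \<open>A\<close>. The signs in the sum are those of the dual basis, so
  \<open>frame_dual\<close> collapses the sum over the frame in any signature.\<close>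

lemma frame_trace:
  assumes E: "orthonormal_frame_on M V E" and p: "p \<in> V" "p \<in> U"
    and R: "\<And>k. k \<in> K \<Longrightarrow> R k \<in> tangent_space M p"
    and A: "\<And>k l. k \<in> K \<Longrightarrow> l \<in> K \<Longrightarrow> R k (crd l) = (\<Sum>j\<in>K. E k p (crd j) * A j l)"
  shows "(\<Sum>k\<in>K. mmetric M p (E k p) (E k p) * mmetric M p (R k) (E k p)) = (\<Sum>l\<in>K. A l l)"
proof -
  let ?\<epsilon> = "\<lambda>k. mmetric M p (E k p) (E k p)"
  have Et: "E k p \<in> tangent_space M p" if "k \<in> K" for k
    by (rule smooth_field_onD(2)[OF orthonormal_frame_onD(1)[OF E that] p(1)])
  have "(\<Sum>k\<in>K. ?\<epsilon> k * mmetric M p (R k) (E k p)) =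
      (\<Sum>k\<in>K. ?\<epsilon> k * (\<Sum>l\<in>K. \<Sum>d\<in>K. (\<Sum>j\<in>K. E k p (crd j) * A j l) * E k p (crd d) * gm l d p))"
    by (intro sum.cong refl arg_cong2[where f = times]) (simp add: metric_expand[OF p(2) R Et] A)
  also have "\<dots> = (\<Sum>k\<in>K. \<Sum>l\<in>K. \<Sum>j\<in>K. A j l * (?\<epsilon> k * E k p (crd j) * (\<Sum>d\<in>K. gm l d p * E k p (crd d))))"
  proof (rule sum.cong[OF refl])
    fix k
    have "?\<epsilon> k * (\<Sum>l\<in>K. \<Sum>d\<in>K. (\<Sum>j\<in>K. E k p (crd j) * A j l) * E k p (crd d) * gm l d p) =
        (\<Sum>l\<in>K. \<Sum>d\<in>K. \<Sum>j\<in>K. A j l * (?\<epsilon> k * E k p (crd j) * (gm l d p * E k p (crd d))))"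
      by (simp add: sum_distrib_left sum_distrib_right mult_ac)
    also have "\<dots> = (\<Sum>l\<in>K. \<Sum>j\<in>K. \<Sum>d\<in>K. A j l * (?\<epsilon> k * E k p (crd j) * (gm l d p * E k p (crd d))))"
      by (intro sum.cong refl sum.swap)
    finally show "?\<epsilon> k * (\<Sum>l\<in>K. \<Sum>d\<in>K. (\<Sum>j\<in>K. E k p (crd j) * A j l) * E k p (crd d) * gm l d p) =
        (\<Sum>l\<in>K. \<Sum>j\<in>K. A j l * (?\<epsilon> k * E k p (crd j) * (\<Sum>d\<in>K. gm l d p * E k p (crd d))))"
      by (simp add: sum_distrib_left)
  qed
  also have "\<dots> = (\<Sum>j\<in>K. \<Sum>l\<in>K. \<Sum>k\<in>K. A j l * (?\<epsilon> k * E k p (crd j) * (\<Sum>d\<in>K. gm l d p * E k p (crd d))))"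
    by (rule sum_swap_outer)
  also have "\<dots> = (\<Sum>j\<in>K. \<Sum>l\<in>K. A j l * (if j = l then 1 else 0))"
    by (intro sum.cong refl) (simp only: sum_distrib_left[symmetric] frame_dual[OF E p])
  also have "\<dots> = (\<Sum>l\<in>K. A l l)"
  proof (rule sum.cong[OF refl])
    fix j assume "j \<in> K"
    have "(\<Sum>l\<in>K. A j l * (if j = l then 1 else 0)) = (\<Sum>l\<in>K. if j = l then A j l else 0)"
      by (intro sum.cong) auto
    then show "(\<Sum>l\<in>K. A j l * (if j = l then 1 else 0)) = A j j" using \<open>j \<in> K\<close> finite_midx by simp
  qed
  finally show ?thesis .
qed

text \<open>Contracting the second argument of the curvature with the result reproduces the sign
  convention of \<open>ricci\<close>.\<close>

definition ricci_coeff :: "('k \<Rightarrow> 'k \<Rightarrow> 'k \<Rightarrow> 'a \<Rightarrow> real) \<Rightarrow> 'k \<Rightarrow> 'k \<Rightarrow> 'a \<Rightarrow> real" where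
  "ricci_coeff G i k q = (\<Sum>j\<in>K. curv_coeff G i j k j q)"

text \<open>The frame picked by \<open>SOME\<close> drops out because its sum is a trace.\<close>

lemma ricci_coeffs:
  assumes G: "conn_coeffs D G"
    and B: "\<And>V X Y. V \<subseteq> U \<Longrightarrow> smooth_field_on M V X \<Longrightarrow> smooth_field_on M V Y \<Longrightarrow> smooth_field_on M V (lie_bracket M X Y)"
    and X: "smooth_field_on M W X" and Y: "smooth_field_on M W Y" and p: "p \<in> W" "p \<in> U"
  shows "ricci M D X Y p = (\<Sum>i\<in>K. \<Sum>k\<in>K. X p (crd i) * Y p (crd k) * ricci_coeff G i k p)"
proof -
  let ?P = "\<lambda>E. \<exists>V. openin (mtop M) V \<and> p \<in> V \<and> orthonormal_frame_on M V E"
  define E where "E = (SOME E. ?P E)"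
  have "?P E" unfolding E_def
    by (rule someI_ex[OF orthonormal_frame_exists[OF U_topspace[OF p(2)]]])
  then obtain V where V: "openin (mtop M) V" "p \<in> V" and E: "orthonormal_frame_on M V E" by blast
  \<comment> \<open>Frame, fields and chart live on three different open sets; the curvature is
    computed on their intersection.\<close>
  define O1 where "O1 = V \<inter> W \<inter> U"
  have O1: "openin (mtop M) O1" "O1 \<subseteq> U" "O1 \<subseteq> W" "O1 \<subseteq> V" "p \<in> O1"
    using V p U_open smooth_field_onD(1)[OF X] by (auto simp: O1_def)
  note X1 = smooth_field_on_subset[OF X O1(1,3)] and Y1 = smooth_field_on_subset[OF Y O1(1,3)]
  have E1: "smooth_field_on M O1 (E k)" if "k \<in> K" for k
    by (rule smooth_field_on_subset[OF orthonormal_frame_onD(1)[OF E that] O1(1,4)])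
  define A where "A j l = (\<Sum>i\<in>K. \<Sum>k\<in>K. X p (crd i) * Y p (crd k) * curv_coeff G i j k l p)" for j l
  have "ricci M D X Y p = (\<Sum>k\<in>K. mmetric M p (E k p) (E k p) * mmetric M p (curvature M D X (E k) Y p) (E k p))"
    by (simp add: ricci_def E_def Let_def)
  also have "\<dots> = (\<Sum>l\<in>K. A l l)"
  proof (rule frame_trace[where A = A, OF E V(2) p(2)])
    fix k assume k: "k \<in> K"
    note B1 = B[OF O1(2) X1 E1[OF k]]
    show "curvature M D X (E k) Y p \<in> tangent_space M p"
      by (rule curvature_coeffs(1)[OF G O1(2) X1 E1[OF k] Y1 B1 O1(5)])
    fix l assume l: "l \<in> K"
    have "curvature M D X (E k) Y p (crd l) =
      (\<Sum>i\<in>K. \<Sum>j\<in>K. \<Sum>k'\<in>K. X p (crd i) * E k p (crd j) * Y p (crd k') * curv_coeff G i j k' l p)"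
      by (rule curvature_coeffs(2)[OF G O1(2) X1 E1[OF k] Y1 B1 O1(5) l])
    also have "\<dots> = (\<Sum>j\<in>K. \<Sum>i\<in>K. \<Sum>k'\<in>K. X p (crd i) * E k p (crd j) * Y p (crd k') * curv_coeff G i j k' l p)"
      by (rule sum.swap)
    also have "\<dots> = (\<Sum>j\<in>K. E k p (crd j) * A j l)"
      by (simp add: A_def sum_distrib_left mult_ac)
    finally show "curvature M D X (E k) Y p (crd l) = (\<Sum>j\<in>K. E k p (crd j) * A j l)" .
  qed
  also have "\<dots> = (\<Sum>i\<in>K. \<Sum>l\<in>K. \<Sum>k\<in>K. X p (crd i) * Y p (crd k) * curv_coeff G i l k l p)"
    unfolding A_def by (rule sum.swap)
  also have "\<dots> = (\<Sum>i\<in>K. \<Sum>k\<in>K. \<Sum>l\<in>K. X p (crd i) * Y p (crd k) * curv_coeff G i l k l p)"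
    by (intro sum.cong refl sum.swap)
  finally show ?thesis by (simp add: ricci_coeff_def sum_distrib_left)
qed

text \<open>Coordinate fields are smooth on \<open>U\<close> and hence admissible in
  \<open>einstein\<close>; evaluating on them isolates a single coefficient.\<close>

lemma einstein_coeffs:
  assumes G: "conn_coeffs D G"
    and B: "\<And>V X Y. V \<subseteq> U \<Longrightarrow> smooth_field_on M V X \<Longrightarrow> smooth_field_on M V Y \<Longrightarrow> smooth_field_on M V (lie_bracket M X Y)"
    and D: "einstein M D \<alpha>" and p: "p \<in> U" and ij: "i \<in> K" "j \<in> K"
  shows "ricci_coeff G i j p = \<alpha> * gm i j p"
proof -
  note s = smooth_field_coord_vec[OF _ U_open order_refl]
  have "(\<Sum>a\<in>K. \<Sum>b\<in>K. pd i p (crd a) * pd j p (crd b) * ricci_coeff G a b p) = ricci M D (pd i) (pd j) p"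
    by (rule ricci_coeffs[OF G B s s p p, symmetric]) (use ij in auto)
  also have "\<dots> = \<alpha> * gm i j p"
    using D s ij p unfolding einstein_def by blast
  also have "(\<Sum>a\<in>K. \<Sum>b\<in>K. pd i p (crd a) * pd j p (crd b) * ricci_coeff G a b p) =
      (\<Sum>a\<in>K. \<Sum>b\<in>K. if a = i then (if b = j then ricci_coeff G a b p else 0) else 0)"
    by (intro sum.cong refl) (simp add: coord_vec_crd p ij)
  also have "\<dots> = (\<Sum>a\<in>K. if a = i then (\<Sum>b\<in>K. if b = j then ricci_coeff G a b p else 0) else 0)"
    by (intro sum.cong refl) simp
  also have "\<dots> = ricci_coeff G i j p"
    using finite_midx ij by simp
  finally show ?thesis .
qed

text \<open>The pointwise converse of \<open>einstein_coeffs\<close>: only coefficients at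
  \<open>p\<close> enter, so each point may be treated in a chart of its own.\<close>

lemma ricci_eq_metric:
  assumes G: "conn_coeffs D G"
    and B: "\<And>V X Y. V \<subseteq> U \<Longrightarrow> smooth_field_on M V X \<Longrightarrow> smooth_field_on M V Y \<Longrightarrow> smooth_field_on M V (lie_bracket M X Y)"
    and R: "\<And>i j. i \<in> K \<Longrightarrow> j \<in> K \<Longrightarrow> ricci_coeff G i j p = \<alpha> * gm i j p"
    and X: "smooth_field_on M W X" and Y: "smooth_field_on M W Y" and p: "p \<in> W" "p \<in> U"
  shows "ricci M D X Y p = \<alpha> * mmetric M p (X p) (Y p)"
proof -
  have "ricci M D X Y p = (\<Sum>i\<in>K. \<Sum>k\<in>K. X p (crd i) * Y p (crd k) * ricci_coeff G i k p)"
    by (rule ricci_coeffs[OF G B X Y p])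
  also have "\<dots> = (\<Sum>i\<in>K. \<Sum>k\<in>K. X p (crd i) * Y p (crd k) * (\<alpha> * gm i k p))"
    by (intro sum.cong refl) (simp add: R)
  also have "\<dots> = \<alpha> * (\<Sum>i\<in>K. \<Sum>k\<in>K. X p (crd i) * Y p (crd k) * gm i k p)"
    by (simp add: sum_distrib_left mult_ac)
  also have "\<dots> = \<alpha> * mmetric M p (X p) (Y p)"
    by (subst metric_expand[OF p(2)]) (use smooth_field_onD(2)[OF X p(1)] smooth_field_onD(2)[OF Y p(1)] in auto)
  finally show ?thesis .
qed

lemma conn_coeffs_cong:
  assumes G: "conn_coeffs D G" and eq: "\<And>i k l q. i \<in> K \<Longrightarrow> k \<in> K \<Longrightarrow> l \<in> K \<Longrightarrow> q \<in> U \<Longrightarrow> G i k l q = H i k l q"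
  shows "conn_coeffs D H"
  unfolding conn_coeffs_def
proof (intro conjI ballI allI impI)
  show "smooth_fun_on M U (H i k l)" if "i \<in> K" "k \<in> K" "l \<in> K" for i k l
    by (rule smooth_fun_on_cong[OF conn_coeffs_smooth[OF G that]]) (rule eq[OF that])
  fix V X Y q assume V: "V \<subseteq> U" "smooth_field_on M V X" "smooth_field_on M V Y" "q \<in> V"
  then have "q \<in> U" by blast
  then show "D X Y q = (\<lambda>f. \<Sum>l\<in>K. (X q (\<lambda>r. Y r (crd l)) +
           (\<Sum>i\<in>K. \<Sum>k\<in>K. X q (crd i) * Y q (crd k) * H i k l q)) * pd l q f)"
    unfolding conn_coeffs_expand[OF G V] by (simp add: eq)
qed

text \<open>Both correction terms are tensorial and simply add to the coefficients: the one along
  \<open>X\<close> brings a Kronecker delta between direction and result, the one along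
  \<open>P\<close> the components of \<open>P\<close>.\<close>

lemma quarter_symmetric_coeffs:
  assumes G: "conn_coeffs D G" and P: "smooth_field_on M U P"
  shows "conn_coeffs (quarter_symmetric M P lam1 lam2 D)
     (\<lambda>i k l q. G i k l q + lam1 * mmetric M q (pd k q) (P q) * (if i = l then 1 else 0)
        - lam2 * gm i k q * P q (crd l))"
  unfolding conn_coeffs_def
proof (intro conjI ballI allI impI)
  fix i k l assume ik: "i \<in> K" "k \<in> K" "l \<in> K"
  show "smooth_fun_on M U (\<lambda>q. G i k l q + lam1 * mmetric M q (pd k q) (P q) * (if i = l then 1 else 0)
        - lam2 * gm i k q * P q (crd l))"
    by (intro smooth_fun_on_diff smooth_fun_on_add smooth_fun_on_mult conn_coeffs_smooth[OF G] ik smooth_fun_on_const U_open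
        metric_smooth order_refl smooth_field_coord_vec P smooth_field_comp)
next
  fix V X Y q assume V: "V \<subseteq> U" and X: "smooth_field_on M V X" and Y: "smooth_field_on M V Y" and q: "q \<in> V"
  have qU: "q \<in> U" using q V by blast
  note Xq = smooth_field_onD(2)[OF X q] and Yq = smooth_field_onD(2)[OF Y q] and Pq = smooth_field_onD(2)[OF P qU]
  let ?x = "\<lambda>i. X q (crd i)" and ?y = "\<lambda>i. Y q (crd i)" and ?\<pi> = "\<lambda>k. mmetric M q (pd k q) (P q)"
  show "quarter_symmetric M P lam1 lam2 D X Y q = (\<lambda>f. \<Sum>l\<in>K. (X q (\<lambda>r. Y r (crd l)) +
           (\<Sum>i\<in>K. \<Sum>k\<in>K. ?x i * ?y k * (G i k l q + lam1 * ?\<pi> k * (if i = l then 1 else 0)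
        - lam2 * gm i k q * P q (crd l)))) * pd l q f)"
  proof
    fix f
    have 1: "(\<Sum>i\<in>K. \<Sum>k\<in>K. ?x i * ?y k * (lam1 * ?\<pi> k * (if i = l then 1 else 0))) = lam1 * mmetric M q (Y q) (P q) * ?x l"
      if "l \<in> K" for l
    proof -
      have "(\<Sum>i\<in>K. \<Sum>k\<in>K. ?x i * ?y k * (lam1 * ?\<pi> k * (if i = l then 1 else 0))) =
          (\<Sum>i\<in>K. if i = l then ?x i * lam1 * (\<Sum>k\<in>K. ?y k * ?\<pi> k) else 0)"
        by (intro sum.cong refl) (simp add: sum_distrib_left mult_ac)
      then show ?thesis using that finite_midx by (simp add: metric_expand_left[OF qU Yq Pq] mult_ac)
    qed
    have 2: "(\<Sum>i\<in>K. \<Sum>k\<in>K. ?x i * ?y k * (lam2 * gm i k q * P q (crd l))) = lam2 * mmetric M q (X q) (Y q) * P q (crd l)" for l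
      unfolding metric_expand[OF qU Xq Yq] by (simp add: sum_distrib_left sum_distrib_right mult_ac)
    have 3: "(\<Sum>i\<in>K. \<Sum>k\<in>K. ?x i * ?y k * (G i k l q + lam1 * ?\<pi> k * (if i = l then 1 else 0) - lam2 * gm i k q * P q (crd l)))
      = (\<Sum>i\<in>K. \<Sum>k\<in>K. ?x i * ?y k * G i k l q) + lam1 * mmetric M q (Y q) (P q) * ?x l - lam2 * mmetric M q (X q) (Y q) * P q (crd l)"
      if "l \<in> K" for l
      unfolding right_diff_distrib distrib_left sum.distrib sum_subtractf 1[OF that] 2 ..
    have "quarter_symmetric M P lam1 lam2 D X Y q f = D X Y q f + lam1 * mmetric M q (Y q) (P q) * (\<Sum>l\<in>K. ?x l * pd l q f)
        - lam2 * mmetric M q (X q) (Y q) * (\<Sum>l\<in>K. P q (crd l) * pd l q f)"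
      unfolding quarter_symmetric_def fun_cong[OF tangent_expand[OF Xq qU], of f, symmetric]
        fun_cong[OF tangent_expand[OF Pq qU], of f, symmetric] ..
    also have "\<dots> = (\<Sum>l\<in>K. (X q (\<lambda>r. Y r (crd l)) + ((\<Sum>i\<in>K. \<Sum>k\<in>K. ?x i * ?y k * G i k l q) + lam1 * mmetric M q (Y q) (P q) * ?x l
        - lam2 * mmetric M q (X q) (Y q) * P q (crd l))) * pd l q f)"
      unfolding conn_coeffs_expand[OF G V X Y q] sum_distrib_left[of "_ * mmetric M q _ _"]
        sum.distrib[symmetric] sum_subtractf[symmetric]
      by (intro sum.cong refl) (simp add: distrib_right left_diff_distrib mult.assoc)
    also have "\<dots> = (\<Sum>l\<in>K. (X q (\<lambda>r. Y r (crd l)) +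
           (\<Sum>i\<in>K. \<Sum>k\<in>K. ?x i * ?y k * (G i k l q + lam1 * ?\<pi> k * (if i = l then 1 else 0)
        - lam2 * gm i k q * P q (crd l)))) * pd l q f)"
      by (intro sum.cong refl) (simp only: 3)
    finally show "quarter_symmetric M P lam1 lam2 D X Y q f = (\<Sum>l\<in>K. (X q (\<lambda>r. Y r (crd l)) +
           (\<Sum>i\<in>K. \<Sum>k\<in>K. ?x i * ?y k * (G i k l q + lam1 * ?\<pi> k * (if i = l then 1 else 0)
        - lam2 * gm i k q * P q (crd l)))) * pd l q f)" .
  qed
qed

section \<open>Christoffel symbols of a Levi-Civita connection\<close>

context
  fixes D :: "'a vfield \<Rightarrow> 'a vfield \<Rightarrow> 'a vfield"
  assumes lc: "levi_civita M D"
begin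

definition christoffel :: "'k \<Rightarrow> 'k \<Rightarrow> 'k \<Rightarrow> 'a \<Rightarrow> real" where
  "christoffel i k l q = D (pd i) (pd k) q (crd l)"

lemma levi_civita_affine: "affine_connection M D"
  using lc by (simp add: levi_civita_def)

lemma levi_civita_coeffs: "conn_coeffs D christoffel"
  using affine_connection_coeffs[OF levi_civita_affine] by (simp add: christoffel_def[abs_def])

text \<open>Read off from torsion-freeness: on \<open>V\<close> the bracket is \<open>D X Y\<close>
  minus \<open>D Y X\<close>, and both are smooth fields by the connection axioms. A direct argument
  would call for equality of mixed partial derivatives.\<close>

lemma levi_civita_bracket_smooth:
  assumes V: "V \<subseteq> U" and X: "smooth_field_on M V X" and Y: "smooth_field_on M V Y"
  shows "smooth_field_on M V (lie_bracket M X Y)"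
proof (rule smooth_field_on_cong)
  have Vo: "openin (mtop M) V" by (rule smooth_field_onD[OF X])
  show "smooth_field_on M V (\<lambda>q f. 1 * D X Y q f + (-1) * D Y X q f)"
    by (intro smooth_field_linear connection_smooth[OF levi_civita_affine Vo V] X Y V smooth_fun_on_const Vo)
  show "(\<lambda>f. 1 * D X Y q f + - 1 * D Y X q f) = lie_bracket M X Y q" if "q \<in> V" for q
  proof -
    have "(\<lambda>f. D X Y q f - D Y X q f) = lie_bracket M X Y q"
      using lc X Y that unfolding levi_civita_def by blast
    then show ?thesis by simp
  qed
qed

text \<open>The bracket of coordinate fields is evaluated only at coordinate functions, whose first
  derivatives are constant on \<open>U\<close>; mixed partials of general functions do not
  occur.\<close>

lemma christoffel_sym:
  assumes q: "q \<in> U" and ij: "i \<in> K" "j \<in> K" "l \<in> K"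
  shows "christoffel i j l q = christoffel j i l q"
proof -
  note s = smooth_field_coord_vec[OF _ U_open order_refl]
  have "(\<lambda>f. D (pd i) (pd j) q f - D (pd j) (pd i) q f) = lie_bracket M (pd i) (pd j) q"
    using lc s[OF ij(1)] s[OF ij(2)] q unfolding levi_civita_def by blast
  from fun_cong[OF this, of "crd l"]
  have "christoffel i j l q - christoffel j i l q = pd i q (\<lambda>r. pd j r (crd l)) - pd j q (\<lambda>r. pd i r (crd l))"
    using crd_smooth_near[OF q ij(3)] by (simp add: christoffel_def lie_bracket_def)
  moreover have "pd a q (\<lambda>r. pd b r (crd l)) = 0" if "a \<in> K" "b \<in> K" for a b
  proof -
    have "pd a q (\<lambda>r. pd b r (crd l)) = pd a q (\<lambda>r. if l = b then 1 else 0)"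
      by (rule coord_vec_cong[OF U_open q q that(1)]) (simp add: coord_vec_crd that ij)
    then show ?thesis by (simp add: coord_vec_const q that)
  qed
  ultimately show ?thesis using ij by simp
qed

lemma christoffel_metric:
  assumes q: "q \<in> U" and ij: "i \<in> K" "j \<in> K" "k \<in> K"
  shows "pd i q (gm j k) = (\<Sum>l\<in>K. christoffel i j l q * gm l k q) + (\<Sum>l\<in>K. christoffel i k l q * gm l j q)"
proof -
  note s = smooth_field_coord_vec[OF _ U_open order_refl]
  note t = smooth_field_onD(2)[OF connection_smooth[OF levi_civita_affine U_open order_refl s s] q]
  have "pd i q (gm j k) = mmetric M q (D (pd i) (pd j) q) (pd k q) + mmetric M q (pd j q) (D (pd i) (pd k) q)"
    using lc s[OF ij(1)] s[OF ij(2)] s[OF ij(3)] q unfolding levi_civita_def by blast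
  also have "mmetric M q (D (pd i) (pd j) q) (pd k q) = (\<Sum>l\<in>K. christoffel i j l q * gm l k q)"
    unfolding christoffel_def by (rule metric_expand_left[OF q t coord_vec_tangent[OF q]]) (use ij in auto)
  also have "mmetric M q (pd j q) (D (pd i) (pd k) q) = mmetric M q (D (pd i) (pd k) q) (pd j q)"
    by (rule metric_sym[OF U_topspace[OF q] coord_vec_tangent[OF q] t]) (use ij in auto)
  also have "\<dots> = (\<Sum>l\<in>K. christoffel i k l q * gm l j q)"
    unfolding christoffel_def by (rule metric_expand_left[OF q t coord_vec_tangent[OF q]]) (use ij in auto)
  finally show ?thesis .
qed

text \<open>The lowered difference of two solutions is symmetric in its first two and antisymmetric in its last two indices.\<close>

lemma christoffel_unique:
  assumes q: "q \<in> U"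
    and sym: "\<And>i j l. i \<in> K \<Longrightarrow> j \<in> K \<Longrightarrow> l \<in> K \<Longrightarrow> H i j l = H j i l"
    and met: "\<And>i j k. i \<in> K \<Longrightarrow> j \<in> K \<Longrightarrow> k \<in> K \<Longrightarrow>
      pd i q (gm j k) = (\<Sum>l\<in>K. H i j l * gm l k q) + (\<Sum>l\<in>K. H i k l * gm l j q)"
    and ij: "i \<in> K" "j \<in> K" "l \<in> K"
  shows "christoffel i j l q = H i j l"
proof -
  define S where "S i j k = (\<Sum>l\<in>K. (christoffel i j l q - H i j l) * gm l k q)" for i j k
  have 1: "S i j k = S j i k" if "i \<in> K" "j \<in> K" for i j k
    unfolding S_def by (intro sum.cong refl) (simp add: christoffel_sym[OF q that] sym[OF that])
  have 2: "S i j k = - S i k j" if "i \<in> K" "j \<in> K" "k \<in> K" for i j k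
    using met[OF that] christoffel_metric[OF q that]
    unfolding S_def left_diff_distrib sum_subtractf by linarith
  have 3: "S i j k = 0" if "i \<in> K" "j \<in> K" "k \<in> K" for i j k
  proof -
    \<comment> \<open>Alternating the two symmetries runs through all six orders of the indices;
      three sign changes make the value its own negative.\<close>
    have "S i j k = - S i k j" "S i k j = S k i j" "S k i j = - S k j i" "S k j i = S j k i" "S j k i = - S j i k" "S j i k = S i j k"
      using 1 2 that by blast+
    then show ?thesis by linarith
  qed
  have "christoffel i j l q - H i j l = 0"
    by (rule metric_nondegenerate[OF q _ ij(3), where s = "\<lambda>l. christoffel i j l q - H i j l"])
       (use 3[OF ij(1,2)] in \<open>simp add: S_def\<close>)
  then show ?thesis by simp
qed

end

end

section \<open>Orthonormal frames of Riemannian manifolds\<close>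

context bilinear_chart
begin

lemma smooth_field_sum:
  assumes V: "openin (mtop M) V" "V \<subseteq> U" and J: "finite J"
    and X: "\<And>j. j \<in> J \<Longrightarrow> smooth_field_on M V (X j)" and a: "\<And>j. j \<in> J \<Longrightarrow> smooth_fun_on M V (a j)"
  shows "smooth_field_on M V (\<lambda>q f. \<Sum>j\<in>J. a j q * X j q f)"
  using J X a
proof (induction J rule: finite_induct)
  case empty
  show ?case using smooth_field_combination[OF V, of "\<lambda>k q. 0"] smooth_fun_on_const[OF V(1)] by simp
next
  case (insert j J)
  then show ?case
    using smooth_field_linear[OF _ _ V(2) _ smooth_fun_on_const[OF V(1)],
        of "X j" "\<lambda>q f. \<Sum>j\<in>J. a j q * X j q f" "a j" 1] by simp
qed

text \<open>Gram--Schmidt orthonormalisation of the coordinate frame. The \<open>k\<close>-th vector before normalisation is nonzero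
  because its \<open>k\<close>-th coordinate is \<open>1\<close>.\<close>

lemma orthonormal_family_exists:
  assumes pos: "\<And>p u. p \<in> U \<Longrightarrow> u \<in> tangent_space M p \<Longrightarrow> u \<noteq> (\<lambda>f. 0) \<Longrightarrow> mmetric M p u u > 0"
    and J: "J \<subseteq> K"
  shows "\<exists>E. (\<forall>j\<in>J. smooth_field_on M U (E j)) \<and>
    (\<forall>q\<in>U. \<forall>j\<in>J. \<forall>k\<in>J. mmetric M q (E j q) (E k q) = (if j = k then 1 else 0)) \<and>
    (\<forall>q\<in>U. \<forall>j\<in>J. \<forall>l\<in>K - J. E j q (crd l) = 0)"
proof -
  have "finite J" using J finite_midx finite_subset by blast
  then show ?thesis using J
  proof (induction J rule: finite_induct)
    case empty
    show ?case by simp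
  next
    case (insert k J)
    have k: "k \<in> K" using insert.prems by simp
    obtain E where E: "\<And>j. j \<in> J \<Longrightarrow> smooth_field_on M U (E j)"
      and on: "\<And>q i j. q \<in> U \<Longrightarrow> i \<in> J \<Longrightarrow> j \<in> J \<Longrightarrow> mmetric M q (E i q) (E j q) = (if i = j then 1 else 0)"
      and tri: "\<And>q j l. q \<in> U \<Longrightarrow> j \<in> J \<Longrightarrow> l \<in> K \<Longrightarrow> l \<notin> J \<Longrightarrow> E j q (crd l) = 0"
      using insert.IH insert.prems by force
    have pdk: "smooth_field_on M U (pd k)" by (rule smooth_field_coord_vec[OF k U_open order_refl])
    define a where "a j q = mmetric M q (pd k q) (E j q)" for j q
    have a: "smooth_fun_on M U (a j)" if "j \<in> J" for j
      unfolding a_def by (rule metric_smooth[OF order_refl pdk E[OF that]])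
    \<comment> \<open>The literal factors 1 and -1 fit the two-term linearity rules for fields and
      for the metric.\<close>
    define v where "v q f = 1 * pd k q f + (-1) * (\<Sum>j\<in>J. a j q * E j q f)" for q f
    have sum_smooth: "smooth_field_on M U (\<lambda>q f. \<Sum>j\<in>J. a j q * E j q f)"
      by (rule smooth_field_sum[OF U_open order_refl insert.hyps(1) E a])
    have v: "smooth_field_on M U v"
      unfolding v_def[abs_def]
      by (rule smooth_field_linear[OF pdk sum_smooth order_refl smooth_fun_on_const[OF U_open] smooth_fun_on_const[OF U_open]])
    note vt = smooth_field_onD(2)[OF v] and Et = smooth_field_onD(2)[OF E] and pt = smooth_field_onD(2)[OF pdk]
    have ortho: "mmetric M q (v q) (E i q) = 0" if "q \<in> U" "i \<in> J" for q i
    proof -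
      have "mmetric M q (v q) (E i q) = 1 * mmetric M q (pd k q) (E i q)
          + (-1) * mmetric M q (\<lambda>f. \<Sum>j\<in>J. a j q * E j q f) (E i q)"
        unfolding v_def[abs_def]
        by (rule metric_linear[OF U_topspace[OF that(1)] pt[OF that(1)] smooth_field_onD(2)[OF sum_smooth that(1)] Et[OF that(2,1)]])
      also have "mmetric M q (\<lambda>f. \<Sum>j\<in>J. a j q * E j q f) (E i q) = (\<Sum>j\<in>J. a j q * mmetric M q (E j q) (E i q))"
        by (rule metric_sum[OF that(1) insert.hyps(1) Et[OF _ that(1)] Et[OF that(2,1)]])
      also have "\<dots> = (\<Sum>j\<in>J. if j = i then a j q else 0)"
        by (intro sum.cong refl) (simp add: on that)
      finally show ?thesis using insert.hyps(1) that by (simp add: a_def)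
    qed
    \<comment> \<open>Triangularity: the earlier frame vectors have no components outside
      \<open>J\<close>, so subtracting them leaves the \<open>k\<close>-th coordinate
      untouched.\<close>
    have vk: "v q (crd l) = (if l = k then 1 else 0)" if "q \<in> U" "l \<in> K" "l \<notin> J" for q l
      using that k tri by (simp add: v_def coord_vec_crd)
    have vpos: "mmetric M q (v q) (v q) > 0" if "q \<in> U" for q
    proof (rule pos[OF that vt[OF that]])
      show "v q \<noteq> (\<lambda>f. 0)" using vk[OF that k insert.hyps(2)] by (metis (full_types) zero_neq_one)
    qed
    \<comment> \<open>The reciprocal norm is written as a power, so that its smoothness follows from
      \<open>smooth_fun_on_powr\<close>.\<close>
    define N where "N q = mmetric M q (v q) (v q) powr (- 1 / 2)" for q
    have N: "smooth_fun_on M U N"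
      unfolding N_def[abs_def] by (rule smooth_fun_on_powr[OF metric_smooth[OF order_refl v v] vpos])
    define e where "e q f = N q * v q f + 0 * v q f" for q f
    have e: "smooth_field_on M U e"
      unfolding e_def[abs_def] by (rule smooth_field_linear[OF v v order_refl N smooth_fun_on_const[OF U_open]])
    have eg: "mmetric M q (e q) w = N q * mmetric M q (v q) w" if "q \<in> U" "w \<in> tangent_space M q" for q w
      using metric_linear[OF U_topspace[OF that(1)] vt[OF that(1)] vt[OF that(1)] that(2), of "N q" 0]
      by (simp add: e_def[abs_def])
    note et = smooth_field_onD(2)[OF e]
    have ee: "mmetric M q (e q) (e q) = 1" if "q \<in> U" for q
    proof -
      let ?n = "mmetric M q (v q) (v q)"
      have "mmetric M q (e q) (e q) = N q * mmetric M q (e q) (v q)"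
        using eg[OF that et[OF that]] metric_sym[OF U_topspace[OF that] vt[OF that] et[OF that]] by simp
      also have "\<dots> = N q * N q * ?n" using eg[OF that vt[OF that]] by simp
      also have "N q * N q = ?n powr (-1)"
        unfolding N_def by (simp flip: powr_add)
      also have "?n powr (-1) * ?n = 1"
        using vpos[OF that] by (simp add: powr_minus)
      finally show ?thesis .
    qed
    have eE: "mmetric M q (e q) (E i q) = 0" "mmetric M q (E i q) (e q) = 0" if "q \<in> U" "i \<in> J" for q i
      using eg[OF that(1) Et[OF that(2,1)]] ortho[OF that]
        metric_sym[OF U_topspace[OF that(1)] Et[OF that(2,1)] et[OF that(1)]] by auto
    let ?E = "E(k := e)"
    have "\<forall>j\<in>insert k J. smooth_field_on M U (?E j)" using E e insert.hyps by auto
    moreover have "\<forall>q\<in>U. \<forall>j\<in>insert k J. \<forall>i\<in>insert k J. mmetric M q (?E j q) (?E i q) = (if j = i then 1 else 0)"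
      using on ee eE insert.hyps(2) by auto
    moreover have "\<forall>q\<in>U. \<forall>j\<in>insert k J. \<forall>l\<in>K - insert k J. ?E j q (crd l) = 0"
      using tri vk by (auto simp: e_def)
    ultimately show ?case by blast
  qed
qed

end

lemma riemannian_metric_manifold:
  assumes M: "riemannian_manifold M"
  shows "metric_manifold M"
proof -
  note R = M[unfolded riemannian_manifold_def]
  interpret atlas_manifold M
    by (rule smooth_manifold_atlas_manifold) (use R in blast)
  interpret bilinear_manifold M
  proof
    show "mmetric M p (\<lambda>f. a * u f + b * v f) w = a * mmetric M p u w + b * mmetric M p v w"
      if "p \<in> topspace (mtop M)" "u \<in> tangent_space M p" "v \<in> tangent_space M p" "w \<in> tangent_space M p" for p u v w a b
      using R[THEN conjunct2, THEN conjunct1] that by blast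
    show "mmetric M p u v = mmetric M p v u"
      if "p \<in> topspace (mtop M)" "u \<in> tangent_space M p" "v \<in> tangent_space M p" for p u v
      using R[THEN conjunct2, THEN conjunct2, THEN conjunct1] that by blast
    show "smooth_fun_on M U (\<lambda>q. mmetric M q (coord_vec M (U, c) j q) (coord_vec M (U, c) k q))"
      if "(U, c) \<in> matlas M" "j \<in> midx M" "k \<in> midx M" for U c j k
    proof -
      interpret chart M U c by unfold_locales (rule that(1))
      show ?thesis
        using R[THEN conjunct2, THEN conjunct2, THEN conjunct2, THEN conjunct2]
          smooth_field_coord_vec[OF that(2) U_open order_refl] smooth_field_coord_vec[OF that(3) U_open order_refl] by blast
    qed
  qed
  show ?thesis
  proof
    fix p assume p: "p \<in> topspace (mtop M)"
    then obtain U c where c: "(U, c) \<in> matlas M" "p \<in> U" using chart_cover by blast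
    interpret bilinear_chart M U c by unfold_locales (rule c(1))
    have pos: "mmetric M q u u > 0" if "q \<in> U" "u \<in> tangent_space M q" "u \<noteq> (\<lambda>f. 0)" for q u
      using R[THEN conjunct2, THEN conjunct2, THEN conjunct2, THEN conjunct1] that U_topspace by blast
    obtain E where "(\<forall>j\<in>K. smooth_field_on M U (E j)) \<and>
      (\<forall>q\<in>U. \<forall>j\<in>K. \<forall>k\<in>K. mmetric M q (E j q) (E k q) = (if j = k then 1 else 0)) \<and>
      (\<forall>q\<in>U. \<forall>j\<in>K. \<forall>l\<in>K - K. E j q (crd l) = 0)"
      by (rule exE[OF orthonormal_family_exists[OF pos order_refl]])
    then have "orthonormal_frame_on M U E" by (auto simp: orthonormal_frame_on_def)
    then show "\<exists>E V. openin (mtop M) V \<and> p \<in> V \<and> orthonormal_frame_on M V E" using U_open c(2) by blast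
  qed
qed

section \<open>The Kasner space-time as a manifold\<close>

locale kasner_spacetime =
  fixes I :: "real set" and \<phi> :: "real \<Rightarrow> real" and m :: nat and p :: "nat \<Rightarrow> real"
    and F :: "nat \<Rightarrow> ('a, 'k) manifold"
  assumes I_open: "open I"
    and \<phi>_smooth: "smooth_on_interval I \<phi>" and \<phi>_pos: "t \<in> I \<Longrightarrow> \<phi> t > 0"
    and F_riemannian: "i \<in> {1..m} \<Longrightarrow> riemannian_manifold (F i)"
begin

abbreviation "M \<equiv> kasner I \<phi> m p F"

lemma M_simps:
  "mtop M = prod_topology (top_of_set I) (product_topology (\<lambda>i. mtop (F i)) {1..m})"
  "midx M = kasner_idx m F"
  "matlas M = {product_chart I m F C | C. \<forall>i\<in>{1..m}. C i \<in> matlas (F i)}"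
  by (simp_all add: kasner_def)

lemma mmetric_M: "mmetric M (t, x) u v = - (u fst * v fst) +
         (\<Sum>i=1..m. \<phi> t powr (2 * p i) *
            mmetric (F i) (x i)
              (differential_at (F i) (\<lambda>q. snd q i) (t, x) u)
              (differential_at (F i) (\<lambda>q. snd q i) (t, x) v))"
  by (simp add: kasner_def)

lemma topspace_M: "topspace (mtop M) = I \<times> (\<Pi>\<^sub>E i\<in>{1..m}. topspace (mtop (F i)))"
  by (simp add: M_simps)

lemma F_metric: "i \<in> {1..m} \<Longrightarrow> metric_manifold (F i)"
  by (rule riemannian_metric_manifold[OF F_riemannian])

lemma F_atlas: "i \<in> {1..m} \<Longrightarrow> atlas_manifold (F i)"
  using F_metric by (simp add: metric_manifold_def bilinear_manifold_def)

lemma finite_F: "i \<in> {1..m} \<Longrightarrow> finite (midx (F i))"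
  using F_atlas atlas_manifold.finite_midx by blast

lemma finite_M: "finite (midx M)"
  unfolding M_simps kasner_idx_def
  by (intro finite.insertI finite_imageI finite_SigmaI finite_atLeastAtMost finite_F)

section \<open>Time and fibre blocks of the coordinates\<close>

lemma None_in_idx [simp]: "None \<in> midx M"
  by (simp add: M_simps kasner_idx_def)

lemma Some_in_idx [simp]: "Some (i, a) \<in> midx M \<longleftrightarrow> i \<in> {1..m} \<and> a \<in> midx (F i)"
  by (auto simp: M_simps kasner_idx_def)

lemma sum_idx: "(\<Sum>k\<in>midx M. h k) = h None + (\<Sum>i=1..m. \<Sum>a\<in>midx (F i). h (Some (i, a)))"
proof -
  have "finite (SIGMA i:{1..m}. midx (F i))" by (intro finite_SigmaI finite_atLeastAtMost finite_F)
  then have "(\<Sum>k\<in>midx M. h k) = h None + (\<Sum>k\<in>Some ` (SIGMA i:{1..m}. midx (F i)). h k)"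
    unfolding M_simps kasner_idx_def by (subst sum.insert) auto
  also have "(\<Sum>k\<in>Some ` (SIGMA i:{1..m}. midx (F i)). h k) = (\<Sum>ia\<in>(SIGMA i:{1..m}. midx (F i)). h (Some ia))"
    by (subst sum.reindex) auto
  also have "\<dots> = (\<Sum>i=1..m. \<Sum>a\<in>midx (F i). h (Some (i, a)))"
    using finite_F by (subst sum.Sigma) (simp_all add: case_prod_beta)
  finally show ?thesis .
qed

text \<open>The restriction makes the result a point of the model space of
  \<open>F i\<close>.\<close>

definition slice :: "nat \<Rightarrow> ((nat \<times> 'k) option \<Rightarrow> real) \<Rightarrow> 'k \<Rightarrow> real" where
  "slice i y = restrict (\<lambda>a. y (Some (i, a))) (midx (F i))"

lemma slice_continuous:
  assumes i: "i \<in> {1..m}"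
  shows "continuous_map (powertop_real (midx M)) (powertop_real (midx (F i))) (slice i)"
  unfolding continuous_map_componentwise
proof (intro conjI ballI)
  show "slice i ` topspace (powertop_real (midx M)) \<subseteq> extensional (midx (F i))"
    by (auto simp: slice_def)
  fix a assume a: "a \<in> midx (F i)"
  have "continuous_map (powertop_real (midx M)) euclideanreal (\<lambda>y. y (Some (i, a)))"
    by (rule continuous_map_product_projection) (use a i in simp)
  then show "continuous_map (powertop_real (midx M)) euclideanreal (\<lambda>y. slice i y a)"
    using a by (simp add: slice_def)
qed

lemma open_box:
  assumes A: "open A" and Q: "\<And>i. i \<in> {1..m} \<Longrightarrow> openin (powertop_real (midx (F i))) (Q i)"
  shows "openin (powertop_real (midx M)) {y \<in> topspace (powertop_real (midx M)). y None \<in> A \<and> (\<forall>i\<in>{1..m}. slice i y \<in> Q i)}"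
proof -
  let ?T = "powertop_real (midx M)"
  have 1: "openin ?T {y \<in> topspace ?T. y None \<in> A}"
    by (rule openin_continuous_map_preimage[OF continuous_map_product_projection]) (use A in auto)
  \<comment> \<open>Intersecting with the whole space covers the case of no factors, where the
    intersection over \<open>i\<close> alone is the universe.\<close>
  have 2: "openin ?T ((\<Inter>i\<in>{1..m}. {y \<in> topspace ?T. slice i y \<in> Q i}) \<inter> topspace ?T)"
    by (rule openin_INT) (use openin_continuous_map_preimage[OF slice_continuous Q] in auto)
  have "{y \<in> topspace ?T. y None \<in> A \<and> (\<forall>i\<in>{1..m}. slice i y \<in> Q i)} =
      {y \<in> topspace ?T. y None \<in> A} \<inter> ((\<Inter>i\<in>{1..m}. {y \<in> topspace ?T. slice i y \<in> Q i}) \<inter> topspace ?T)"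
    by blast
  with 1 2 show ?thesis by (simp only: openin_Int)
qed

lemma Ck_on_slice:
  assumes i: "i \<in> {1..m}" and W: "openin (powertop_real (midx M)) W"
    and Q: "openin (powertop_real (midx (F i))) Q" and WQ: "\<And>y. y \<in> W \<Longrightarrow> slice i y \<in> Q"
    and f: "Ck_on r (midx (F i)) Q f"
  shows "Ck_on r (midx M) W (\<lambda>y. f (slice i y))"
proof (rule Ck_on_compose_map[OF finite_F[OF i] Q W WQ _ f])
  fix a assume a: "a \<in> midx (F i)"
  have "Ck_on r (midx M) W (\<lambda>y. y (Some (i, a)))"
    by (rule Ck_on_proj[OF W]) (use a i in simp)
  then show "Ck_on r (midx M) W (\<lambda>y. slice i y a)" using a by (simp add: slice_def)
qed

end

text \<open>The product chart at the stage where the product is not yet known to be an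
  \<open>atlas_manifold\<close>; the facts shown here are what that instance is proved from.\<close>

locale kasner_pre_chart = kasner_spacetime I \<phi> m p F
  for I \<phi> m p and F :: "nat \<Rightarrow> ('a, 'k) manifold" +
  fixes C :: "nat \<Rightarrow> 'a set \<times> ('a \<Rightarrow> 'k \<Rightarrow> real)"
  assumes C: "i \<in> {1..m} \<Longrightarrow> C i \<in> matlas (F i)"
begin

abbreviation "UF i \<equiv> fst (C i)"
abbreviation "cF i \<equiv> snd (C i)"

definition U where "U = I \<times> (\<Pi>\<^sub>E i\<in>{1..m}. UF i)"
definition c where "c = (\<lambda>(t, x). restrict (case_option t (\<lambda>(i, a). cF i (x i) a)) (kasner_idx m F))"

lemma product_chart_eq: "product_chart I m F C = (U, c)"
  by (simp add: product_chart_def U_def c_def)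

lemma F_chart: "i \<in> {1..m} \<Longrightarrow> chart (F i) (UF i) (cF i)"
  using F_atlas C by (simp add: chart_def chart_axioms_def)

lemma c_None [simp]: "c q None = fst q"
  by (simp add: c_def kasner_idx_def case_prod_beta)

lemma c_Some: "i \<in> {1..m} \<Longrightarrow> a \<in> midx (F i) \<Longrightarrow> c q (Some (i, a)) = cF i (snd q i) a"
  by (auto simp: c_def kasner_idx_def case_prod_beta)

lemma c_extensional: "c q \<in> extensional (midx M)"
  by (simp add: c_def case_prod_beta M_simps)

lemma U_D: "q \<in> U \<Longrightarrow> fst q \<in> I" "q \<in> U \<Longrightarrow> i \<in> {1..m} \<Longrightarrow> snd q i \<in> UF i" "q \<in> U \<Longrightarrow> snd q \<in> extensional {1..m}"
  by (auto simp: U_def PiE_def)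

lemma cF_extensional: "i \<in> {1..m} \<Longrightarrow> z \<in> UF i \<Longrightarrow> cF i z \<in> extensional (midx (F i))"
proof -
  assume i: "i \<in> {1..m}" "z \<in> UF i"
  interpret X: chart "F i" "UF i" "cF i" by (rule F_chart[OF i(1)])
  have "openin (powertop_real (midx (F i))) (cF i ` UF i)"
    by (rule X.chart_image_open[OF X.chart X.U_open order_refl])
  then show ?thesis using openin_subset i(2) by (fastforce simp: PiE_def)
qed

text \<open>Chart values are extensional because chart images are open in the model space, and
  \<open>slice\<close> restricts to the same index set.\<close>

lemma slice_c: "q \<in> U \<Longrightarrow> i \<in> {1..m} \<Longrightarrow> slice i (c q) = cF i (snd q i)"
  using cF_extensional[OF _ U_D(2)] by (auto simp: slice_def c_Some extensional_def fun_eq_iff)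

lemma inj_c: "inj_on c U"
proof (rule inj_onI)
  fix q r assume qr: "q \<in> U" "r \<in> U" "c q = c r"
  have "snd q i = snd r i" for i
  proof (cases "i \<in> {1..m}")
    case True
    interpret X: chart "F i" "UF i" "cF i" by (rule F_chart[OF True])
    have "cF i (snd q i) = cF i (snd r i)" using slice_c[OF qr(1) True] slice_c[OF qr(2) True] qr(3) by simp
    then show ?thesis using X.inv_c U_D(2)[OF qr(1) True] U_D(2)[OF qr(2) True] by metis
  next
    case False
    then show ?thesis using U_D(3)[OF qr(1)] U_D(3)[OF qr(2)] by (simp add: extensional_def)
  qed
  moreover have "fst q = fst r" using qr(3) by (metis c_None)
  ultimately show "q = r" by (simp add: prod_eq_iff fun_eq_iff)
qed

lemma inv_c_fst: "y \<in> c ` U \<Longrightarrow> fst (inv_into U c y) = y None"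
  using inj_c by auto

lemma inv_c_snd: "y \<in> c ` U \<Longrightarrow> i \<in> {1..m} \<Longrightarrow> snd (inv_into U c y) i = inv_into (UF i) (cF i) (slice i y)"
proof -
  assume y: "y \<in> c ` U" and i: "i \<in> {1..m}"
  interpret X: chart "F i" "UF i" "cF i" by (rule F_chart[OF i])
  obtain q where q: "q \<in> U" "y = c q" using y by blast
  have "inv_into (UF i) (cF i) (slice i y) = snd q i"
    unfolding q(2) slice_c[OF q(1) i] by (rule X.inv_c[OF U_D(2)[OF q(1) i]])
  moreover have "inv_into U c y = q" using q inj_c by simp
  ultimately show ?thesis by simp
qed

lemma slice_in:
  assumes y: "y \<in> c ` V" and V: "V \<subseteq> U" and i: "i \<in> {1..m}" and B: "\<And>q. q \<in> V \<Longrightarrow> snd q i \<in> B"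
  shows "slice i y \<in> cF i ` (UF i \<inter> B)"
proof -
  obtain q where q: "q \<in> V" "y = c q" using y by blast
  then have qU: "q \<in> U" using V by blast
  have "snd q i \<in> UF i \<inter> B" using U_D(2)[OF qU i] B[OF q(1)] by simp
  then show ?thesis unfolding q(2) slice_c[OF qU i] by (rule imageI)
qed

lemma open_U: "openin (mtop M) U"
proof -
  have "openin (product_topology (\<lambda>i. mtop (F i)) {1..m}) (\<Pi>\<^sub>E i\<in>{1..m}. UF i)"
    using chart.U_open[OF F_chart] by (simp add: openin_PiE)
  then show ?thesis unfolding U_def M_simps openin_prod_Times_iff using openin_subset by auto
qed

text \<open>Openness is checked around each point by a box: time coordinate in an open set, and each
  fibre block in the open chart image of a neighbourhood in that fibre.\<close>

lemma image_open:
  assumes V: "openin (mtop M) V" "V \<subseteq> U"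
  shows "openin (powertop_real (midx M)) (c ` V)"
proof (subst openin_subopen, intro ballI)
  fix y assume "y \<in> c ` V"
  then obtain t x where q: "(t, x) \<in> V" "y = c (t, x)" by auto
  obtain A B where A: "openin (top_of_set I) A" "t \<in> A"
    and B: "openin (product_topology (\<lambda>i. mtop (F i)) {1..m}) B" "x \<in> B" "A \<times> B \<subseteq> V"
    using V(1) q(1) unfolding M_simps openin_prod_topology_alt by blast
  have Ao: "open A" using A(1) I_open by (simp add: openin_open_eq)
  obtain Bi where Bi: "\<And>i. i \<in> {1..m} \<Longrightarrow> openin (mtop (F i)) (Bi i)" "x \<in> Pi\<^sub>E {1..m} Bi" "Pi\<^sub>E {1..m} Bi \<subseteq> B"
    using bspec[OF openin_product_topology_alt[THEN iffD1, OF B(1)] B(2)] by metis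
  define Q where "Q i = cF i ` (UF i \<inter> Bi i)" for i
  have Q: "openin (powertop_real (midx (F i))) (Q i)" if "i \<in> {1..m}" for i
    unfolding Q_def
    by (rule atlas_manifold.chart_Int_image_open[OF F_atlas[OF that] _ Bi(1)[OF that]]) (use C[OF that] in simp)
  let ?W = "{y \<in> topspace (powertop_real (midx M)). y None \<in> A \<and> (\<forall>i\<in>{1..m}. slice i y \<in> Q i)}"
  show "\<exists>T. openin (powertop_real (midx M)) T \<and> y \<in> T \<and> T \<subseteq> c ` V"
  proof (intro exI conjI)
    show "openin (powertop_real (midx M)) ?W" by (rule open_box[OF Ao Q])
    have qU: "(t, x) \<in> U" using q V by blast
    have "slice i y \<in> Q i" if "i \<in> {1..m}" for i
      unfolding q(2) slice_c[OF qU that] Q_def using Bi(2) that U_D(2)[OF qU that] by (auto simp: PiE_def)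
    then show "y \<in> ?W" using A(2) q(2) c_extensional by (auto simp: PiE_def)
    show "?W \<subseteq> c ` V"
    proof
      fix z assume z: "z \<in> ?W"
      \<comment> \<open>The preimage of \<open>z\<close>, assembled block by block from the inverse
        fibre charts.\<close>
      define x' where "x' = (\<lambda>i\<in>{1..m}. inv_into (UF i) (cF i) (slice i z))"
      have x': "x' i \<in> UF i \<inter> Bi i" "cF i (x' i) = slice i z" if i: "i \<in> {1..m}" for i
      proof -
        interpret X: chart "F i" "UF i" "cF i" by (rule F_chart[OF i])
        have "slice i z \<in> cF i ` (UF i \<inter> Bi i)" using z i by (simp add: Q_def)
        then obtain w where "w \<in> UF i" "w \<in> Bi i" "slice i z = cF i w" by auto
        then show "x' i \<in> UF i \<inter> Bi i" "cF i (x' i) = slice i z" using i by (simp_all add: x'_def)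
      qed
      have "x' \<in> Pi\<^sub>E {1..m} Bi" using x' by (auto simp: x'_def)
      then have "(z None, x') \<in> V" using B(3) Bi(3) z by blast
      moreover have "c (z None, x') = z"
      proof
        fix k show "c (z None, x') k = z k"
        proof (cases "k \<in> midx M")
          case True
          show ?thesis
          proof (cases k)
            case (Some ia)
            obtain i a where ia: "ia = (i, a)" by (cases ia)
            have i: "i \<in> {1..m}" "a \<in> midx (F i)" using True Some ia by auto
            show ?thesis unfolding Some ia c_Some[OF i] using x'(2)[OF i(1)] i(2) by (simp add: slice_def)
          qed simp
        next
          case False
          then show ?thesis using c_extensional[of "(z None, x')"] z by (auto simp: extensional_def PiE_def)
        qed
      qed
      ultimately show "z \<in> c ` V" by (metis imageI)
    qed
  qed
qed

end

context kasner_spacetime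
begin

lemma atlas_cases:
  assumes "(U, c) \<in> matlas M"
  obtains C where "kasner_pre_chart I \<phi> m F C" "U = kasner_pre_chart.U I m C" "c = kasner_pre_chart.c m F C"
proof -
  obtain C where C0: "(U, c) = product_chart I m F C" "\<forall>i\<in>{1..m}. C i \<in> matlas (F i)"
    using assms by (auto simp: M_simps)
  interpret kasner_pre_chart I \<phi> m p F C by unfold_locales (use C0 in auto)
  show thesis by (rule that[OF kasner_pre_chart_axioms]) (use trans[OF C0(1) product_chart_eq] in simp_all)
qed

text \<open>Transition functions split along the index: the time coordinate is a projection, and a
  fibre coordinate is a transition function of that fibre composed with
  \<open>slice\<close>.\<close>

sublocale M: atlas_manifold M
proof
  show "finite (midx M)" by (rule finite_M)
  show "\<exists>U c. (U, c) \<in> matlas M \<and> q \<in> U" if q: "q \<in> topspace (mtop M)" for q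
  proof -
    have "\<exists>Uc. Uc \<in> matlas (F i) \<and> snd q i \<in> fst Uc" if i: "i \<in> {1..m}" for i
    proof -
      have "snd q i \<in> topspace (mtop (F i))" using q i unfolding topspace_M by auto
      from atlas_manifold.chart_cover[OF F_atlas[OF i] this] show ?thesis by auto
    qed
    then obtain C where C0: "\<And>i. i \<in> {1..m} \<Longrightarrow> C i \<in> matlas (F i) \<and> snd q i \<in> fst (C i)" by metis
    interpret kasner_pre_chart I \<phi> m p F C by unfold_locales (use C0 in auto)
    have "q \<in> U" using C0 q unfolding U_def topspace_M by (cases q) (auto simp: PiE_def)
    moreover have "product_chart I m F C \<in> matlas M" using C by (auto simp: M_simps)
    ultimately show ?thesis using product_chart_eq by metis
  qed
  fix U c assume "(U, c) \<in> matlas M"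
  then obtain C where C: "kasner_pre_chart I \<phi> m F C"
    and Uc: "U = kasner_pre_chart.U I m C" "c = kasner_pre_chart.c m F C" by (rule atlas_cases)
  interpret X: kasner_pre_chart I \<phi> m p F C by (rule C)
  show "openin (mtop M) U" unfolding Uc by (rule X.open_U)
  show "inj_on c U" unfolding Uc by (rule X.inj_c)
  show "openin (powertop_real (midx M)) (c ` V)" if "openin (mtop M) V" "V \<subseteq> U" for V
    using X.image_open[of V] that unfolding Uc by blast
  fix U' c' k r assume "(U', c') \<in> matlas M" and k: "k \<in> midx M"
  then obtain C' where C': "kasner_pre_chart I \<phi> m F C'"
    and Uc': "U' = kasner_pre_chart.U I m C'" "c' = kasner_pre_chart.c m F C'" by (rule_tac atlas_cases)
  interpret X': kasner_pre_chart I \<phi> m p F C' by (rule C')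
  have o: "openin (powertop_real (midx M)) (X.c ` (X.U \<inter> X'.U))"
    by (rule X.image_open) (use X.open_U X'.open_U in auto)
  have sub: "X.c ` (X.U \<inter> X'.U) \<subseteq> X.c ` X.U" by blast
  show "Ck_on r (midx M) (c ` (U \<inter> U')) (\<lambda>x. c' (inv_into U c x) k)"
  proof (cases k)
    case None
    show ?thesis unfolding Uc Uc' None
      by (rule Ck_on_cong[OF o _ Ck_on_proj[OF o None_in_idx]]) (use sub in \<open>auto simp: X.inv_c_fst subset_iff\<close>)
  next
    case (Some ia)
    obtain i a where ia: "ia = (i, a)" by (cases ia)
    have i: "i \<in> {1..m}" "a \<in> midx (F i)" using k Some ia by auto
    interpret Y: atlas_manifold "F i" by (rule F_atlas[OF i(1)])
    have Q: "openin (powertop_real (midx (F i))) (X.cF i ` (X.UF i \<inter> X'.UF i))"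
      by (rule Y.chart_Int_image_open) (use X.C[OF i(1)] chart.U_open[OF X'.F_chart[OF i(1)]] in auto)
    have "Ck_on r (midx (F i)) (X.cF i ` (X.UF i \<inter> X'.UF i)) (\<lambda>z. X'.cF i (inv_into (X.UF i) (X.cF i) z) a)"
      by (rule Y.chart_transition) (use X.C[OF i(1)] X'.C[OF i(1)] i in auto)
    from Ck_on_slice[OF i(1) o Q _ this]
    have "Ck_on r (midx M) (X.c ` (X.U \<inter> X'.U)) (\<lambda>y. X'.cF i (inv_into (X.UF i) (X.cF i) (slice i y)) a)"
      using X.slice_in[of _ "X.U \<inter> X'.U" i "X'.UF i"] X'.U_D(2) i(1) by blast
    then show ?thesis unfolding Uc Uc' Some ia
    proof (rule Ck_on_cong[OF o, rotated])
      fix y assume "y \<in> X.c ` (X.U \<inter> X'.U)"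
      then have "y \<in> X.c ` X.U" using sub by blast
      from X.inv_c_snd[OF this i(1)]
      show "X'.cF i (inv_into (X.UF i) (X.cF i) (slice i y)) a = X'.c (inv_into X.U X.c y) (Some (i, a))"
        by (simp add: X'.c_Some[OF i])
    qed
  qed
qed

section \<open>Smooth functions pulled back from the factors\<close>

lemma smooth_pullback:
  assumes i: "i \<in> {1..m}" and f: "smooth_fun_on (F i) B f"
    and V: "openin (mtop M) V" and VB: "\<And>q. q \<in> V \<Longrightarrow> snd q i \<in> B"
  shows "smooth_fun_on M V (\<lambda>q. f (snd q i))"
proof (rule M.smooth_fun_onI[OF V])
  fix U c r assume Uc0: "(U, c) \<in> matlas M"
  then obtain C where C: "kasner_pre_chart I \<phi> m F C"
    and Uc: "U = kasner_pre_chart.U I m C" "c = kasner_pre_chart.c m F C" by (rule atlas_cases)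
  interpret X: kasner_pre_chart I \<phi> m p F C by (rule C)
  interpret Y: atlas_manifold "F i" by (rule F_atlas[OF i])
  have o: "openin (powertop_real (midx M)) (X.c ` (X.U \<inter> V))"
    by (rule M.chart_Int_image_open[OF Uc0[unfolded Uc] V])
  have Q: "openin (powertop_real (midx (F i))) (X.cF i ` (X.UF i \<inter> B))"
    by (rule Y.chart_Int_image_open) (use X.C[OF i] Y.smooth_fun_on_openD[OF f] in auto)
  have "Ck_on r (midx (F i)) (X.cF i ` (X.UF i \<inter> B)) (\<lambda>z. f (inv_into (X.UF i) (X.cF i) z))"
    by (rule Y.smooth_fun_on_Ck[OF f]) (use X.C[OF i] in simp)
  from Ck_on_slice[OF i o Q _ this]
  have "Ck_on r (midx M) (X.c ` (X.U \<inter> V)) (\<lambda>y. f (inv_into (X.UF i) (X.cF i) (slice i y)))"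
    using X.slice_in[of _ "X.U \<inter> V" i B] VB i by blast
  then show "Ck_on r (midx M) (c ` (U \<inter> V)) (\<lambda>y. f (snd (inv_into U c y) i))" unfolding Uc
  proof (rule Ck_on_cong[OF o, rotated])
    fix y assume "y \<in> X.c ` (X.U \<inter> V)"
    then have "y \<in> X.c ` X.U" by blast
    then show "f (inv_into (X.UF i) (X.cF i) (slice i y)) = f (snd (inv_into X.U X.c y) i)"
      by (simp add: X.inv_c_snd[OF _ i])
  qed
qed

lemma smooth_time:
  assumes h: "smooth_on_interval I h" and V: "openin (mtop M) V"
  shows "smooth_fun_on M V (\<lambda>q. h (fst q))"
proof (rule M.smooth_fun_onI[OF V])
  fix U c r assume Uc0: "(U, c) \<in> matlas M"
  then obtain C where C: "kasner_pre_chart I \<phi> m F C"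
    and Uc: "U = kasner_pre_chart.U I m C" "c = kasner_pre_chart.c m F C" by (rule atlas_cases)
  interpret X: kasner_pre_chart I \<phi> m p F C by (rule C)
  have o: "openin (powertop_real (midx M)) (X.c ` (X.U \<inter> V))"
    by (rule M.chart_Int_image_open[OF Uc0[unfolded Uc] V])
  have "Ck_on r (midx M) (X.c ` (X.U \<inter> V)) (\<lambda>y. h (y None))"
    by (rule Ck_on_fun_of_coord[OF o None_in_idx _ h]) (auto dest: X.U_D(1))
  then show "Ck_on r (midx M) (c ` (U \<inter> V)) (\<lambda>y. h (fst (inv_into U c y)))" unfolding Uc
    by (rule Ck_on_cong[OF o, rotated]) (auto simp: X.inv_c_fst)
qed

lemma open_pullback:
  assumes i: "i \<in> {1..m}" and B: "openin (mtop (F i)) B"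
  shows "openin (mtop M) {q \<in> topspace (mtop M). snd q i \<in> B}"
proof -
  have "continuous_map (mtop M) (mtop (F i)) (\<lambda>q. snd q i)"
  proof -
    have "continuous_map (mtop M) (product_topology (\<lambda>i. mtop (F i)) {1..m}) snd"
      unfolding M_simps by (rule continuous_map_snd)
    from continuous_map_compose[OF this continuous_map_product_projection[OF i]]
    show ?thesis by (simp add: o_def)
  qed
  from openin_continuous_map_preimage[OF this B] show ?thesis .
qed

lemma smooth_near_pullback:
  assumes i: "i \<in> {1..m}" and q: "q \<in> topspace (mtop M)" and f: "smooth_near (F i) (snd q i) f"
  shows "smooth_near M q (\<lambda>q. f (snd q i))"
proof -
  obtain B where B: "snd q i \<in> B" "smooth_fun_on (F i) B f" using f by (auto simp: smooth_near_def)
  have "smooth_fun_on M {q \<in> topspace (mtop M). snd q i \<in> B} (\<lambda>q. f (snd q i))"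
    by (rule smooth_pullback[OF i B(2) open_pullback[OF i]])
       (use atlas_manifold.smooth_fun_on_openD[OF F_atlas[OF i] B(2)] in auto)
  then show ?thesis by (rule M.smooth_nearI) (use B q in simp)
qed

end

text \<open>Adds no assumption to \<open>kasner_pre_chart\<close>; with
  \<open>atlas_manifold\<close> now available for the product, its charts can inherit the calculus
  of the locale \<open>chart\<close>.\<close>

locale kasner_chart = kasner_pre_chart I \<phi> m p F C
  for I \<phi> m p and F :: "nat \<Rightarrow> ('a, 'k) manifold" and C
begin

lemma Uc_atlas: "(U, c) \<in> matlas M"
  unfolding M_simps product_chart_eq[symmetric] using C by blast

sublocale chart M U c
  by unfold_locales (rule Uc_atlas)

abbreviation "pdF i a \<equiv> coord_vec (F i) (C i) a"

lemma F_metric_chart: "i \<in> {1..m} \<Longrightarrow> metric_chart (F i) (UF i) (cF i)"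
  using F_metric F_chart by (auto simp: metric_chart_def bilinear_chart_def metric_manifold_def)

text \<open>Moving a coordinate of block \<open>i\<close> moves exactly one coordinate in the chart
  of \<open>F i\<close>; moving any other leaves the fibre point fixed.\<close>

lemma pd_pullback:
  assumes q: "q \<in> U" and i: "i \<in> {1..m}" and f: "smooth_near (F i) (snd q i) f" and k: "k \<in> midx M"
  shows "pd k q (\<lambda>r. f (snd r i)) = (case k of None \<Rightarrow> 0 | Some (j, a) \<Rightarrow> if j = i then pdF i a (snd q i) f else 0)"
proof (rule coord_vec_eqI[OF q smooth_near_pullback[OF i U_topspace[OF q] f] k])
  interpret X: chart "F i" "UF i" "cF i" by (rule F_chart[OF i])
  note z = U_D(2)[OF q i]
  have ev: "\<forall>\<^sub>F s in nhds (c q k). f (inv_into (UF i) (cF i) (slice i ((c q)(k := s)))) = f (snd (inv_into U c ((c q)(k := s))) i)"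
  proof (rule eventually_mono[OF slice_inv_in[OF U_open q q k]])
    fix s assume "inv_into U c ((c q)(k := s)) \<in> U \<inter> U \<and> (c q)(k := s) \<in> c ` (U \<inter> U)"
    then have "(c q)(k := s) \<in> c ` U" unfolding Int_absorb by (rule conjunct2)
    from inv_c_snd[OF this i] show "f (inv_into (UF i) (cF i) (slice i ((c q)(k := s)))) = f (snd (inv_into U c ((c q)(k := s))) i)"
      by simp
  qed
  show "((\<lambda>s. f (snd (inv_into U c ((c q)(k := s))) i)) has_real_derivative
      (case k of None \<Rightarrow> 0 | Some (j, a) \<Rightarrow> if j = i then pdF i a (snd q i) f else 0)) (at (c q k))"
    unfolding DERIV_cong_ev[OF refl ev refl, symmetric]
  proof (cases "\<exists>a. k = Some (i, a)")
    case True
    then obtain a where a: "k = Some (i, a)" by blast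
    have aF: "a \<in> midx (F i)" using k a by simp
    have "slice i ((c q)(k := s)) = (cF i (snd q i))(a := s)" for s
    proof -
      have "slice i ((c q)(k := s)) = (slice i (c q))(a := s)"
        using aF by (auto simp: slice_def a fun_eq_iff)
      then show ?thesis by (simp add: slice_c[OF q i])
    qed
    moreover have "c q k = cF i (snd q i) a" unfolding a by (rule c_Some[OF i aF])
    ultimately show "((\<lambda>s. f (inv_into (UF i) (cF i) (slice i ((c q)(k := s))))) has_real_derivative
      (case k of None \<Rightarrow> 0 | Some (j, a) \<Rightarrow> if j = i then pdF i a (snd q i) f else 0)) (at (c q k))"
      using X.coord_vec_deriv[OF z f aF] a by simp
  next
    case False
    then have "slice i ((c q)(k := s)) = slice i (c q)" for s
      by (auto simp: slice_def fun_eq_iff)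
    moreover have "(case k of None \<Rightarrow> 0 | Some (j, a) \<Rightarrow> if j = i then pdF i a (snd q i) f else 0) = 0"
      using False by (auto split: option.split)
    ultimately show "((\<lambda>s. f (inv_into (UF i) (cF i) (slice i ((c q)(k := s))))) has_real_derivative
      (case k of None \<Rightarrow> 0 | Some (j, a) \<Rightarrow> if j = i then pdF i a (snd q i) f else 0)) (at (c q k))"
      by simp
  qed
qed

lemma pd_time:
  assumes q: "q \<in> U" and s: "smooth_near M q (\<lambda>r. h (fst r))" and h: "(h has_real_derivative h') (at (fst q))" and k: "k \<in> midx M"
  shows "pd k q (\<lambda>r. h (fst r)) = (if k = None then h' else 0)"
proof (rule coord_vec_eqI[OF q s k])
  have ev: "\<forall>\<^sub>F s in nhds (c q k). h (if k = None then s else fst q) = h (fst (inv_into U c ((c q)(k := s))))"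
  proof (rule eventually_mono[OF slice_inv_in[OF U_open q q k]])
    fix s assume "inv_into U c ((c q)(k := s)) \<in> U \<inter> U \<and> (c q)(k := s) \<in> c ` (U \<inter> U)"
    then have "(c q)(k := s) \<in> c ` U" unfolding Int_absorb by (rule conjunct2)
    from inv_c_fst[OF this] show "h (if k = None then s else fst q) = h (fst (inv_into U c ((c q)(k := s))))"
      by simp
  qed
  show "((\<lambda>s. h (fst (inv_into U c ((c q)(k := s))))) has_real_derivative (if k = None then h' else 0)) (at (c q k))"
    unfolding DERIV_cong_ev[OF refl ev refl, symmetric] using h by (cases k) auto
qed

section \<open>Projections to the fibres and the product metric\<close>

definition dF :: "nat \<Rightarrow> real \<times> (nat \<Rightarrow> 'a) \<Rightarrow> (real \<times> (nat \<Rightarrow> 'a)) tvec \<Rightarrow> 'a tvec" where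
  "dF i q = differential_at (F i) (\<lambda>r. snd r i) q"

text \<open>The differential of the projection keeps the components of block \<open>i\<close> and
  drops the rest, because a function pulled back from \<open>F i\<close> has no derivative in the
  other directions.\<close>

lemma dF_expand:
  assumes q: "q \<in> U" and i: "i \<in> {1..m}" and u: "u \<in> tangent_space M q"
  shows "dF i q u = (\<lambda>f. \<Sum>a\<in>midx (F i). u (\<lambda>r. c r (Some (i, a))) * pdF i a (snd q i) f)"
proof
  fix f
  interpret X: chart "F i" "UF i" "cF i" by (rule F_chart[OF i])
  show "dF i q u f = (\<Sum>a\<in>midx (F i). u (\<lambda>r. c r (Some (i, a))) * pdF i a (snd q i) f)"
  proof (cases "smooth_near (F i) (snd q i) f")
    case True
    have "dF i q u f = u (\<lambda>r. f (snd r i))" using True by (simp add: dF_def differential_at_def)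
    also have "\<dots> = (\<Sum>k\<in>midx M. u (\<lambda>r. c r k) * pd k q (\<lambda>r. f (snd r i)))"
      by (rule fun_cong[OF tangent_expand[OF u q]])
    also have "\<dots> = (\<Sum>k\<in>midx M. u (\<lambda>r. c r k) * (case k of None \<Rightarrow> 0 | Some (j, a) \<Rightarrow> if j = i then pdF i a (snd q i) f else 0))"
      by (intro sum.cong refl) (simp add: pd_pullback[OF q i True])
    also have "\<dots> = (\<Sum>j=1..m. if j = i then (\<Sum>a\<in>midx (F i). u (\<lambda>r. c r (Some (i, a))) * pdF i a (snd q i) f) else 0)"
      unfolding sum_idx option.case prod.case mult_zero_right add_0_left by (intro sum.cong refl) auto
    finally show ?thesis using i by simp
  next
    case False
    then show ?thesis using X.coord_vec_not_smooth[of "snd q i" f] by (simp add: dF_def differential_at_def)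
  qed
qed

lemma dF_tangent:
  assumes q: "q \<in> U" and i: "i \<in> {1..m}" and u: "u \<in> tangent_space M q"
  shows "dF i q u \<in> tangent_space (F i) (snd q i)"
proof -
  interpret X: chart "F i" "UF i" "cF i" by (rule F_chart[OF i])
  show ?thesis unfolding dF_expand[OF assms]
    using X.tangent_combination[OF U_D(2)[OF q i], of "\<lambda>a. u (\<lambda>r. c r (Some (i, a)))"] by simp
qed

lemma dF_linear: "dF i q (\<lambda>f. a * u f + b * v f) = (\<lambda>f. a * dF i q u f + b * dF i q v f)"
  by (auto simp: dF_def differential_at_def)

lemma dF_pd:
  assumes q: "q \<in> U" and i: "i \<in> {1..m}" and k: "k \<in> midx M"
  shows "dF i q (pd k q) = (case k of None \<Rightarrow> (\<lambda>f. 0) | Some (j, a) \<Rightarrow> if j = i then pdF i a (snd q i) else (\<lambda>f. 0))"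
proof
  fix f
  interpret X: chart "F i" "UF i" "cF i" by (rule F_chart[OF i])
  show "dF i q (pd k q) f = (case k of None \<Rightarrow> (\<lambda>f. 0) | Some (j, a) \<Rightarrow> if j = i then pdF i a (snd q i) else (\<lambda>f. 0)) f"
    using pd_pullback[OF q i _ k, of f] X.coord_vec_not_smooth[of "snd q i" f]
    by (cases "smooth_near (F i) (snd q i) f") (auto simp: dF_def differential_at_def split: option.splits if_splits)
qed

lemma mmetric_dF: "mmetric M q u v = - (u fst * v fst) +
    (\<Sum>i=1..m. \<phi> (fst q) powr (2 * p i) * mmetric (F i) (snd q i) (dF i q u) (dF i q v))"
  by (cases q) (simp add: mmetric_M dF_def)

lemma M_metric_linear:
  assumes q: "q \<in> U" and u: "u \<in> tangent_space M q" and v: "v \<in> tangent_space M q" and w: "w \<in> tangent_space M q"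
  shows "mmetric M q (\<lambda>f. a * u f + b * v f) w = a * mmetric M q u w + b * mmetric M q v w"
proof -
  have "mmetric (F i) (snd q i) (dF i q (\<lambda>f. a * u f + b * v f)) (dF i q w) =
      a * mmetric (F i) (snd q i) (dF i q u) (dF i q w) + b * mmetric (F i) (snd q i) (dF i q v) (dF i q w)"
    if i: "i \<in> {1..m}" for i
  proof -
    interpret X: metric_chart "F i" "UF i" "cF i" by (rule F_metric_chart[OF i])
    show ?thesis unfolding dF_linear
      by (intro X.metric_linear X.U_topspace U_D(2) dF_tangent q i u v w)
  qed
  then show ?thesis unfolding mmetric_dF
    by (simp add: algebra_simps sum.distrib sum_distrib_left)
qed

lemma M_metric_sym:
  assumes q: "q \<in> U" and u: "u \<in> tangent_space M q" and v: "v \<in> tangent_space M q"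
  shows "mmetric M q u v = mmetric M q v u"
proof -
  have "mmetric (F i) (snd q i) (dF i q u) (dF i q v) = mmetric (F i) (snd q i) (dF i q v) (dF i q u)"
    if i: "i \<in> {1..m}" for i
  proof -
    interpret X: metric_chart "F i" "UF i" "cF i" by (rule F_metric_chart[OF i])
    show ?thesis by (intro X.metric_sym X.U_topspace U_D(2) dF_tangent q i u v)
  qed
  then show ?thesis unfolding mmetric_dF by (simp add: mult.commute)
qed

lemma pd_fst: "q \<in> U \<Longrightarrow> k \<in> midx M \<Longrightarrow> pd k q fst = (if k = None then 1 else 0)"
  using coord_vec_crd[of q k None] by simp

definition gF :: "nat \<Rightarrow> 'k \<Rightarrow> 'k \<Rightarrow> 'a \<Rightarrow> real" where
  "gF i a b z = mmetric (F i) z (pdF i a z) (pdF i b z)"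

text \<open>Supplies the zeros of the off-diagonal blocks, where one of the two differentials is the
  zero vector.\<close>

lemma metric_zero:
  assumes i: "i \<in> {1..m}" and z: "z \<in> UF i" and w: "w \<in> tangent_space (F i) z"
  shows "mmetric (F i) z (\<lambda>f. 0) w = 0" "mmetric (F i) z w (\<lambda>f. 0) = 0"
proof -
  interpret X: metric_chart "F i" "UF i" "cF i" by (rule F_metric_chart[OF i])
  show 1: "mmetric (F i) z (\<lambda>f. 0) w = 0"
    using X.metric_linear[OF X.U_topspace[OF z] w w w, of 0 0] by simp
  have "(\<lambda>f. 0) \<in> tangent_space (F i) z" using X.tangent_linear[OF w w z, of 0 0] by simp
  from X.metric_sym[OF X.U_topspace[OF z] w this] 1 show "mmetric (F i) z w (\<lambda>f. 0) = 0" by simp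
qed

lemma gm_M:
  assumes q: "q \<in> U"
  shows "mmetric M q (pd None q) (pd None q) = -1"
    and "i \<in> {1..m} \<Longrightarrow> a \<in> midx (F i) \<Longrightarrow> mmetric M q (pd None q) (pd (Some (i, a)) q) = 0"
    and "i \<in> {1..m} \<Longrightarrow> a \<in> midx (F i) \<Longrightarrow> mmetric M q (pd (Some (i, a)) q) (pd None q) = 0"
    and "i \<in> {1..m} \<Longrightarrow> a \<in> midx (F i) \<Longrightarrow> j \<in> {1..m} \<Longrightarrow> b \<in> midx (F j) \<Longrightarrow>
      mmetric M q (pd (Some (i, a)) q) (pd (Some (j, b)) q) =
        (if i = j then \<phi> (fst q) powr (2 * p i) * gF i a b (snd q i) else 0)"
proof -
  have T: "pd k q \<in> tangent_space M q" if "k \<in> midx M" for k by (rule coord_vec_tangent[OF q that])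
  note z = metric_zero[OF _ U_D(2)[OF q]]
  have N: "mmetric (F j) (snd q j) (dF j q (pd None q)) (dF j q u) = 0"
    "mmetric (F j) (snd q j) (dF j q u) (dF j q (pd None q)) = 0" if "u \<in> tangent_space M q" "j \<in> {1..m}" for j u
    using dF_pd[OF q that(2), of None] z[OF that(2) that(2) dF_tangent[OF q that(2,1)]] by auto
  show "mmetric M q (pd None q) (pd None q) = -1"
    unfolding mmetric_dF using N T[of None] by (simp add: pd_fst[OF q])
  show "mmetric M q (pd None q) (pd (Some (i, a)) q) = 0" "mmetric M q (pd (Some (i, a)) q) (pd None q) = 0"
    if "i \<in> {1..m}" "a \<in> midx (F i)"
    unfolding mmetric_dF using N T[of "Some (i, a)"] that by (simp_all add: pd_fst[OF q])
  show "mmetric M q (pd (Some (i, a)) q) (pd (Some (j, b)) q) =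
        (if i = j then \<phi> (fst q) powr (2 * p i) * gF i a b (snd q i) else 0)"
    if i: "i \<in> {1..m}" "a \<in> midx (F i)" and j: "j \<in> {1..m}" "b \<in> midx (F j)"
  proof -
    have 1: "mmetric (F n) (snd q n) (dF n q (pd (Some (i, a)) q)) (dF n q (pd (Some (j, b)) q)) =
        (if n = i then if i = j then gF i a b (snd q i) else 0 else 0)" if n: "n \<in> {1..m}" for n
    proof -
      have "dF n q (pd (Some (i, a)) q) = (if i = n then pdF n a (snd q n) else (\<lambda>f. 0))"
        "dF n q (pd (Some (j, b)) q) = (if j = n then pdF n b (snd q n) else (\<lambda>f. 0))"
        using dF_pd[OF q n, of "Some (i, a)"] dF_pd[OF q n, of "Some (j, b)"] i j by simp_all
      moreover have "dF n q (pd (Some (i, a)) q) \<in> tangent_space (F n) (snd q n)"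
        "dF n q (pd (Some (j, b)) q) \<in> tangent_space (F n) (snd q n)"
        using dF_tangent[OF q n T] i j by simp_all
      ultimately show ?thesis using z[OF n n] by (auto simp: gF_def)
    qed
    have "mmetric M q (pd (Some (i, a)) q) (pd (Some (j, b)) q) =
       (\<Sum>n=1..m. \<phi> (fst q) powr (2 * p n) * (if n = i then if i = j then gF i a b (snd q i) else 0 else 0))"
      unfolding mmetric_dF using i j by (simp add: pd_fst[OF q] 1)
    also have "\<dots> = (\<Sum>n=1..m. if n = i then \<phi> (fst q) powr (2 * p i) * (if i = j then gF i a b (snd q i) else 0) else 0)"
      by (intro sum.cong refl) simp
    finally show ?thesis using i by simp
  qed
qed

lemma gF_smooth:
  assumes i: "i \<in> {1..m}" and ab: "a \<in> midx (F i)" "b \<in> midx (F i)"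
  shows "smooth_fun_on (F i) (UF i) (gF i a b)"
proof -
  interpret X: metric_chart "F i" "UF i" "cF i" by (rule F_metric_chart[OF i])
  show ?thesis using X.gm_smooth[OF ab] by (simp add: gF_def[abs_def])
qed

lemma \<phi>_smooth_M: "smooth_fun_on M U (\<lambda>q. \<phi> (fst q) powr e)"
  by (rule M.smooth_fun_on_powr[OF smooth_time[OF \<phi>_smooth U_open]]) (rule \<phi>_pos[OF U_D(1)])

lemma M_metric_coord_smooth:
  assumes "j \<in> midx M" "k \<in> midx M"
  shows "smooth_fun_on M U (\<lambda>q. mmetric M q (pd j q) (pd k q))"
proof -
  have const: "smooth_fun_on M U (\<lambda>q. mmetric M q (pd j q) (pd k q))"
    if "\<And>q. q \<in> U \<Longrightarrow> mmetric M q (pd j q) (pd k q) = e" for e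
    by (rule M.smooth_fun_on_cong[OF M.smooth_fun_on_const[OF U_open]]) (simp add: that)
  show ?thesis
  proof (cases j)
    case None
    show ?thesis
    proof (cases k)
      case N2: None
      show ?thesis by (rule const[of "-1"]) (simp add: None N2 gm_M)
    next
      case (Some ia)
      then show ?thesis using assms by (intro const[of 0]) (cases ia, simp add: None gm_M)
    qed
  next
    case (Some ia)
    obtain i a where ia: "ia = (i, a)" by (cases ia)
    have i: "i \<in> {1..m}" "a \<in> midx (F i)" using assms Some ia by auto
    show ?thesis
    proof (cases k)
      case None
      show ?thesis using i by (intro const[of 0]) (simp add: None Some ia gm_M)
    next
      case S2: (Some jb)
      obtain j' b where jb: "jb = (j', b)" by (cases jb)
      have j: "j' \<in> {1..m}" "b \<in> midx (F j')" using assms S2 jb by auto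
      show ?thesis
      proof (cases "i = j'")
        case True
        have "smooth_fun_on M U (\<lambda>q. \<phi> (fst q) powr (2 * p i) * gF i a b (snd q i))"
          by (intro M.smooth_fun_on_mult \<phi>_smooth_M smooth_pullback[OF i(1) gF_smooth U_open] U_D i) (use True j in auto)
        then show ?thesis
          by (rule M.smooth_fun_on_cong) (use i j in \<open>simp add: Some S2 ia jb True gm_M\<close>)
      next
        case False
        then show ?thesis using i j by (intro const[of 0]) (simp add: S2 Some ia jb gm_M)
      qed
    qed
  qed
qed

end

section \<open>The Levi-Civita and the quarter-symmetric connection of a Kasner space-time\<close>

context bilinear_chart
begin

lemma metric_scale:
  assumes p: "p \<in> U" and u: "u \<in> tangent_space M p" and v: "v \<in> tangent_space M p"
  shows "mmetric M p (\<lambda>f. a * u f) (\<lambda>f. b * v f) = a * b * mmetric M p u v"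
proof -
  have 1: "mmetric M p (\<lambda>f. s * w f) w' = s * mmetric M p w w'"
    if "w \<in> tangent_space M p" "w' \<in> tangent_space M p" for s w w'
    using metric_linear[OF U_topspace[OF p] that(1,1,2), of s 0] by simp
  have t: "(\<lambda>f. b * v f) \<in> tangent_space M p" using tangent_linear[OF v v p, of b 0] by simp
  show ?thesis
    using 1[OF u t, of a] metric_sym[OF U_topspace[OF p] u t] 1[OF v u, of b] metric_sym[OF U_topspace[OF p] u v] by simp
qed

end

section \<open>Orthonormal frames of the space-time\<close>

context kasner_chart
begin

text \<open>With an indefinite metric Gram-Schmidt may meet null vectors, so the frame is written
  down instead: the time coordinate field together with the fibre frames, rescaled by
  \<open>\<phi> powr (- p i)\<close> to undo the warping.\<close>

lemma M_frame_exists: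
  assumes q0: "q0 \<in> U"
  shows "\<exists>E V. openin (mtop M) V \<and> q0 \<in> V \<and> orthonormal_frame_on M V E"
proof -
  have "\<exists>E V. openin (mtop (F i)) V \<and> snd q0 i \<in> V \<and> orthonormal_frame_on (F i) V E" if i: "i \<in> {1..m}" for i
  proof -
    interpret X: metric_chart "F i" "UF i" "cF i" by (rule F_metric_chart[OF i])
    show ?thesis by (rule X.orthonormal_frame_exists[OF X.U_topspace[OF U_D(2)[OF q0 i]]])
  qed
  then obtain e B where e: "\<And>i. i \<in> {1..m} \<Longrightarrow> orthonormal_frame_on (F i) (B i) (e i)"
    and B: "\<And>i. i \<in> {1..m} \<Longrightarrow> openin (mtop (F i)) (B i)" "\<And>i. i \<in> {1..m} \<Longrightarrow> snd q0 i \<in> B i"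
    by metis
  define V where "V = I \<times> (\<Pi>\<^sub>E i\<in>{1..m}. UF i \<inter> B i)"
  have VU: "V \<subseteq> U" by (auto simp: V_def U_def PiE_def)
  have VB: "snd q i \<in> B i" if "q \<in> V" "i \<in> {1..m}" for q i using that by (auto simp: V_def)
  have q0V: "q0 \<in> V"
    using q0 U_D(2)[OF q0] B(2) unfolding V_def U_def by (cases q0) (auto simp: PiE_def)
  have Vo: "openin (mtop M) V"
  proof -
    have "openin (mtop (F i)) (UF i \<inter> B i)" if "i \<in> {1..m}" for i
      using chart.U_open[OF F_chart[OF that]] B(1)[OF that] by blast
    then have "openin (product_topology (\<lambda>i. mtop (F i)) {1..m}) (\<Pi>\<^sub>E i\<in>{1..m}. UF i \<inter> B i)"
      by (simp add: openin_PiE)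
    then show ?thesis unfolding V_def M_simps openin_prod_Times_iff using openin_subset by auto
  qed
  \<comment> \<open>Components of the frame in the product chart; prescribing components makes
    tangency and smoothness consequences of the coordinate calculus.\<close>
  define A where "A k l q = (case k of None \<Rightarrow> (case l of None \<Rightarrow> 1 | Some _ \<Rightarrow> 0)
    | Some (i, a) \<Rightarrow> (case l of None \<Rightarrow> 0 | Some (j, b) \<Rightarrow>
        if i = j then \<phi> (fst q) powr (- p i) * e i a (snd q i) (\<lambda>z. cF i z b) else 0))"
    for k l :: "(nat \<times> 'k) option" and q :: "real \<times> (nat \<Rightarrow> 'a)"
  define E where "E k q f = (\<Sum>l\<in>midx M. A k l q * pd l q f)" for k q f
  have A: "smooth_fun_on M V (A k l)" if k: "k \<in> midx M" and l: "l \<in> midx M" for k l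
  proof (cases "\<exists>i a b. k = Some (i, a) \<and> l = Some (i, b)")
    case True
    then obtain i a b where kl: "k = Some (i, a)" "l = Some (i, b)" by blast
    have i: "i \<in> {1..m}" "a \<in> midx (F i)" "b \<in> midx (F i)" using k l kl by auto
    interpret X: metric_chart "F i" "UF i" "cF i" by (rule F_metric_chart[OF i(1)])
    have O1: "openin (mtop (F i)) (UF i \<inter> B i)" using X.U_open B(1)[OF i(1)] by blast
    have "smooth_fun_on (F i) (UF i \<inter> B i) (\<lambda>z. e i a z (\<lambda>z. cF i z b))"
      by (rule X.smooth_field_comp[OF X.smooth_field_on_subset[OF orthonormal_frame_onD(1)[OF e[OF i(1)] i(2)] O1] _ i(3)]) auto
    then have "smooth_fun_on M V (\<lambda>q. \<phi> (fst q) powr (- p i) * e i a (snd q i) (\<lambda>z. cF i z b))"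
      by (intro M.smooth_fun_on_mult M.smooth_fun_on_subset[OF \<phi>_smooth_M Vo VU] smooth_pullback[OF i(1) _ Vo])
         (use VB U_D(2) VU i in auto)
    then show ?thesis by (simp add: A_def[abs_def] kl)
  next
    case False
    then have "A k l = (\<lambda>q. if k = None \<and> l = None then 1 else 0)"
      by (auto simp: A_def fun_eq_iff split: option.splits)
    then show ?thesis using M.smooth_fun_on_const[OF Vo] by simp
  qed
  have E: "smooth_field_on M V (E k)" if k: "k \<in> midx M" for k
    unfolding E_def[abs_def] by (rule smooth_field_combination[OF Vo VU A[OF k]])
  have Ec: "E k q (\<lambda>r. c r l) = A k l q" if "q \<in> V" "l \<in> midx M" for k l q
    unfolding E_def by (rule combination_crd) (use that VU in auto)
  have EN: "E k q fst = A k None q" if "q \<in> V" for k q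
    using Ec[OF that None_in_idx] by simp
  have Et: "E k q \<in> tangent_space M q" if "q \<in> V" "k \<in> midx M" for k q
    by (rule M.smooth_field_onD(2)[OF E[OF that(2)] that(1)])
  have dE: "dF n q (E k q) = (case k of None \<Rightarrow> (\<lambda>f. 0) | Some (i, a) \<Rightarrow>
      if i = n then (\<lambda>f. \<phi> (fst q) powr (- p n) * e n a (snd q n) f) else (\<lambda>f. 0))"
    if q: "q \<in> V" and k: "k \<in> midx M" and n: "n \<in> {1..m}" for q k n
  proof -
    have qU: "q \<in> U" using q VU by blast
    interpret X: metric_chart "F n" "UF n" "cF n" by (rule F_metric_chart[OF n])
    have "dF n q (E k q) = (\<lambda>f. \<Sum>b\<in>midx (F n). A k (Some (n, b)) q * pdF n b (snd q n) f)"
      unfolding dF_expand[OF qU n Et[OF q k]]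
      by (intro ext sum.cong refl) (use Ec[OF q] n in simp)
    also have "\<dots> = (case k of None \<Rightarrow> (\<lambda>f. 0) | Some (i, a) \<Rightarrow>
      if i = n then (\<lambda>f. \<phi> (fst q) powr (- p n) * e n a (snd q n) f) else (\<lambda>f. 0))"
    proof (cases "\<exists>a. k = Some (n, a)")
      case True
      then obtain a where a: "k = Some (n, a)" by blast
      have t: "e n a (snd q n) \<in> tangent_space (F n) (snd q n)"
        by (rule X.smooth_field_onD(2)[OF orthonormal_frame_onD(1)[OF e[OF n]] VB[OF q n]]) (use a k in simp)
      have "e n a (snd q n) f = (\<Sum>b\<in>midx (F n). e n a (snd q n) (\<lambda>z. cF n z b) * pdF n b (snd q n) f)" for f
        by (rule fun_cong[OF X.tangent_expand[OF t U_D(2)[OF qU n], unfolded prod.collapse]])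
      from this[symmetric] show ?thesis by (simp add: a A_def mult.assoc flip: sum_distrib_left)
    qed (auto simp: A_def split: option.splits)
    finally show ?thesis .
  qed
  have zero: "mmetric (F n) (snd q n) (\<lambda>f. 0) (dF n q (E k q)) = 0" "mmetric (F n) (snd q n) (dF n q (E k q)) (\<lambda>f. 0) = 0"
    if "q \<in> V" "k \<in> midx M" "n \<in> {1..m}" for n q k
    by (rule metric_zero[OF that(3) U_D(2)[OF _ that(3)] dF_tangent[OF _ that(3) Et[OF that(1,2)]]]; use that VU in blast)+
  have metric: "mmetric M q (E k q) (E l q) = (case k of None \<Rightarrow> (case l of None \<Rightarrow> -1 | Some _ \<Rightarrow> 0)
    | Some (i, a) \<Rightarrow> (case l of None \<Rightarrow> 0 | Some (j, b) \<Rightarrow>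
        if i = j then mmetric (F i) (snd q i) (e i a (snd q i)) (e i b (snd q i)) else 0))"
    if q: "q \<in> V" and k: "k \<in> midx M" and l: "l \<in> midx M" for q k l
  proof (cases "\<exists>i a b. k = Some (i, a) \<and> l = Some (i, b)")
    case True
    then obtain i a b where kl: "k = Some (i, a)" "l = Some (i, b)" by blast
    have i: "i \<in> {1..m}" "a \<in> midx (F i)" "b \<in> midx (F i)" using k l kl by auto
    have qU: "q \<in> U" using q VU by blast
    have pos: "\<phi> (fst q) > 0" by (rule \<phi>_pos[OF U_D(1)[OF qU]])
    interpret X: metric_chart "F i" "UF i" "cF i" by (rule F_metric_chart[OF i(1)])
    have t: "e i a (snd q i) \<in> tangent_space (F i) (snd q i)" if "a \<in> midx (F i)" for a
      by (rule X.smooth_field_onD(2)[OF orthonormal_frame_onD(1)[OF e[OF i(1)] that] VB[OF q i(1)]])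
    let ?g = "mmetric (F i) (snd q i) (e i a (snd q i)) (e i b (snd q i))"
    have "\<phi> (fst q) powr (2 * p n) * mmetric (F n) (snd q n) (dF n q (E k q)) (dF n q (E l q)) = (if n = i then ?g else 0)"
      if n: "n \<in> {1..m}" for n
    proof (cases "n = i")
      case True
      have "mmetric (F n) (snd q n) (dF n q (E k q)) (dF n q (E l q)) =
          \<phi> (fst q) powr (- p i) * \<phi> (fst q) powr (- p i) * ?g"
        using dE[OF q k n] dE[OF q l n] X.metric_scale[OF U_D(2)[OF qU i(1)] t[OF i(2)] t[OF i(3)]]
        by (simp add: kl True)
      moreover have "\<phi> (fst q) powr (2 * p i) * (\<phi> (fst q) powr (- p i) * \<phi> (fst q) powr (- p i)) = 1"
        using pos by (simp flip: powr_add)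
      ultimately show ?thesis using True by (simp add: mult.assoc[symmetric])
    next
      case False
      then show ?thesis using dE[OF q k n] zero(1)[OF q l n] by (simp add: kl)
    qed
    then have "mmetric M q (E k q) (E l q) = (\<Sum>n=1..m. if n = i then ?g else 0)"
      unfolding mmetric_dF EN[OF q] by (simp add: A_def kl)
    then show ?thesis using i kl by simp
  next
    case False
    have "mmetric (F n) (snd q n) (dF n q (E k q)) (dF n q (E l q)) = 0" if n: "n \<in> {1..m}" for n
      using False dE[OF q k n] dE[OF q l n] zero[OF q k n] zero[OF q l n] by (auto split: option.splits if_splits)
    then have "mmetric M q (E k q) (E l q) = - (A k None q * A l None q)"
      unfolding mmetric_dF EN[OF q] by simp
    with False show ?thesis by (auto simp: A_def split: option.splits)
  qed
  have "orthonormal_frame_on M V E"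
    unfolding orthonormal_frame_on_def
  proof (intro conjI ballI impI)
    fix q j k assume q: "q \<in> V" and jk: "j \<in> midx M" "k \<in> midx M" "j \<noteq> k"
    show "mmetric M q (E j q) (E k q) = 0"
    proof (cases "\<exists>i a b. j = Some (i, a) \<and> k = Some (i, b)")
      case True
      then obtain i a b where s: "j = Some (i, a)" "k = Some (i, b)" by blast
      have i: "i \<in> {1..m}" "a \<in> midx (F i)" "b \<in> midx (F i)" "a \<noteq> b" using jk s by auto
      show ?thesis
        using metric[OF q jk(1,2)] orthonormal_frame_onD(2)[OF e[OF i(1)] i(2,3) VB[OF q i(1)] i(4)] by (simp add: s)
    next
      case False
      then show ?thesis unfolding metric[OF q jk(1,2)] using jk(3) by (auto split: option.split)
    qed
  next
    fix q k assume q: "q \<in> V" and k: "k \<in> midx M"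
    show "mmetric M q (E k q) (E k q) \<in> {-1, 1}"
    proof (cases k)
      case None
      then show ?thesis unfolding metric[OF q k k] by simp
    next
      case (Some ia)
      obtain i a where ia: "ia = (i, a)" by (cases ia)
      have i: "i \<in> {1..m}" "a \<in> midx (F i)" using k Some ia by auto
      show ?thesis
        using metric[OF q k k] orthonormal_frame_onD(3)[OF e[OF i(1)] i(2) VB[OF q i(1)]] by (auto simp: Some ia)
    qed
  qed (rule E)
  with Vo q0V show ?thesis by blast
qed

end

context kasner_spacetime
begin

lemma chart_at:
  assumes "q \<in> topspace (mtop M)"
  obtains C where "kasner_chart I \<phi> m F C" "q \<in> kasner_pre_chart.U I m C"
proof -
  obtain U c where "(U, c) \<in> matlas M" "q \<in> U" using M.chart_cover[OF assms] by blast
  then show thesis using atlas_cases that kasner_chart.intro by metis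
qed

sublocale M: metric_manifold M
proof
  show "mmetric M q (\<lambda>f. a * u f + b * v f) w = a * mmetric M q u w + b * mmetric M q v w"
    if T: "q \<in> topspace (mtop M)" "u \<in> tangent_space M q" "v \<in> tangent_space M q" "w \<in> tangent_space M q" for q u v w a b
  proof -
    obtain C where C: "kasner_chart I \<phi> m F C" "q \<in> kasner_pre_chart.U I m C" using T(1) by (rule chart_at)
    interpret X: kasner_chart I \<phi> m p F C by (rule C)
    show ?thesis by (rule X.M_metric_linear[OF C(2) T(2-4)])
  qed
  show "mmetric M q u v = mmetric M q v u"
    if T: "q \<in> topspace (mtop M)" "u \<in> tangent_space M q" "v \<in> tangent_space M q" for q u v
  proof -
    obtain C where C: "kasner_chart I \<phi> m F C" "q \<in> kasner_pre_chart.U I m C" using T(1) by (rule chart_at)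
    interpret X: kasner_chart I \<phi> m p F C by (rule C)
    show ?thesis by (rule X.M_metric_sym[OF C(2) T(2-3)])
  qed
  show "smooth_fun_on M U (\<lambda>q. mmetric M q (coord_vec M (U, c) j q) (coord_vec M (U, c) k q))"
    if T: "(U, c) \<in> matlas M" "j \<in> midx M" "k \<in> midx M" for U c j k
  proof -
    obtain C where C: "kasner_pre_chart I \<phi> m F C"
      and Uc: "U = kasner_pre_chart.U I m C" "c = kasner_pre_chart.c m F C" using T(1) by (rule atlas_cases)
    interpret X: kasner_chart I \<phi> m p F C by (rule kasner_chart.intro[OF C])
    show ?thesis unfolding Uc by (rule X.M_metric_coord_smooth[OF T(2,3)])
  qed
  show "\<exists>E V. openin (mtop M) V \<and> q \<in> V \<and> orthonormal_frame_on M V E" if T: "q \<in> topspace (mtop M)" for q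
  proof -
    obtain C where C: "kasner_chart I \<phi> m F C" "q \<in> kasner_pre_chart.U I m C" using T by (rule chart_at)
    interpret X: kasner_chart I \<phi> m p F C by (rule C)
    show ?thesis by (rule X.M_frame_exists[OF C(2)])
  qed
qed

end

section \<open>Derivatives of the warping functions\<close>

context kasner_chart
begin

sublocale MC: metric_chart M U c ..

lemma pd_product:
  assumes q: "q \<in> U" and s: "smooth_near M q (\<lambda>r. h (fst r))" and h: "(h has_real_derivative h') (at (fst q))"
    and i: "i \<in> {1..m}" and f: "smooth_near (F i) (snd q i) f" and k: "k \<in> midx M"
  shows "pd k q (\<lambda>r. h (fst r) * f (snd r i)) =
    (case k of None \<Rightarrow> h' * f (snd q i) | Some (j, a) \<Rightarrow> if j = i then h (fst q) * pdF i a (snd q i) f else 0)"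
  unfolding coord_vec_mult[OF q k s smooth_near_pullback[OF i U_topspace[OF q] f]]
    pd_pullback[OF q i f k] pd_time[OF q s h k]
  by (auto split: option.split)

lemma \<phi>_derivs:
  assumes "t \<in> I"
  shows "(\<phi> has_real_derivative deriv \<phi> t) (at t)" "(deriv \<phi> has_real_derivative deriv (deriv \<phi>) t) (at t)"
proof -
  have "(deriv ^^ 0) \<phi> differentiable (at t)" "(deriv ^^ 1) \<phi> differentiable (at t)"
    using \<phi>_smooth assms unfolding smooth_on_interval_def by blast+
  then show "(\<phi> has_real_derivative deriv \<phi> t) (at t)" "(deriv \<phi> has_real_derivative deriv (deriv \<phi>) t) (at t)"
    by (simp_all add: DERIV_deriv_iff_real_differentiable)
qed

text \<open>Logarithmic derivative of the warping function \<open>\<phi> powr p i\<close>.\<close>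

definition hubble :: "nat \<Rightarrow> real \<Rightarrow> real" where
  "hubble i t = p i * (deriv \<phi> t / \<phi> t)"

definition hubble' :: "nat \<Rightarrow> real \<Rightarrow> real" where
  "hubble' i t = p i * (deriv (deriv \<phi>) t / \<phi> t - (deriv \<phi> t)\<^sup>2 / (\<phi> t)\<^sup>2)"

lemma hubble_deriv:
  assumes "t \<in> I"
  shows "(hubble i has_real_derivative hubble' i t) (at t)"
  unfolding hubble_def[abs_def] hubble'_def
  by (rule DERIV_cong[OF DERIV_cmult[OF DERIV_divide[OF \<phi>_derivs(2,1)[OF assms]]]])
     (use \<phi>_pos[OF assms] in \<open>simp_all add: diff_divide_distrib power2_eq_square\<close>)

lemma warp_deriv:
  assumes "t \<in> I"
  shows "((\<lambda>t. \<phi> t powr (2 * p i)) has_real_derivative 2 * hubble i t * \<phi> t powr (2 * p i)) (at t)"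
proof -
  have "((\<lambda>t. \<phi> t powr (2 * p i)) has_real_derivative 2 * p i * \<phi> t powr (2 * p i - of_nat 1) * deriv \<phi> t) (at t)"
    by (rule DERIV_fun_powr[OF \<phi>_derivs(1)[OF assms] \<phi>_pos[OF assms]])
  moreover have "\<phi> t powr (2 * p i - of_nat 1) = \<phi> t powr (2 * p i) / \<phi> t"
    using \<phi>_pos[OF assms] by (simp add: powr_diff)
  ultimately show ?thesis by (simp add: hubble_def mult_ac)
qed

text \<open>The division by \<phi> becomes the power -1, which stays within products and powers of
  smooth functions.\<close>

lemma hubble_smooth: "smooth_fun_on M U (\<lambda>q. hubble i (fst q))"
proof -
  have "smooth_on_interval I (deriv \<phi>)"
    using \<phi>_smooth unfolding smooth_on_interval_def by (metis comp_apply funpow_Suc_right)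
  then have "smooth_fun_on M U (\<lambda>q. p i * (deriv \<phi> (fst q) * \<phi> (fst q) powr (-1)))"
    by (intro M.smooth_fun_on_mult M.smooth_fun_on_const U_open smooth_time \<phi>_smooth_M)
  then show ?thesis
  proof (rule M.smooth_fun_on_cong)
    fix q assume "q \<in> U"
    from \<phi>_pos[OF U_D(1)[OF this]]
    show "p i * (deriv \<phi> (fst q) * \<phi> (fst q) powr (-1)) = hubble i (fst q)"
      by (simp add: hubble_def powr_minus divide_inverse)
  qed
qed

end

locale kasner_connection = kasner_chart I \<phi> m p F C
  for I \<phi> m p and F :: "nat \<Rightarrow> ('a, 'k) manifold" and C +
  fixes nabla :: "(real \<times> (nat \<Rightarrow> 'a)) vfield \<Rightarrow> (real \<times> (nat \<Rightarrow> 'a)) vfield \<Rightarrow> (real \<times> (nat \<Rightarrow> 'a)) vfield"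
    and nablaF :: "nat \<Rightarrow> 'a vfield \<Rightarrow> 'a vfield \<Rightarrow> 'a vfield"
  assumes nabla: "levi_civita M nabla"
    and nablaF: "i \<in> {1..m} \<Longrightarrow> levi_civita (F i) (nablaF i)"
begin

definition \<Gamma> :: "nat \<Rightarrow> 'k \<Rightarrow> 'k \<Rightarrow> 'k \<Rightarrow> 'a \<Rightarrow> real" where
  "\<Gamma> i a b d z = nablaF i (pdF i a) (pdF i b) z (\<lambda>w. cF i w d)"

text \<open>Connection coefficients of the quarter-symmetric connection; \<open>lam1 = lam2 = 0\<close> gives the Levi-Civita connection.\<close>

definition kG :: "real \<Rightarrow> real \<Rightarrow> (nat \<times> 'k) option \<Rightarrow> (nat \<times> 'k) option \<Rightarrow> (nat \<times> 'k) option \<Rightarrow>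
    real \<times> (nat \<Rightarrow> 'a) \<Rightarrow> real" where
  "kG lam1 lam2 k1 k2 k3 q = (case k1 of
     None \<Rightarrow> (case k2 of
        None \<Rightarrow> if k3 = None then lam2 - lam1 else 0
      | Some (i, a) \<Rightarrow> if k3 = Some (i, a) then hubble i (fst q) else 0)
   | Some (i, a) \<Rightarrow> (case k2 of
        None \<Rightarrow> if k3 = Some (i, a) then hubble i (fst q) - lam1 else 0
      | Some (j, b) \<Rightarrow> (case k3 of
           None \<Rightarrow> if i = j then (hubble i (fst q) - lam2) * \<phi> (fst q) powr (2 * p i) * gF i a b (snd q i) else 0
         | Some (n, d) \<Rightarrow> if i = j \<and> n = i then \<Gamma> i a b d (snd q i) else 0)))"

text \<open>\<open>christoffel\<close> belongs to one fibre chart with one Levi-Civita connection;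
  \<Gamma> is freed from that context so that the fibre index can vary inside
  \<open>kG\<close>.\<close>

lemma \<Gamma>_eq: "i \<in> {1..m} \<Longrightarrow> metric_chart.christoffel (F i) (UF i) (cF i) (nablaF i) a b d z = \<Gamma> i a b d z"
  using metric_chart.christoffel_def[OF F_metric_chart nablaF] by (simp add: \<Gamma>_def)

lemma \<Gamma>_coeffs:
  assumes i: "i \<in> {1..m}"
  shows "chart.conn_coeffs (F i) (UF i) (cF i) (nablaF i) (\<Gamma> i)"
proof -
  interpret X: metric_chart "F i" "UF i" "cF i" by (rule F_metric_chart[OF i])
  show ?thesis
    by (rule X.conn_coeffs_cong[OF X.levi_civita_coeffs[OF nablaF[OF i]]]) (rule \<Gamma>_eq[OF i])
qed

lemma \<Gamma>_sym:
  assumes i: "i \<in> {1..m}" and z: "z \<in> UF i" and ab: "a \<in> midx (F i)" "b \<in> midx (F i)" "d \<in> midx (F i)"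
  shows "\<Gamma> i a b d z = \<Gamma> i b a d z"
proof -
  interpret X: metric_chart "F i" "UF i" "cF i" by (rule F_metric_chart[OF i])
  show ?thesis using X.christoffel_sym[OF nablaF[OF i] z ab] by (simp only: \<Gamma>_eq[OF i])
qed

lemma gF_sym:
  assumes i: "i \<in> {1..m}" and z: "z \<in> UF i" and ab: "a \<in> midx (F i)" "b \<in> midx (F i)"
  shows "gF i a b z = gF i b a z"
proof -
  interpret X: metric_chart "F i" "UF i" "cF i" by (rule F_metric_chart[OF i])
  show ?thesis using X.gm_sym[OF z ab] by (simp add: gF_def)
qed

lemma \<Gamma>_metric:
  assumes i: "i \<in> {1..m}" and z: "z \<in> UF i" and ab: "e \<in> midx (F i)" "a \<in> midx (F i)" "b \<in> midx (F i)"
  shows "pdF i e z (gF i a b) = (\<Sum>d\<in>midx (F i). \<Gamma> i e a d z * gF i d b z) + (\<Sum>d\<in>midx (F i). \<Gamma> i e b d z * gF i d a z)"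
proof -
  interpret X: metric_chart "F i" "UF i" "cF i" by (rule F_metric_chart[OF i])
  show ?thesis using X.christoffel_metric[OF nablaF[OF i] z ab] unfolding \<Gamma>_eq[OF i]
    by (simp add: gF_def[abs_def])
qed

lemma gF_near: "i \<in> {1..m} \<Longrightarrow> z \<in> UF i \<Longrightarrow> a \<in> midx (F i) \<Longrightarrow> b \<in> midx (F i) \<Longrightarrow> smooth_near (F i) z (gF i a b)"
  using atlas_manifold.smooth_nearI[OF F_atlas gF_smooth] by blast

lemma \<Gamma>_near:
  assumes "i \<in> {1..m}" "z \<in> UF i" "a \<in> midx (F i)" "b \<in> midx (F i)" "d \<in> midx (F i)"
  shows "smooth_near (F i) z (\<Gamma> i a b d)"
proof -
  interpret X: metric_chart "F i" "UF i" "cF i" by (rule F_metric_chart[OF assms(1)])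
  show ?thesis using X.smooth_nearI[OF X.conn_coeffs_smooth[OF \<Gamma>_coeffs] assms(2)] assms by blast
qed

lemma sum_single_block:
  "i \<in> {1..m} \<Longrightarrow> (\<Sum>n=1..m. \<Sum>d\<in>midx (F n). if n = i then h n d else 0) = (\<Sum>d\<in>midx (F i). h i d :: real)"
proof -
  assume i: "i \<in> {1..m}"
  have "(\<Sum>n=1..m. \<Sum>d\<in>midx (F n). if n = i then h n d else 0) = (\<Sum>n=1..m. if n = i then \<Sum>d\<in>midx (F i). h i d else 0)"
    by (intro sum.cong refl) auto
  with i show ?thesis by simp
qed

lemma sum_single_idx:
  assumes "k \<in> midx M"
  shows "(\<Sum>l\<in>midx M. (if l = k then h l else 0) * g l) = h k * (g k :: real)"
proof -
  have "(\<Sum>l\<in>midx M. (if l = k then h l else 0) * g l) = (\<Sum>l\<in>midx M. if l = k then h l * g l else 0)"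
    by (intro sum.cong) auto
  then show ?thesis using assms finite_M by simp
qed

text \<open>Stated for an arbitrary \<open>g\<close>, so that the same four rules lower indices with
  the metric and evaluate the quadratic terms of the Ricci tensor.\<close>

lemma kG_contract:
  shows "(\<Sum>l\<in>midx M. kG l1 l2 None None l q * g l) = (l2 - l1) * g None"
    and "i \<in> {1..m} \<Longrightarrow> a \<in> midx (F i) \<Longrightarrow>
      (\<Sum>l\<in>midx M. kG l1 l2 None (Some (i, a)) l q * g l) = hubble i (fst q) * g (Some (i, a))"
    and "i \<in> {1..m} \<Longrightarrow> a \<in> midx (F i) \<Longrightarrow>
      (\<Sum>l\<in>midx M. kG l1 l2 (Some (i, a)) None l q * g l) = (hubble i (fst q) - l1) * g (Some (i, a))"
    and "i \<in> {1..m} \<Longrightarrow> (\<Sum>l\<in>midx M. kG l1 l2 (Some (i, a)) (Some (j, b)) l q * g l) =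
      (if i = j then (hubble i (fst q) - l2) * \<phi> (fst q) powr (2 * p i) * gF i a b (snd q i) * g None
         + (\<Sum>d\<in>midx (F i). \<Gamma> i a b d (snd q i) * g (Some (i, d))) else 0)"
proof -
  show "(\<Sum>l\<in>midx M. kG l1 l2 None None l q * g l) = (l2 - l1) * g None"
    using sum_single_idx[OF None_in_idx, of "\<lambda>_. l2 - l1" g] by (simp add: kG_def)
  show "(\<Sum>l\<in>midx M. kG l1 l2 None (Some (i, a)) l q * g l) = hubble i (fst q) * g (Some (i, a))"
    "(\<Sum>l\<in>midx M. kG l1 l2 (Some (i, a)) None l q * g l) = (hubble i (fst q) - l1) * g (Some (i, a))"
    if "i \<in> {1..m}" "a \<in> midx (F i)"
    using sum_single_idx[of "Some (i, a)" "\<lambda>_. hubble i (fst q)" g] sum_single_idx[of "Some (i, a)" "\<lambda>_. hubble i (fst q) - l1" g] that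
    by (simp_all add: kG_def)
  show "(\<Sum>l\<in>midx M. kG l1 l2 (Some (i, a)) (Some (j, b)) l q * g l) =
      (if i = j then (hubble i (fst q) - l2) * \<phi> (fst q) powr (2 * p i) * gF i a b (snd q i) * g None
         + (\<Sum>d\<in>midx (F i). \<Gamma> i a b d (snd q i) * g (Some (i, d))) else 0)" if i: "i \<in> {1..m}"
  proof (cases "i = j")
    case True
    have "(\<Sum>n=1..m. \<Sum>d\<in>midx (F n). kG l1 l2 (Some (i, a)) (Some (j, b)) (Some (n, d)) q * g (Some (n, d))) =
        (\<Sum>n=1..m. \<Sum>d\<in>midx (F n). if n = i then \<Gamma> i a b d (snd q i) * g (Some (n, d)) else 0)"
      by (intro sum.cong refl) (simp add: kG_def True)
    also have "\<dots> = (\<Sum>d\<in>midx (F i). \<Gamma> i a b d (snd q i) * g (Some (i, d)))"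
      by (rule sum_single_block[OF i])
    finally show ?thesis unfolding sum_idx using True by (simp add: kG_def)
  next
    case False
    then have "kG l1 l2 (Some (i, a)) (Some (j, b)) l q = 0" for l
      by (auto simp: kG_def split: option.split)
    with False show ?thesis by simp
  qed
qed

end

section \<open>Coefficients of the Levi-Civita and the quarter-symmetric connection\<close>

context kasner_connection
begin

lemma pd_const_on_U:
  assumes "q \<in> U" "k \<in> midx M" "\<And>r. r \<in> U \<Longrightarrow> f r = e"
  shows "pd k q f = 0"
  using coord_vec_cong[OF U_open assms(1,1,2), of f "\<lambda>r. e"] assms(3) coord_vec_const[OF assms(1,2)] by simp

lemma \<phi>_smooth_near: "q \<in> U \<Longrightarrow> smooth_near M q (\<lambda>r. \<phi> (fst r) powr e)"
  by (rule M.smooth_nearI[OF \<phi>_smooth_M])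

lemma hubble_smooth_near: "q \<in> U \<Longrightarrow> smooth_near M q (\<lambda>r. hubble i (fst r) - e)"
  by (rule M.smooth_nearI[OF M.smooth_fun_on_diff[OF hubble_smooth M.smooth_fun_on_const[OF U_open]]])

lemma pd_gm_Some:
  assumes q: "q \<in> U" and k: "k \<in> midx M" and i: "i \<in> {1..m}" "a \<in> midx (F i)" "b \<in> midx (F i)"
  shows "pd k q (MC.gm (Some (i, a)) (Some (i, b))) = (case k of
      None \<Rightarrow> 2 * hubble i (fst q) * \<phi> (fst q) powr (2 * p i) * gF i a b (snd q i)
    | Some (n, e) \<Rightarrow> if n = i then \<phi> (fst q) powr (2 * p i) * pdF i e (snd q i) (gF i a b) else 0)"
proof -
  have "pd k q (MC.gm (Some (i, a)) (Some (i, b))) = pd k q (\<lambda>r. \<phi> (fst r) powr (2 * p i) * gF i a b (snd r i))"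
    by (rule coord_vec_cong[OF U_open q q k]) (use gm_M(4)[OF _ i(1,2) i(1,3)] in simp)
  also have "\<dots> = (case k of
      None \<Rightarrow> 2 * hubble i (fst q) * \<phi> (fst q) powr (2 * p i) * gF i a b (snd q i)
    | Some (n, e) \<Rightarrow> if n = i then \<phi> (fst q) powr (2 * p i) * pdF i e (snd q i) (gF i a b) else 0)"
    by (rule pd_product[OF q \<phi>_smooth_near[OF q] warp_deriv[OF U_D(1)[OF q]] i(1) gF_near[OF i(1) U_D(2)[OF q i(1)] i(2,3)] k])
  finally show ?thesis .
qed

lemma pd_gm_zero:
  assumes q: "q \<in> U" and k: "k \<in> midx M"
  shows "pd k q (MC.gm None None) = 0"
    and "i \<in> {1..m} \<Longrightarrow> a \<in> midx (F i) \<Longrightarrow> pd k q (MC.gm None (Some (i, a))) = 0"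
    and "i \<in> {1..m} \<Longrightarrow> a \<in> midx (F i) \<Longrightarrow> pd k q (MC.gm (Some (i, a)) None) = 0"
    and "i \<in> {1..m} \<Longrightarrow> a \<in> midx (F i) \<Longrightarrow> j \<in> {1..m} \<Longrightarrow> b \<in> midx (F j) \<Longrightarrow> i \<noteq> j \<Longrightarrow>
      pd k q (MC.gm (Some (i, a)) (Some (j, b))) = 0"
proof -
  show "pd k q (MC.gm None None) = 0"
    by (rule pd_const_on_U[OF q k]) (rule gm_M(1))
  show "pd k q (MC.gm None (Some (i, a))) = 0" if "i \<in> {1..m}" "a \<in> midx (F i)"
    by (rule pd_const_on_U[OF q k]) (rule gm_M(2)[OF _ that])
  show "pd k q (MC.gm (Some (i, a)) None) = 0" if "i \<in> {1..m}" "a \<in> midx (F i)"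
    by (rule pd_const_on_U[OF q k]) (rule gm_M(3)[OF _ that])
  show "pd k q (MC.gm (Some (i, a)) (Some (j, b))) = 0"
    if "i \<in> {1..m}" "a \<in> midx (F i)" "j \<in> {1..m}" "b \<in> midx (F j)" "i \<noteq> j"
    by (rule pd_const_on_U[OF q k, where e = 0]) (simp only: gm_M(4)[OF _ that(1-4)] that(5) if_False)
qed

text \<open>The candidate is verified rather than derived: by uniqueness it is enough to check
  symmetry and metric compatibility, one combination of index kinds at a time. In the mixed cases
  the time component of a fibre pair cancels against a time-fibre coefficient.\<close>

lemma nabla_christoffel:
  assumes q: "q \<in> U" and ijl: "i \<in> midx M" "j \<in> midx M" "l \<in> midx M"
  shows "MC.christoffel nabla i j l q = kG 0 0 i j l q"
proof (rule MC.christoffel_unique[OF nabla q _ _ ijl])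
  show "kG 0 0 i j l q = kG 0 0 j i l q" if "i \<in> midx M" "j \<in> midx M" "l \<in> midx M" for i j l
    using that \<Gamma>_sym[OF _ U_D(2)[OF q]] gF_sym[OF _ U_D(2)[OF q]]
    by (cases i; cases j; cases l) (auto simp: kG_def)
  fix i j k assume i: "i \<in> midx M" and j: "j \<in> midx M" and k: "k \<in> midx M"
  \<comment> \<open>The candidate with its upper index lowered by the metric.\<close>
  let ?L = "\<lambda>i j k. \<Sum>l\<in>midx M. kG 0 0 i j l q * MC.gm l k q"
  have L0: "?L None None k = 0" for k by (simp add: kG_contract)
  have L1: "?L None (Some (n, a)) k = hubble n (fst q) * MC.gm (Some (n, a)) k q"
    "?L (Some (n, a)) None k = hubble n (fst q) * MC.gm (Some (n, a)) k q" if "n \<in> {1..m}" "a \<in> midx (F n)" for n a k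
    using kG_contract(2,3)[OF that, of 0 0 q "\<lambda>l. MC.gm l k q"] by simp_all
  have L2: "?L (Some (n, a)) (Some (n', b)) None =
      (if n = n' then - (hubble n (fst q) * \<phi> (fst q) powr (2 * p n) * gF n a b (snd q n)) else 0)"
    if n: "n \<in> {1..m}" for n n' a b
  proof -
    have "(\<Sum>d\<in>midx (F n). \<Gamma> n a b d (snd q n) * MC.gm (Some (n, d)) None q) = 0"
      by (intro sum.neutral ballI) (simp only: gm_M(3)[OF q n] mult_zero_right)
    then show ?thesis unfolding kG_contract(4)[OF n] gm_M(1)[OF q] by (simp only:) simp
  qed
  have L3: "?L (Some (n, a)) (Some (n', b)) (Some (n'', e)) =
      (if n = n' \<and> n = n'' then \<phi> (fst q) powr (2 * p n) * (\<Sum>d\<in>midx (F n). \<Gamma> n a b d (snd q n) * gF n d e (snd q n)) else 0)"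
    if n: "n \<in> {1..m}" and e: "n'' \<in> {1..m}" "e \<in> midx (F n'')" for n n' n'' a b e
  proof -
    have "(\<Sum>d\<in>midx (F n). \<Gamma> n a b d (snd q n) * MC.gm (Some (n, d)) (Some (n'', e)) q) =
        (if n = n'' then \<phi> (fst q) powr (2 * p n) * (\<Sum>d\<in>midx (F n). \<Gamma> n a b d (snd q n) * gF n d e (snd q n)) else 0)"
    proof (cases "n = n''")
      case True
      then show ?thesis unfolding sum_distrib_left
        by (simp, intro sum.cong refl) (use gm_M(4)[OF q n _ e] in \<open>simp add: mult_ac\<close>)
    next
      case False
      then show ?thesis using gm_M(4)[OF q n _ e] by simp
    qed
    then show ?thesis unfolding kG_contract(4)[OF n] gm_M(2)[OF q e] by (simp only:) simp
  qed
  show "pd i q (MC.gm j k) = ?L i j k + ?L i k j"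
  proof (cases i)
    case iN: None
    show ?thesis
    proof (cases j)
      case jN: None
      show ?thesis
      proof (cases k)
        case None
        show ?thesis unfolding iN jN None L0 by (simp add: pd_gm_zero[OF q])
      next
        case (Some nb)
        obtain n b where nb: "nb = (n, b)" by (cases nb)
        have n: "n \<in> {1..m}" "b \<in> midx (F n)" using k Some nb by auto
        show ?thesis unfolding iN jN Some nb L0 L1[OF n] pd_gm_zero(2)[OF q None_in_idx n] gm_M(3)[OF q n] by simp
      qed
    next
      case (Some ma)
      obtain n a where ma: "ma = (n, a)" by (cases ma)
      have n: "n \<in> {1..m}" "a \<in> midx (F n)" using j Some ma by auto
      show ?thesis
      proof (cases k)
        case None
        show ?thesis unfolding iN Some None ma L0 L1[OF n] pd_gm_zero(3)[OF q None_in_idx n] gm_M(3)[OF q n] by simp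
      next
        case S2: (Some nb)
        obtain n' b where nb: "nb = (n', b)" by (cases nb)
        have n': "n' \<in> {1..m}" "b \<in> midx (F n')" using k S2 nb by auto
        show ?thesis
        proof (cases "n = n'")
          case True
          show ?thesis unfolding iN Some S2 ma nb L1[OF n] L1[OF n'] gm_M(4)[OF q n n'] gm_M(4)[OF q n' n]
            using pd_gm_Some[OF q None_in_idx n, of b] n' gF_sym[OF n(1) U_D(2)[OF q n(1)], of b a] n by (simp add: True)
        next
          case False
          show ?thesis unfolding iN Some S2 ma nb L1[OF n] L1[OF n'] gm_M(4)[OF q n n'] gm_M(4)[OF q n' n]
            using pd_gm_zero(4)[OF q None_in_idx n n' False] False by simp
        qed
      qed
    qed
  next
    case iS: (Some le)
    obtain n0 e where le: "le = (n0, e)" by (cases le)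
    have n0: "n0 \<in> {1..m}" "e \<in> midx (F n0)" using i iS le by auto
    note ik = i[unfolded iS le]
    show ?thesis
    proof (cases j)
      case jN: None
      show ?thesis
      proof (cases k)
        case None
        show ?thesis unfolding iS le jN None L1[OF n0] gm_M(3)[OF q n0] pd_gm_zero(1)[OF q ik] by simp
      next
        case (Some nb)
        obtain n b where nb: "nb = (n, b)" by (cases nb)
        have n: "n \<in> {1..m}" "b \<in> midx (F n)" using k Some nb by auto
        show ?thesis unfolding iS le jN Some nb L1[OF n0] L2[OF n0(1)] pd_gm_zero(2)[OF q ik n] gm_M(4)[OF q n0 n] by simp
      qed
    next
      case (Some ma)
      obtain n a where ma: "ma = (n, a)" by (cases ma)
      have n: "n \<in> {1..m}" "a \<in> midx (F n)" using j Some ma by auto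
      show ?thesis
      proof (cases k)
        case None
        show ?thesis unfolding iS le Some None ma L1[OF n0] L2[OF n0(1)] pd_gm_zero(3)[OF q ik n] gm_M(4)[OF q n0 n] by simp
      next
        case S2: (Some nb)
        obtain n' b where nb: "nb = (n', b)" by (cases nb)
        have n': "n' \<in> {1..m}" "b \<in> midx (F n')" using k S2 nb by auto
        show ?thesis
        proof (cases "n = n'")
          case True
          have b: "b \<in> midx (F n)" using n' True by simp
          show ?thesis
          proof (cases "n0 = n")
            case t: True
            show ?thesis unfolding iS le Some S2 ma nb L3[OF n0(1) n'] L3[OF n0(1) n]
              using pd_gm_Some[OF q ik n b] \<Gamma>_metric[OF n(1) U_D(2)[OF q n(1)] _ n(2) b, of e] n0
              by (simp add: True[symmetric] t distrib_left)
          next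
            case False
            show ?thesis unfolding iS le Some S2 ma nb L3[OF n0(1) n'] L3[OF n0(1) n]
              using pd_gm_Some[OF q ik n b] False by (simp add: True[symmetric])
          qed
        next
          case False
          show ?thesis unfolding iS le Some S2 ma nb L3[OF n0(1) n'] L3[OF n0(1) n]
            using pd_gm_zero(4)[OF q ik n n' False] False by simp
        qed
      qed
    qed
  qed
qed

lemma nabla_coeffs: "conn_coeffs nabla (kG 0 0)"
  by (rule MC.conn_coeffs_cong[OF MC.levi_civita_coeffs[OF nabla] nabla_christoffel])

text \<open>\<open>time_field\<close> varies the time of a point directly, whereas
  \<open>pd None\<close> varies a coordinate and inverts the chart. They agree because near
  \<open>q\<close> the point with the altered time coordinate keeps its fibre components.\<close>

lemma time_field_eq:
  assumes q: "q \<in> U"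
  shows "time_field M q = pd None q"
proof
  fix f
  show "time_field M q f = pd None q f"
  proof (cases "smooth_near M q f")
    case True
    have ev: "\<forall>\<^sub>F s in nhds (c q None). f (inv_into U c ((c q)(None := s))) = f (s, snd q)"
    proof (rule eventually_mono[OF slice_inv_in[OF U_open q q None_in_idx]])
      fix s assume "inv_into U c ((c q)(None := s)) \<in> U \<inter> U \<and> (c q)(None := s) \<in> c ` (U \<inter> U)"
      then have y: "(c q)(None := s) \<in> c ` U" unfolding Int_absorb by (rule conjunct2)
      then obtain r where r: "r \<in> U" "(c q)(None := s) = c r" by blast
      have "snd r j = snd q j" for j
      proof (cases "j \<in> {1..m}")
        case j: True
        have "slice j ((c q)(None := s)) = slice j (c q)" by (auto simp: slice_def fun_eq_iff)
        then have "inv_into (UF j) (cF j) (cF j (snd r j)) = inv_into (UF j) (cF j) (cF j (snd q j))"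
          using slice_c[OF r(1) j] slice_c[OF q j] r(2) by simp
        then show ?thesis
          using chart.inv_c[OF F_chart[OF j] U_D(2)[OF r(1) j]] chart.inv_c[OF F_chart[OF j] U_D(2)[OF q j]] by simp
      next
        case False
        then show ?thesis using U_D(3)[OF r(1)] U_D(3)[OF q] by (simp add: extensional_def)
      qed
      moreover have "fst r = s" using r(2) by (metis c_None fun_upd_same)
      ultimately have "r = (s, snd q)" by (simp add: prod_eq_iff fun_eq_iff)
      then show "f (inv_into U c ((c q)(None := s))) = f (s, snd q)" unfolding r(2) inv_c[OF r(1)] by simp
    qed
    have "((\<lambda>s. f (s, snd q)) has_real_derivative pd None q f) (at (fst q))"
      using coord_vec_deriv[OF q True None_in_idx] unfolding DERIV_cong_ev[OF refl ev refl] by simp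
    then show ?thesis using True by (cases q) (simp add: time_field_def DERIV_imp_deriv)
  next
    case False
    then show ?thesis by (cases q) (simp add: time_field_def coord_vec_not_smooth)
  qed
qed

text \<open>The metric is -1 on the time field. Hence \<open>lam1\<close> enters with a minus sign
  where the second index is time, and for two time indices the two corrections add up to
  \<open>lam2 - lam1\<close>.\<close>

lemma quarter_coeffs: "conn_coeffs (quarter_symmetric M (time_field M) lam1 lam2 nabla) (kG lam1 lam2)"
proof -
  have P: "smooth_field_on M U (time_field M)"
    by (rule M.smooth_field_on_cong[OF smooth_field_coord_vec[OF None_in_idx U_open order_refl]])
       (rule time_field_eq[symmetric])
  show ?thesis
  proof (rule MC.conn_coeffs_cong[OF MC.quarter_symmetric_coeffs[OF nabla_coeffs P]])
    fix i k l q assume i: "i \<in> midx M" and k: "k \<in> midx M" and l: "l \<in> midx M" and q: "q \<in> U"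
    have l': "pd None q (\<lambda>r. c r l) = (if l = None then 1 else 0)"
      by (rule coord_vec_crd[OF q None_in_idx l])
    show "kG 0 0 i k l q + lam1 * mmetric M q (pd k q) (time_field M q) * (if i = l then 1 else 0)
        - lam2 * MC.gm i k q * time_field M q (\<lambda>r. c r l) = kG lam1 lam2 i k l q"
      unfolding time_field_eq[OF q] l'
      using i k l gm_M[OF q]
      by (cases i; cases k; cases l) (auto simp: kG_def left_diff_distrib split: if_splits)
  qed
qed

section \<open>The Ricci tensor of the quarter-symmetric connection\<close>

text \<open>Direction index contracted with the result; for a Levi-Civita connection this is the
  logarithmic derivative of the volume density.\<close>

definition traceG :: "real \<Rightarrow> real \<Rightarrow> (nat \<times> 'k) option \<Rightarrow> real \<times> (nat \<Rightarrow> 'a) \<Rightarrow> real" where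
  "traceG l1 l2 k q = (\<Sum>j\<in>midx M. kG l1 l2 j k j q)"

lemma traceG_None: "traceG l1 l2 None q = (l2 - l1) + (\<Sum>n=1..m. real (card (midx (F n))) * (hubble n (fst q) - l1))"
  unfolding traceG_def sum_idx by (simp add: kG_def)

lemma traceG_Some:
  assumes "i \<in> {1..m}"
  shows "traceG l1 l2 (Some (i, a)) q = (\<Sum>d\<in>midx (F i). \<Gamma> i d a d (snd q i))"
proof -
  have "(\<Sum>n=1..m. \<Sum>d\<in>midx (F n). kG l1 l2 (Some (n, d)) (Some (i, a)) (Some (n, d)) q) =
      (\<Sum>n=1..m. \<Sum>d\<in>midx (F n). if n = i then \<Gamma> n d a d (snd q n) else 0)"
    by (intro sum.cong refl) (auto simp: kG_def)
  also have "\<dots> = (\<Sum>d\<in>midx (F i). \<Gamma> i d a d (snd q i))"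
    by (rule sum_single_block[OF assms])
  finally show ?thesis unfolding traceG_def sum_idx by (simp add: kG_def)
qed

text \<open>Arranged so that the last quadratic term is \<open>kG\<close> against
  \<open>traceG\<close>, the form in which unwanted terms cancel below.\<close>

lemma ricci_split:
  "MC.ricci_coeff (kG l1 l2) i k q =
     (\<Sum>j\<in>midx M. pd i q (kG l1 l2 j k j)) - (\<Sum>j\<in>midx M. pd j q (kG l1 l2 i k j))
     + (\<Sum>e\<in>midx M. \<Sum>j\<in>midx M. kG l1 l2 i e j q * kG l1 l2 j k e q)
     - (\<Sum>e\<in>midx M. kG l1 l2 i k e q * traceG l1 l2 e q)"
proof -
  have "(\<Sum>j\<in>midx M. \<Sum>e\<in>midx M. kG l1 l2 j e j q * kG l1 l2 i k e q) = (\<Sum>e\<in>midx M. \<Sum>j\<in>midx M. kG l1 l2 j e j q * kG l1 l2 i k e q)"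
    by (rule sum.swap)
  also have "\<dots> = (\<Sum>e\<in>midx M. kG l1 l2 i k e q * traceG l1 l2 e q)"
    unfolding traceG_def by (simp add: sum_distrib_left mult.commute)
  finally have 1: "(\<Sum>j\<in>midx M. \<Sum>e\<in>midx M. kG l1 l2 j e j q * kG l1 l2 i k e q) = (\<Sum>e\<in>midx M. kG l1 l2 i k e q * traceG l1 l2 e q)" .
  have 2: "(\<Sum>j\<in>midx M. \<Sum>e\<in>midx M. kG l1 l2 i e j q * kG l1 l2 j k e q) = (\<Sum>e\<in>midx M. \<Sum>j\<in>midx M. kG l1 l2 i e j q * kG l1 l2 j k e q)"
    by (rule sum.swap)
  show ?thesis unfolding MC.ricci_coeff_def curv_coeff_def sum.distrib sum_subtractf 1 2 by simp
qed

lemma pd_hub: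
  assumes q: "q \<in> U" and k: "k \<in> midx M"
  shows "pd k q (\<lambda>r. hubble i (fst r) - e) = (if k = None then hubble' i (fst q) else 0)"
  by (rule pd_time[OF q hubble_smooth_near[OF q] _ k]) (auto intro!: derivative_eq_intros hubble_deriv[OF U_D(1)[OF q]])

text \<open>The time-fibre case is written with \<open>- 0\<close> so that the single rule
  \<open>pd_hub\<close> differentiates both kinds of mixed coefficients.\<close>

lemma kG_funs:
  "kG l1 l2 None None None = (\<lambda>r. l2 - l1)"
  "kG l1 l2 None None (Some x) = (\<lambda>r. 0)"
  "kG l1 l2 None (Some x) None = (\<lambda>r. 0)"
  "kG l1 l2 (Some x) None None = (\<lambda>r. 0)"
  "kG l1 l2 None (Some x) (Some y) = (\<lambda>r. if y = x then hubble (fst x) (fst r) - 0 else 0)"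
  "kG l1 l2 (Some x) None (Some y) = (\<lambda>r. if y = x then hubble (fst x) (fst r) - l1 else 0)"
  "kG l1 l2 (Some (i, a)) (Some (j, b)) None = (\<lambda>r. if i = j then (hubble i (fst r) - l2) * \<phi> (fst r) powr (2 * p i) * gF i a b (snd r i) else 0)"
  "kG l1 l2 (Some (i, a)) (Some (j, b)) (Some (n, d)) = (\<lambda>r. if i = j \<and> n = i then \<Gamma> i a b d (snd r i) else 0)"
  by (auto simp: kG_def fun_eq_iff split: prod.splits)

lemma pd_if_zero: "q \<in> U \<Longrightarrow> k \<in> midx M \<Longrightarrow> pd k q (\<lambda>r. if P then f r else 0) = (if P then pd k q f else 0)"
  by (cases P) (simp_all add: coord_vec_const)

text \<open>The square of \<open>l2 - l1\<close> occurs in both quadratic terms and cancels; what is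
  left is a sum over the fibres weighted by their dimensions.\<close>

lemma ricci_None_None:
  assumes q: "q \<in> U"
  shows "MC.ricci_coeff (kG l1 l2) None None q =
     (\<Sum>n=1..m. real (card (midx (F n))) * (hubble' n (fst q) + (hubble n (fst q) - l1) * (hubble n (fst q) - l2 + l1)))"
proof -
  have D1: "(\<Sum>j\<in>midx M. pd None q (kG l1 l2 j None j)) = (\<Sum>n=1..m. real (card (midx (F n))) * hubble' n (fst q))"
    unfolding sum_idx by (simp add: kG_funs coord_vec_const[OF q] pd_hub[OF q])
  have D2: "(\<Sum>j\<in>midx M. pd j q (kG l1 l2 None None j)) = 0"
  proof (rule sum.neutral, rule ballI)
    show "pd j q (kG l1 l2 None None j) = 0" if "j \<in> midx M" for j
      by (cases j) (use coord_vec_const[OF q that] in \<open>simp_all add: kG_funs\<close>)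
  qed
  have S: "(\<Sum>e\<in>midx M. \<Sum>j\<in>midx M. kG l1 l2 None e j q * kG l1 l2 j None e q) =
      (l2 - l1)\<^sup>2 + (\<Sum>n=1..m. real (card (midx (F n))) * (hubble n (fst q) * (hubble n (fst q) - l1)))"
  proof -
    have "(\<Sum>n=1..m. \<Sum>a\<in>midx (F n). \<Sum>j\<in>midx M. kG l1 l2 None (Some (n, a)) j q * kG l1 l2 j None (Some (n, a)) q) =
      (\<Sum>n=1..m. \<Sum>a\<in>midx (F n). hubble n (fst q) * (hubble n (fst q) - l1))"
      by (intro sum.cong refl) (simp only: kG_contract(2), simp add: kG_def)
    then show ?thesis unfolding sum_idx[of "\<lambda>e. \<Sum>j\<in>midx M. _ e j"] kG_contract(1)
      by (simp add: kG_def power2_eq_square)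
  qed
  show ?thesis unfolding ricci_split D1 D2 S kG_contract(1) traceG_None
    by (simp add: sum.distrib[symmetric] sum_subtractf[symmetric] sum_distrib_left power2_eq_square algebra_simps)
qed

text \<open>Both quadratic terms are the same multiple of \<open>traceG\<close>, so the fibre
  coefficients cancel without being known.\<close>

lemma ricci_None_Some:
  assumes q: "q \<in> U" and i: "i \<in> {1..m}" "a \<in> midx (F i)"
  shows "MC.ricci_coeff (kG l1 l2) None (Some (i, a)) q = 0"
proof -
  have G0: "pd None q (\<lambda>r. \<Gamma> i d a d (snd r i)) = 0" if "d \<in> midx (F i)" for d
    using pd_pullback[OF q i(1) \<Gamma>_near[OF i(1) U_D(2)[OF q i(1)] that i(2) that] None_in_idx] by simp
  have D1: "(\<Sum>j\<in>midx M. pd None q (kG l1 l2 j (Some (i, a)) j)) = 0"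
  proof (rule sum.neutral, rule ballI)
    fix j assume j: "j \<in> midx M"
    show "pd None q (kG l1 l2 j (Some (i, a)) j) = 0"
    proof (cases j)
      case (Some nd)
      then show ?thesis using G0 j by (cases nd) (auto simp: kG_funs pd_if_zero[OF q])
    qed (simp add: kG_funs coord_vec_const[OF q])
  qed
  have D2: "(\<Sum>j\<in>midx M. pd j q (kG l1 l2 None (Some (i, a)) j)) = 0"
  proof (rule sum.neutral, rule ballI)
    fix j assume j: "j \<in> midx M"
    show "pd j q (kG l1 l2 None (Some (i, a)) j) = 0"
    proof (cases j)
      case (Some nd)
      then show ?thesis using pd_hub[OF q j, of _ 0] j by (auto simp: kG_funs pd_if_zero[OF q])
    qed (use coord_vec_const[OF q j] in \<open>simp add: kG_funs\<close>)
  qed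
  have S: "(\<Sum>e\<in>midx M. \<Sum>j\<in>midx M. kG l1 l2 None e j q * kG l1 l2 j (Some (i, a)) e q) =
      hubble i (fst q) * traceG l1 l2 (Some (i, a)) q"
  proof -
    have "(\<Sum>n=1..m. \<Sum>b\<in>midx (F n). \<Sum>j\<in>midx M. kG l1 l2 None (Some (n, b)) j q * kG l1 l2 j (Some (i, a)) (Some (n, b)) q) =
      (\<Sum>n=1..m. \<Sum>b\<in>midx (F n). if n = i then hubble n (fst q) * \<Gamma> n b a b (snd q n) else 0)"
      by (intro sum.cong refl) (simp only: kG_contract(2), simp add: kG_def)
    then show ?thesis unfolding sum_idx[of "\<lambda>e. \<Sum>j\<in>midx M. _ e j"] kG_contract(1) traceG_Some[OF i(1)] sum_single_block[OF i(1)]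
      by (simp add: kG_def sum_distrib_left)
  qed
  show ?thesis unfolding ricci_split D1 D2 S kG_contract(2)[OF i] by simp
qed

text \<open>Quarter-symmetric coefficients are not symmetric, so this order of arguments needs its
  own computation; symmetry of \<Gamma> turns the contraction over the second lower index into
  \<open>traceG\<close>.\<close>

lemma ricci_Some_None:
  assumes q: "q \<in> U" and i: "i \<in> {1..m}" "a \<in> midx (F i)"
  shows "MC.ricci_coeff (kG l1 l2) (Some (i, a)) None q = 0"
proof -
  have ik: "Some (i, a) \<in> midx M" using i by simp
  have D1: "(\<Sum>j\<in>midx M. pd (Some (i, a)) q (kG l1 l2 j None j)) = 0"
  proof (rule sum.neutral, rule ballI)
    fix j assume j: "j \<in> midx M"
    show "pd (Some (i, a)) q (kG l1 l2 j None j) = 0"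
      by (cases j) (simp_all add: kG_funs coord_vec_const[OF q ik] pd_hub[OF q ik])
  qed
  have D2: "(\<Sum>j\<in>midx M. pd j q (kG l1 l2 (Some (i, a)) None j)) = 0"
  proof (rule sum.neutral, rule ballI)
    fix j assume j: "j \<in> midx M"
    show "pd j q (kG l1 l2 (Some (i, a)) None j) = 0"
    proof (cases j)
      case (Some nd)
      then show ?thesis using pd_hub[OF q j, of _ l1] j by (auto simp: kG_funs pd_if_zero[OF q])
    qed (use coord_vec_const[OF q j] in \<open>simp add: kG_funs\<close>)
  qed
  have S: "(\<Sum>e\<in>midx M. \<Sum>j\<in>midx M. kG l1 l2 (Some (i, a)) e j q * kG l1 l2 j None e q) =
      (hubble i (fst q) - l1) * traceG l1 l2 (Some (i, a)) q"
  proof -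
    have "(\<Sum>j\<in>midx M. kG l1 l2 (Some (i, a)) (Some (n, b)) j q * kG l1 l2 j None (Some (n, b)) q) =
       (if n = i then (hubble i (fst q) - l1) * \<Gamma> n a b b (snd q n) else 0)" if "n \<in> {1..m}" "b \<in> midx (F n)" for n b
    proof (cases "i = n")
      case True
      have "(\<Sum>d\<in>midx (F i). \<Gamma> i a b d (snd q i) * kG l1 l2 (Some (i, d)) None (Some (n, b)) q) =
          (\<Sum>d\<in>midx (F i). if d = b then \<Gamma> i a b d (snd q i) * (hubble i (fst q) - l1) else 0)"
        by (intro sum.cong refl) (auto simp: kG_def True)
      also have "\<dots> = \<Gamma> i a b b (snd q i) * (hubble i (fst q) - l1)"
        using that finite_F[OF i(1)] True by simp
      finally show ?thesis unfolding kG_contract(4)[OF i(1)] using True by (simp add: kG_def)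
    next
      case False
      then show ?thesis unfolding kG_contract(4)[OF i(1)] by auto
    qed
    then have "(\<Sum>n=1..m. \<Sum>b\<in>midx (F n). \<Sum>j\<in>midx M. kG l1 l2 (Some (i, a)) (Some (n, b)) j q * kG l1 l2 j None (Some (n, b)) q) =
      (\<Sum>n=1..m. \<Sum>b\<in>midx (F n). if n = i then (hubble i (fst q) - l1) * \<Gamma> n a b b (snd q n) else 0)"
      by (intro sum.cong refl)
    also have "\<dots> = (\<Sum>b\<in>midx (F i). (hubble i (fst q) - l1) * \<Gamma> i b a b (snd q i))"
      unfolding sum_single_block[OF i(1)] using \<Gamma>_sym[OF i(1) U_D(2)[OF q i(1)] i(2)] by (intro sum.cong refl) simp
    finally show ?thesis unfolding sum_idx[of "\<lambda>e. \<Sum>j\<in>midx M. _ e j"] kG_contract(3)[OF i] traceG_Some[OF i(1)]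
      by (simp add: kG_def sum_distrib_left)
  qed
  show ?thesis unfolding ricci_split D1 D2 S kG_contract(3)[OF i] by simp
qed

text \<open>The contribution of the warping to the \<open>i\<close>-th diagonal block, as a multiple
  of the warped metric.\<close>

definition warp_ricci :: "real \<Rightarrow> real \<Rightarrow> nat \<Rightarrow> real \<Rightarrow> real" where
  "warp_ricci l1 l2 i t = - hubble' i t - l2 * hubble i t + l2\<^sup>2
     - (hubble i t - l2) * (\<Sum>n=1..m. real (card (midx (F n))) * (hubble n t - l1))"

text \<open>Terms with fibre indices only reassemble into the Ricci coefficients of
  \<open>F i\<close>; the remaining ones pass through a time index and all carry the factor
  \<open>\<phi> powr (2 * p i)\<close> times the fibre metric.\<close>

lemma ricci_Some_Some:
  assumes q: "q \<in> U" and i: "i \<in> {1..m}" "a \<in> midx (F i)" and n: "n \<in> {1..m}" "b \<in> midx (F n)"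
  shows "MC.ricci_coeff (kG l1 l2) (Some (i, a)) (Some (n, b)) q =
     (if i = n then metric_chart.ricci_coeff (F i) (UF i) (cF i) (\<Gamma> i) a b (snd q i) +
         \<phi> (fst q) powr (2 * p i) * gF i a b (snd q i) * warp_ricci l1 l2 i (fst q) else 0)"
proof (cases "i = n")
  case True
  have b: "b \<in> midx (F i)" using n True by simp
  interpret X: metric_chart "F i" "UF i" "cF i" by (rule F_metric_chart[OF i(1)])
  note z = U_D(2)[OF q i(1)]
  have ik: "Some (i, a) \<in> midx M" using i by simp
  let ?h = "hubble i (fst q)" and ?w = "\<phi> (fst q) powr (2 * p i) * gF i a b (snd q i)"
  have Gpd: "pd k q (\<lambda>r. \<Gamma> i d e d' (snd r i)) = (case k of None \<Rightarrow> 0 | Some (j, a) \<Rightarrow> if j = i then pdF i a (snd q i) (\<Gamma> i d e d') else 0)"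
    if "k \<in> midx M" "d \<in> midx (F i)" "e \<in> midx (F i)" "d' \<in> midx (F i)" for k d e d'
    by (rule pd_pullback[OF q i(1) \<Gamma>_near[OF i(1) z that(2-4)] that(1)])
  have D1: "(\<Sum>j\<in>midx M. pd (Some (i, a)) q (kG l1 l2 j (Some (i, b)) j)) = (\<Sum>d\<in>midx (F i). pdF i a (snd q i) (\<Gamma> i d b d))"
  proof -
    have "(\<Sum>n=1..m. \<Sum>d\<in>midx (F n). pd (Some (i, a)) q (kG l1 l2 (Some (n, d)) (Some (i, b)) (Some (n, d)))) =
       (\<Sum>n=1..m. \<Sum>d\<in>midx (F n). if n = i then pdF i a (snd q i) (\<Gamma> i d b d) else 0)"
      by (intro sum.cong refl) (auto simp: kG_funs pd_if_zero[OF q ik] Gpd[OF ik _ b])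
    then show ?thesis unfolding sum_idx sum_single_block[OF i(1)] by (simp add: kG_funs coord_vec_const[OF q ik])
  qed
  have D2: "(\<Sum>j\<in>midx M. pd j q (kG l1 l2 (Some (i, a)) (Some (i, b)) j)) =
     (hubble' i (fst q) + 2 * ?h * (?h - l2)) * ?w + (\<Sum>d\<in>midx (F i). pdF i d (snd q i) (\<Gamma> i a b d))"
  proof -
    have "(\<Sum>n=1..m. \<Sum>d\<in>midx (F n). pd (Some (n, d)) q (kG l1 l2 (Some (i, a)) (Some (i, b)) (Some (n, d)))) =
       (\<Sum>n=1..m. \<Sum>d\<in>midx (F n). if n = i then pdF i d (snd q i) (\<Gamma> i a b d) else 0)"
    proof (intro sum.cong refl)
      fix n d assume nd: "n \<in> {1..m}" "d \<in> midx (F n)"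
      then have k: "Some (n, d) \<in> midx M" by simp
      show "pd (Some (n, d)) q (kG l1 l2 (Some (i, a)) (Some (i, b)) (Some (n, d))) = (if n = i then pdF i d (snd q i) (\<Gamma> i a b d) else 0)"
        using Gpd[OF k i(2) b, of d] nd by (auto simp: kG_funs pd_if_zero[OF q k])
    qed
    moreover have "pd None q (kG l1 l2 (Some (i, a)) (Some (i, b)) None) = (hubble' i (fst q) + 2 * ?h * (?h - l2)) * ?w"
    proof -
      have h: "((\<lambda>t. (hubble i t - l2) * \<phi> t powr (2 * p i)) has_real_derivative
          hubble' i (fst q) * \<phi> (fst q) powr (2 * p i) + (?h - l2) * (2 * ?h * \<phi> (fst q) powr (2 * p i))) (at (fst q))"
        by (rule DERIV_cong[OF DERIV_mult[OF DERIV_diff[OF hubble_deriv[OF U_D(1)[OF q]] DERIV_const] warp_deriv[OF U_D(1)[OF q]]]])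
           simp
      have s: "smooth_near M q (\<lambda>r. (hubble i (fst r) - l2) * \<phi> (fst r) powr (2 * p i))"
        by (rule M.smooth_near_mult[OF hubble_smooth_near[OF q] \<phi>_smooth_near[OF q]])
      have "pd None q (\<lambda>r. (hubble i (fst r) - l2) * \<phi> (fst r) powr (2 * p i) * gF i a b (snd r i)) =
          (hubble' i (fst q) * \<phi> (fst q) powr (2 * p i) + (?h - l2) * (2 * ?h * \<phi> (fst q) powr (2 * p i))) * gF i a b (snd q i)"
        using pd_product[OF q s h i(1) gF_near[OF i(1) z i(2) b] None_in_idx] by simp
      then show ?thesis by (simp add: kG_funs algebra_simps)
    qed
    ultimately show ?thesis unfolding sum_idx sum_single_block[OF i(1)] by simp
  qed
  \<comment> \<open>The two terms with \<open>?h\<close> come from a time index in the contraction,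
    once as \<open>e\<close> and once as \<open>j\<close>.\<close>
  have S: "(\<Sum>e\<in>midx M. \<Sum>j\<in>midx M. kG l1 l2 (Some (i, a)) e j q * kG l1 l2 j (Some (i, b)) e q) =
      (?h - l1) * (?h - l2) * ?w + (?h - l2) * ?h * ?w
        + (\<Sum>e\<in>midx (F i). \<Sum>d\<in>midx (F i). \<Gamma> i a e d (snd q i) * \<Gamma> i d b e (snd q i))"
  proof -
    have "(\<Sum>j\<in>midx M. kG l1 l2 (Some (i, a)) (Some (n, e)) j q * kG l1 l2 j (Some (i, b)) (Some (n, e)) q) =
       (if n = i then (if e = b then (?h - l2) * ?h * ?w else 0)
          + (\<Sum>d\<in>midx (F i). \<Gamma> i a e d (snd q i) * \<Gamma> i d b e (snd q i)) else 0)" if "n \<in> {1..m}" for n e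
      unfolding kG_contract(4)[OF i(1)] by (auto simp: kG_def intro!: sum.cong)
    then have "(\<Sum>n=1..m. \<Sum>e\<in>midx (F n). \<Sum>j\<in>midx M. kG l1 l2 (Some (i, a)) (Some (n, e)) j q * kG l1 l2 j (Some (i, b)) (Some (n, e)) q) =
      (\<Sum>n=1..m. \<Sum>e\<in>midx (F n). if n = i then (if e = b then (?h - l2) * ?h * ?w else 0)
          + (\<Sum>d\<in>midx (F i). \<Gamma> i a e d (snd q i) * \<Gamma> i d b e (snd q i)) else 0)"
      by (intro sum.cong refl)
    also have "\<dots> = (?h - l2) * ?h * ?w + (\<Sum>e\<in>midx (F i). \<Sum>d\<in>midx (F i). \<Gamma> i a e d (snd q i) * \<Gamma> i d b e (snd q i))"
      unfolding sum_single_block[OF i(1)] sum.distrib using finite_F[OF i(1)] b by simp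
    finally show ?thesis unfolding sum_idx[of "\<lambda>e. \<Sum>j\<in>midx M. _ e j"] kG_contract(3)[OF i]
      by (simp add: kG_def)
  qed
  have T: "(\<Sum>e\<in>midx M. kG l1 l2 (Some (i, a)) (Some (i, b)) e q * traceG l1 l2 e q) =
      (?h - l2) * ?w * traceG l1 l2 None q + (\<Sum>e\<in>midx (F i). \<Gamma> i a b e (snd q i) * (\<Sum>d\<in>midx (F i). \<Gamma> i d e d (snd q i)))"
    unfolding kG_contract(4)[OF i(1)] by (simp add: traceG_Some[OF i(1)])
  have R: "X.ricci_coeff (\<Gamma> i) a b (snd q i) =
     (\<Sum>d\<in>midx (F i). pdF i a (snd q i) (\<Gamma> i d b d)) - (\<Sum>d\<in>midx (F i). pdF i d (snd q i) (\<Gamma> i a b d))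
     + (\<Sum>e\<in>midx (F i). \<Sum>d\<in>midx (F i). \<Gamma> i a e d (snd q i) * \<Gamma> i d b e (snd q i))
     - (\<Sum>e\<in>midx (F i). \<Gamma> i a b e (snd q i) * (\<Sum>d\<in>midx (F i). \<Gamma> i d e d (snd q i)))"
  proof -
    have 1: "(\<Sum>d\<in>midx (F i). \<Sum>e\<in>midx (F i). \<Gamma> i d e d (snd q i) * \<Gamma> i a b e (snd q i)) =
        (\<Sum>e\<in>midx (F i). \<Gamma> i a b e (snd q i) * (\<Sum>d\<in>midx (F i). \<Gamma> i d e d (snd q i)))"
      by (subst sum.swap) (simp add: sum_distrib_left mult.commute)
    have 2: "(\<Sum>d\<in>midx (F i). \<Sum>e\<in>midx (F i). \<Gamma> i a e d (snd q i) * \<Gamma> i d b e (snd q i)) =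
        (\<Sum>e\<in>midx (F i). \<Sum>d\<in>midx (F i). \<Gamma> i a e d (snd q i) * \<Gamma> i d b e (snd q i))"
      by (rule sum.swap)
    show ?thesis unfolding X.ricci_coeff_def X.curv_coeff_def sum.distrib sum_subtractf 1 2 by simp
  qed
  show ?thesis unfolding True[symmetric] ricci_split D1 D2 S T traceG_None R warp_ricci_def
    by (simp add: algebra_simps power2_eq_square)
next
  case False
  have ik: "Some (i, a) \<in> midx M" using i by simp
  note z = U_D(2)[OF q n(1)]
  have D1: "(\<Sum>j\<in>midx M. pd (Some (i, a)) q (kG l1 l2 j (Some (n, b)) j)) = 0"
  proof (rule sum.neutral, rule ballI)
    fix j assume j: "j \<in> midx M"
    show "pd (Some (i, a)) q (kG l1 l2 j (Some (n, b)) j) = 0"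
    proof (cases j)
      case (Some nd)
      obtain n' d where nd: "nd = (n', d)" by (cases nd)
      show ?thesis
      proof (cases "n' = n")
        case True
        have d: "d \<in> midx (F n)" using j Some nd True by simp
        show ?thesis using pd_pullback[OF q n(1) \<Gamma>_near[OF n(1) z d n(2) d] ik] False True by (simp add: kG_funs Some nd)
      next
        case False
        then show ?thesis by (simp add: kG_funs Some nd coord_vec_const[OF q ik])
      qed
    qed (simp add: kG_funs coord_vec_const[OF q ik])
  qed
  have D2: "(\<Sum>j\<in>midx M. pd j q (kG l1 l2 (Some (i, a)) (Some (n, b)) j)) = 0"
  proof (rule sum.neutral, rule ballI)
    fix j assume j: "j \<in> midx M"
    have "kG l1 l2 (Some (i, a)) (Some (n, b)) j = (\<lambda>r. 0)" using False by (cases j) (auto simp: kG_def fun_eq_iff)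
    then show "pd j q (kG l1 l2 (Some (i, a)) (Some (n, b)) j) = 0" using coord_vec_const[OF q j] by simp
  qed
  have S: "(\<Sum>e\<in>midx M. \<Sum>j\<in>midx M. kG l1 l2 (Some (i, a)) e j q * kG l1 l2 j (Some (n, b)) e q) = 0"
  proof (rule sum.neutral, rule ballI)
    fix e assume e: "e \<in> midx M"
    show "(\<Sum>j\<in>midx M. kG l1 l2 (Some (i, a)) e j q * kG l1 l2 j (Some (n, b)) e q) = 0"
    proof (cases e)
      case None
      show ?thesis unfolding None kG_contract(3)[OF i] using False by (simp add: kG_def)
    next
      case (Some nd)
      obtain n' d where nd: "nd = (n', d)" by (cases nd)
      show ?thesis unfolding Some nd kG_contract(4)[OF i(1)] using False by (simp add: kG_def)
    qed
  qed
  show ?thesis unfolding ricci_split D1 D2 S kG_contract(4)[OF i(1)] using False by simp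
qed

lemma nabla_bracket:
  "V \<subseteq> U \<Longrightarrow> smooth_field_on M V X \<Longrightarrow> smooth_field_on M V Y \<Longrightarrow> smooth_field_on M V (lie_bracket M X Y)"
  by (rule MC.levi_civita_bracket_smooth[OF nabla])

end

section \<open>The Einstein condition\<close>

context kasner_connection
begin

lemma F_einstein_coeffs:
  assumes i: "i \<in> {1..m}" and E: "einstein (F i) (nablaF i) \<beta>" and z: "z \<in> UF i"
    and ab: "a \<in> midx (F i)" "b \<in> midx (F i)"
  shows "metric_chart.ricci_coeff (F i) (UF i) (cF i) (\<Gamma> i) a b z = \<beta> * gF i a b z"
proof -
  interpret X: metric_chart "F i" "UF i" "cF i" by (rule F_metric_chart[OF i])
  show ?thesis
    using X.einstein_coeffs[OF \<Gamma>_coeffs[OF i] X.levi_civita_bracket_smooth[OF nablaF[OF i]] E z ab]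
    by (simp add: gF_def)
qed

lemma F_ricci_eq_metric:
  assumes i: "i \<in> {1..m}" and z: "z \<in> UF i" "z \<in> W"
    and R: "\<And>a b. a \<in> midx (F i) \<Longrightarrow> b \<in> midx (F i) \<Longrightarrow>
      metric_chart.ricci_coeff (F i) (UF i) (cF i) (\<Gamma> i) a b z = \<beta> * gF i a b z"
    and X: "smooth_field_on (F i) W X" and Y: "smooth_field_on (F i) W Y"
  shows "ricci (F i) (nablaF i) X Y z = \<beta> * mmetric (F i) z (X z) (Y z)"
proof -
  interpret X: metric_chart "F i" "UF i" "cF i" by (rule F_metric_chart[OF i])
  have R': "X.ricci_coeff (\<Gamma> i) a b z = \<beta> * X.gm a b z" if "a \<in> midx (F i)" "b \<in> midx (F i)" for a b
    using R[OF that] by (simp add: gF_def)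
  show ?thesis
    by (rule X.ricci_eq_metric[OF \<Gamma>_coeffs[OF i] X.levi_civita_bracket_smooth[OF nablaF[OF i]] R' X Y z(2,1)])
qed

text \<open>Provides a nonzero entry to cancel when two multiples of the fibre metric are
  compared.\<close>

lemma gF_pos:
  assumes i: "i \<in> {1..m}" and z: "z \<in> UF i" and a: "a \<in> midx (F i)"
  shows "gF i a a z > 0"
proof -
  interpret X: metric_chart "F i" "UF i" "cF i" by (rule F_metric_chart[OF i])
  have "pdF i a z (\<lambda>w. cF i w a) = 1" using X.coord_vec_crd[OF z a a] by simp
  then have "pdF i a z \<noteq> (\<lambda>f. 0)" by (metis (full_types) zero_neq_one)
  moreover have "pdF i a z \<in> tangent_space (F i) z" using X.coord_vec_tangent[OF z a] by simp
  moreover have "z \<in> topspace (mtop (F i))" by (rule X.U_topspace[OF z])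
  moreover have "\<forall>q\<in>topspace (mtop (F i)). \<forall>u\<in>tangent_space (F i) q. u \<noteq> (\<lambda>f. 0) \<longrightarrow> mmetric (F i) q u u > 0"
    using F_riemannian[OF i] unfolding riemannian_manifold_def by (elim conjE)
  ultimately show ?thesis unfolding gF_def by blast
qed

text \<open>The right-hand side is \<open>- \<alpha>\<close> because the metric is -1 on the time
  field.\<close>

definition time_eq :: "real \<Rightarrow> real \<Rightarrow> real \<Rightarrow> real \<Rightarrow> bool" where
  "time_eq l1 l2 \<alpha> t \<longleftrightarrow>
     (\<Sum>n=1..m. real (card (midx (F n))) * (hubble' n t + (hubble n t - l1) * (hubble n t - l2 + l1))) = - \<alpha>"

lemma einstein_M_D:
  assumes E: "einstein M (quarter_symmetric M (time_field M) l1 l2 nabla) \<alpha>" and q: "q \<in> U"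
  shows "time_eq l1 l2 \<alpha> (fst q)"
    and "i \<in> {1..m} \<Longrightarrow> a \<in> midx (F i) \<Longrightarrow> b \<in> midx (F i) \<Longrightarrow>
      metric_chart.ricci_coeff (F i) (UF i) (cF i) (\<Gamma> i) a b (snd q i) =
        (\<alpha> - warp_ricci l1 l2 i (fst q)) * \<phi> (fst q) powr (2 * p i) * gF i a b (snd q i)"
proof -
  have D: "MC.ricci_coeff (kG l1 l2) i j q = \<alpha> * MC.gm i j q" if "i \<in> midx M" "j \<in> midx M" for i j
    by (rule MC.einstein_coeffs[OF quarter_coeffs nabla_bracket E q that])
  show "time_eq l1 l2 \<alpha> (fst q)"
    using D[OF None_in_idx None_in_idx] unfolding ricci_None_None[OF q] gm_M(1)[OF q] time_eq_def by simp
  show "metric_chart.ricci_coeff (F i) (UF i) (cF i) (\<Gamma> i) a b (snd q i) =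
        (\<alpha> - warp_ricci l1 l2 i (fst q)) * \<phi> (fst q) powr (2 * p i) * gF i a b (snd q i)"
    if i: "i \<in> {1..m}" and ab: "a \<in> midx (F i)" "b \<in> midx (F i)"
  proof -
    have "Some (i, a) \<in> midx M" "Some (i, b) \<in> midx M" using i ab by simp_all
    from D[OF this] show ?thesis
      unfolding ricci_Some_Some[OF q i ab(1) i ab(2)] gm_M(4)[OF q i ab(1) i ab(2)] by (simp add: algebra_simps)
  qed
qed

text \<open>The converse of \<open>einstein_M_D\<close> at a single point: the two conditions settle
  the diagonal blocks, and in all other blocks both sides vanish.\<close>

lemma ricci_M_eq_metric:
  assumes q: "q \<in> U" "q \<in> W" and t: "time_eq l1 l2 \<alpha> (fst q)"
    and F: "\<And>i a b. i \<in> {1..m} \<Longrightarrow> a \<in> midx (F i) \<Longrightarrow> b \<in> midx (F i) \<Longrightarrow>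
      metric_chart.ricci_coeff (F i) (UF i) (cF i) (\<Gamma> i) a b (snd q i) =
        (\<alpha> - warp_ricci l1 l2 i (fst q)) * \<phi> (fst q) powr (2 * p i) * gF i a b (snd q i)"
    and X: "smooth_field_on M W X" and Y: "smooth_field_on M W Y"
  shows "ricci M (quarter_symmetric M (time_field M) l1 l2 nabla) X Y q = \<alpha> * mmetric M q (X q) (Y q)"
proof (rule MC.ricci_eq_metric[OF quarter_coeffs nabla_bracket _ X Y q(2,1)])
  fix i j assume i: "i \<in> midx M" and j: "j \<in> midx M"
  show "MC.ricci_coeff (kG l1 l2) i j q = \<alpha> * MC.gm i j q"
  proof (cases i)
    case iN: None
    show ?thesis
    proof (cases j)
      case None
      show ?thesis unfolding iN None ricci_None_None[OF q(1)] gm_M(1)[OF q(1)] using t by (simp add: time_eq_def)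
    next
      case (Some nb)
      obtain n b where nb: "nb = (n, b)" by (cases nb)
      have n: "n \<in> {1..m}" "b \<in> midx (F n)" using j Some nb by auto
      show ?thesis unfolding iN Some nb ricci_None_Some[OF q(1) n] gm_M(2)[OF q(1) n] by simp
    qed
  next
    case (Some ma)
    obtain n' a where ma: "ma = (n', a)" by (cases ma)
    have n': "n' \<in> {1..m}" "a \<in> midx (F n')" using i Some ma by auto
    show ?thesis
    proof (cases j)
      case None
      show ?thesis unfolding Some None ma ricci_Some_None[OF q(1) n'] gm_M(3)[OF q(1) n'] by simp
    next
      case S2: (Some nb)
      obtain n b where nb: "nb = (n, b)" by (cases nb)
      have n: "n \<in> {1..m}" "b \<in> midx (F n)" using j S2 nb by auto
      show ?thesis
      proof (cases "n' = n")
        case True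
        then have b: "b \<in> midx (F n')" using n by simp
        show ?thesis unfolding Some S2 ma nb ricci_Some_Some[OF q(1) n' n] gm_M(4)[OF q(1) n' n]
          using F[OF n' b] by (simp add: True algebra_simps)
      next
        case False
        then show ?thesis unfolding Some S2 ma nb ricci_Some_Some[OF q(1) n' n] gm_M(4)[OF q(1) n' n] by simp
      qed
    qed
  qed
qed

context
  fixes l :: "nat \<Rightarrow> nat" and \<zeta> \<eta> N :: real
  assumes l: "i \<in> {1..m} \<Longrightarrow> card (midx (F i)) = l i"
    and \<zeta>: "\<zeta> = (\<Sum>i=1..m. real (l i) * p i)" and \<eta>: "\<eta> = (\<Sum>i=1..m. real (l i) * (p i)\<^sup>2)"
    and N: "N = (\<Sum>i=1..m. real (l i))"
begin

text \<open>Each summand is a combination of \<open>p n\<close>, its square and 1; weighting by the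
  fibre dimensions turns these into \<zeta>, \<eta> and \<open>N\<close>, the last becoming
  \<open>nbar - 1\<close> in the theorem.\<close>

lemma time_eq_iff:
  "time_eq lam1 lam2 \<alpha> t \<longleftrightarrow>
     \<zeta> * (lam2 * (deriv \<phi> t / \<phi> t) - deriv (deriv \<phi>) t / \<phi> t)
               - (\<eta> - \<zeta>) * ((deriv \<phi> t)\<^sup>2 / (\<phi> t)\<^sup>2)
               + (lam1\<^sup>2 - lam1 * lam2) * N = \<alpha>"
proof -
  define h s where hs: "h = deriv \<phi> t / \<phi> t" "s = deriv (deriv \<phi>) t / \<phi> t"
  have "(\<Sum>n=1..m. real (card (midx (F n))) * (hubble' n t + (hubble n t - lam1) * (hubble n t - lam2 + lam1))) =
    (\<Sum>n=1..m. real (l n) * p n * (s - h\<^sup>2 - lam2 * h) + real (l n) * (p n)\<^sup>2 * h\<^sup>2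
       + real (l n) * (lam1 * lam2 - lam1\<^sup>2))"
    by (intro sum.cong refl) (simp only: l hubble_def hubble'_def power_divide[symmetric] hs[symmetric],
        simp add: algebra_simps power2_eq_square)
  also have "\<dots> = \<zeta> * (s - h\<^sup>2 - lam2 * h) + \<eta> * h\<^sup>2 + N * (lam1 * lam2 - lam1\<^sup>2)"
    unfolding \<zeta> \<eta> N by (simp only: sum.distrib sum_distrib_right)
  finally show ?thesis unfolding time_eq_def power_divide[symmetric] hs[symmetric]
    by (simp only: algebra_simps) linarith
qed

text \<open>\<open>hubble\<close> is linear in the exponent, so the sum over the fibres involves
  only \<zeta> and \<open>N\<close>. The 1 in \<open>\<zeta> - 1\<close> stems from the squared
  logarithmic derivative inside \<open>hubble'\<close>.\<close>

lemma warp_ricci_eq: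
  "warp_ricci lam1 lam2 i t = - p i * (deriv (deriv \<phi>) t / \<phi> t)
               - (\<zeta> - 1) * p i * ((deriv \<phi> t)\<^sup>2 / (\<phi> t)\<^sup>2)
               + (lam2 * \<zeta> + (N * lam1 - lam2) * p i) * (deriv \<phi> t / \<phi> t)
               + lam2\<^sup>2 - N * lam1 * lam2"
proof -
  define h s where hs: "h = deriv \<phi> t / \<phi> t" "s = deriv (deriv \<phi>) t / \<phi> t"
  have "(\<Sum>n=1..m. real (card (midx (F n))) * (hubble n t - lam1)) = (\<Sum>n=1..m. real (l n) * p n * h - real (l n) * lam1)"
    by (intro sum.cong refl) (simp only: l hubble_def hs[symmetric], simp add: algebra_simps)
  also have "\<dots> = \<zeta> * h - N * lam1"
    unfolding \<zeta> N by (simp only: sum_subtractf sum_distrib_right)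
  finally have *: "(\<Sum>n=1..m. real (card (midx (F n))) * (hubble n t - lam1)) = \<zeta> * h - N * lam1" .
  show ?thesis
    unfolding warp_ricci_def *
    unfolding hubble_def hubble'_def power_divide[symmetric] hs[symmetric]
    by (simp add: algebra_simps power2_eq_square)
qed

end

end

section \<open>From charts to the whole space-time\<close>

context kasner_spacetime
begin

lemma fibre_nonempty:
  assumes i: "i \<in> {1..m}"
  shows "\<exists>z. z \<in> topspace (mtop (F i))"
  using F_riemannian[OF i] unfolding riemannian_manifold_def smooth_manifold_def by blast

text \<open>Time and a point of one fibre can be prescribed independently, which is what separation
  of variables rests on; the other fibres are filled by nonemptiness.\<close>

lemma point_exists:
  assumes t: "t \<in> I" and i: "i \<in> {1..m}" and z: "z \<in> topspace (mtop (F i))"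
  obtains q where "q \<in> topspace (mtop M)" "fst q = t" "snd q i = z"
proof -
  obtain x where x: "\<And>j. j \<in> {1..m} \<Longrightarrow> x j \<in> topspace (mtop (F j))" using fibre_nonempty by metis
  let ?q = "(t, \<lambda>j\<in>{1..m}. if j = i then z else x j)"
  have "?q \<in> topspace (mtop M)" unfolding topspace_M using t z x by auto
  with i show thesis by (intro that[of ?q]) auto
qed

end

context kasner_spacetime
begin

lemma connection_at:
  assumes "levi_civita M nabla" "\<And>i. i \<in> {1..m} \<Longrightarrow> levi_civita (F i) (nablaF i)" "q \<in> topspace (mtop M)"
  obtains C where "kasner_connection I \<phi> m p F C nabla nablaF" "q \<in> kasner_pre_chart.U I m C"
proof -
  obtain C where C: "kasner_chart I \<phi> m F C" "q \<in> kasner_pre_chart.U I m C"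
    using assms(3) by (rule chart_at)
  have "kasner_connection I \<phi> m p F C nabla nablaF"
    by (intro kasner_connection.intro kasner_connection_axioms.intro C(1) assms(1,2))
  then show thesis using C(2) by (rule that)
qed

text \<open>Coefficients belong to charts, the claim to whole manifolds: every point gets a chart of
  its own, and only functions of time and the Einstein constants are carried from one chart to
  another.\<close>

lemma einstein_iff:
  fixes l :: "nat \<Rightarrow> nat" and \<alpha> lam1 lam2 \<zeta> \<eta> N :: real
  assumes nabla: "levi_civita M nabla" and nablaF: "\<And>i. i \<in> {1..m} \<Longrightarrow> levi_civita (F i) (nablaF i)"
    and m: "1 \<le> m" and I: "I \<noteq> {}"
    and l: "\<And>i. i \<in> {1..m} \<Longrightarrow> card (midx (F i)) = l i" and l1: "\<And>i. i \<in> {1..m} \<Longrightarrow> l i \<ge> 1"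
    and \<zeta>: "\<zeta> = (\<Sum>i=1..m. real (l i) * p i)" and \<eta>: "\<eta> = (\<Sum>i=1..m. real (l i) * (p i)\<^sup>2)"
    and N: "N = (\<Sum>i=1..m. real (l i))"
  shows "einstein M (quarter_symmetric M (time_field M) lam1 lam2 nabla) \<alpha> \<longleftrightarrow>
    (\<exists>\<alpha>F :: nat \<Rightarrow> real. \<forall>i\<in>{1..m}.
       einstein (F i) (nablaF i) (\<alpha>F i) \<and>
       (\<forall>t\<in>I. \<zeta> * (lam2 * (deriv \<phi> t / \<phi> t) - deriv (deriv \<phi>) t / \<phi> t)
               - (\<eta> - \<zeta>) * ((deriv \<phi> t)\<^sup>2 / (\<phi> t)\<^sup>2)
               + (lam1\<^sup>2 - lam1 * lam2) * N = \<alpha>) \<and>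
       (\<forall>t\<in>I. \<alpha>F i / \<phi> t powr (2 * p i)
               - p i * (deriv (deriv \<phi>) t / \<phi> t)
               - (\<zeta> - 1) * p i * ((deriv \<phi> t)\<^sup>2 / (\<phi> t)\<^sup>2)
               + (lam2 * \<zeta> + (N * lam1 - lam2) * p i) * (deriv \<phi> t / \<phi> t)
             = \<alpha> - lam2\<^sup>2 + N * lam1 * lam2))"
    (is "einstein M ?D \<alpha> \<longleftrightarrow> (\<exists>\<alpha>F. \<forall>i\<in>{1..m}. einstein (F i) (nablaF i) (\<alpha>F i) \<and> (\<forall>t\<in>I. ?T t = \<alpha>) \<and> (\<forall>t\<in>I. ?S \<alpha>F i t = ?rhs))")
proof -
  \<comment> \<open>\<open>warp_ricci\<close> written without reference to a chart, so that it can
    be compared across points.\<close>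
  define w where "w i t = - p i * (deriv (deriv \<phi>) t / \<phi> t)
               - (\<zeta> - 1) * p i * ((deriv \<phi> t)\<^sup>2 / (\<phi> t)\<^sup>2)
               + (lam2 * \<zeta> + (N * lam1 - lam2) * p i) * (deriv \<phi> t / \<phi> t)
               + lam2\<^sup>2 - N * lam1 * lam2" for i t
  \<comment> \<open>The fibre condition solved for its constant; multiplying by the positive power
    of \<phi> is reversible.\<close>
  have S: "?S \<alpha>F i t = ?rhs \<longleftrightarrow> \<alpha>F i = (\<alpha> - w i t) * \<phi> t powr (2 * p i)" if "t \<in> I" for \<alpha>F :: "nat \<Rightarrow> real" and i t
  proof -
    have pos: "\<phi> t powr (2 * p i) > 0" using \<phi>_pos[OF that] by simp
    have "?S \<alpha>F i t = ?rhs \<longleftrightarrow> \<alpha>F i / \<phi> t powr (2 * p i) = \<alpha> - w i t"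
      unfolding w_def by (simp only: minus_mult_left[symmetric]) linarith
    then show ?thesis using pos by (simp add: divide_eq_eq)
  qed
  have point: "\<exists>C. kasner_connection I \<phi> m p F C nabla nablaF \<and> q \<in> kasner_pre_chart.U I m C"
    if q: "q \<in> topspace (mtop M)" for q
    by (rule connection_at[OF nabla _ q]) (use nablaF in blast)+
  show ?thesis
  proof
    assume E: "einstein M ?D \<alpha>"
    obtain t0 where t0: "t0 \<in> I" using I by blast
    \<comment> \<open>For every choice of time and fibre point the Einstein condition yields an
      equation on the fibre at that point, with time entering only through a scalar factor.\<close>
    have at: "?T t = \<alpha> \<and> (\<exists>C. kasner_connection I \<phi> m p F C nabla nablaF \<and> z \<in> fst (C i) \<and>
        (\<forall>a\<in>midx (F i). \<forall>b\<in>midx (F i).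
          metric_chart.ricci_coeff (F i) (fst (C i)) (snd (C i)) (kasner_connection.\<Gamma> F C nablaF i) a b z =
            (\<alpha> - w i t) * \<phi> t powr (2 * p i) * kasner_chart.gF F C i a b z))"
      if t: "t \<in> I" and i: "i \<in> {1..m}" and z: "z \<in> topspace (mtop (F i))" for t i z
    proof -
      obtain q where q: "q \<in> topspace (mtop M)" "fst q = t" "snd q i = z" using t i z by (rule point_exists)
      obtain C where C: "kasner_connection I \<phi> m p F C nabla nablaF" "q \<in> kasner_pre_chart.U I m C"
        using point[OF q(1)] by blast
      interpret C: kasner_connection I \<phi> m p F C nabla nablaF by (rule C(1))
      have teq: "C.time_eq lam1 lam2 \<alpha> t \<longleftrightarrow> ?T t = \<alpha>" for t
        by (rule C.time_eq_iff[OF l \<zeta> \<eta> N])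
      have weq: "C.warp_ricci lam1 lam2 i t = w i t" for i t
        unfolding w_def by (rule C.warp_ricci_eq[OF l \<zeta> \<eta> N])
      have "?T t = \<alpha>"
        using C.einstein_M_D(1)[OF E C(2)] unfolding q(2) teq .
      moreover have "z \<in> fst (C i)" using C.U_D(2)[OF C(2) i] q(3) by simp
      moreover note C.einstein_M_D(2)[OF E C(2) i, unfolded q(2,3) weq]
      ultimately show ?thesis using C(1) by blast
    qed
    \<comment> \<open>The scalar factor frozen at one instant. Every point of the fibre is reached
      at this instant, so it serves the whole fibre.\<close>
    define \<alpha>F where "\<alpha>F i = (\<alpha> - w i t0) * \<phi> t0 powr (2 * p i)" for i
    have EF: "einstein (F i) (nablaF i) (\<alpha>F i)" if i: "i \<in> {1..m}" for i
      unfolding einstein_def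
    proof (intro allI impI ballI)
      fix W X Y z assume XY: "smooth_field_on (F i) W X \<and> smooth_field_on (F i) W Y" and z: "z \<in> W"
      have "openin (mtop (F i)) W" using XY by (simp add: smooth_field_on_def)
      then have "z \<in> topspace (mtop (F i))" using z openin_subset by blast
      then obtain C where C: "kasner_connection I \<phi> m p F C nabla nablaF" "z \<in> fst (C i)"
          "\<forall>a\<in>midx (F i). \<forall>b\<in>midx (F i).
          metric_chart.ricci_coeff (F i) (fst (C i)) (snd (C i)) (kasner_connection.\<Gamma> F C nablaF i) a b z =
            \<alpha>F i * kasner_chart.gF F C i a b z"
        using at[OF t0 i] unfolding \<alpha>F_def by blast
      interpret C: kasner_connection I \<phi> m p F C nabla nablaF by (rule C(1))
      show "ricci (F i) (nablaF i) X Y z = \<alpha>F i * mmetric (F i) z (X z) (Y z)"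
        by (rule C.F_ricci_eq_metric[OF i C(2) z]) (use C(3) XY in blast)+
    qed
    have "?S \<alpha>F i t = ?rhs" if i: "i \<in> {1..m}" and t: "t \<in> I" for i t
    proof -
      obtain z where z: "z \<in> topspace (mtop (F i))" using fibre_nonempty[OF i] by blast
      obtain C where C: "kasner_connection I \<phi> m p F C nabla nablaF" "z \<in> fst (C i)"
          "\<forall>a\<in>midx (F i). \<forall>b\<in>midx (F i).
          metric_chart.ricci_coeff (F i) (fst (C i)) (snd (C i)) (kasner_connection.\<Gamma> F C nablaF i) a b z =
            (\<alpha> - w i t) * \<phi> t powr (2 * p i) * kasner_chart.gF F C i a b z"
        using at[OF t i z] by blast
      interpret C: kasner_connection I \<phi> m p F C nabla nablaF by (rule C(1))
      \<comment> \<open>Positive dimension supplies a coordinate field; its squared length is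
        positive, so cancelling it identifies the factor at \<open>t\<close> with the one at
        \<open>t0\<close>.\<close>
      obtain a where a: "a \<in> midx (F i)"
        using l[OF i] l1[OF i] by (metis card.empty equals0I not_one_le_zero)
      have "\<alpha>F i * C.gF i a a z = (\<alpha> - w i t) * \<phi> t powr (2 * p i) * C.gF i a a z"
        unfolding C.F_einstein_coeffs[OF i EF[OF i] C(2) a a, symmetric] using C(3) a by blast
      with C.gF_pos[OF i C(2) a] have "\<alpha>F i = (\<alpha> - w i t) * \<phi> t powr (2 * p i)" by simp
      with S[OF t] show ?thesis by blast
    qed
    \<comment> \<open>\<open>at\<close> delivers the time equation only together with a fibre and a
      point of it; \<open>1 \<le> m\<close> provides the fibre.\<close>
    moreover have "?T t = \<alpha>" if "t \<in> I" for t
      using at[OF that _ ] fibre_nonempty m by (metis atLeastAtMost_iff order_refl)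
    ultimately show "\<exists>\<alpha>F. \<forall>i\<in>{1..m}. einstein (F i) (nablaF i) (\<alpha>F i) \<and> (\<forall>t\<in>I. ?T t = \<alpha>) \<and> (\<forall>t\<in>I. ?S \<alpha>F i t = ?rhs)"
      using EF by blast
  next
    assume "\<exists>\<alpha>F. \<forall>i\<in>{1..m}. einstein (F i) (nablaF i) (\<alpha>F i) \<and> (\<forall>t\<in>I. ?T t = \<alpha>) \<and> (\<forall>t\<in>I. ?S \<alpha>F i t = ?rhs)"
    then obtain \<alpha>F where \<alpha>F: "\<forall>i\<in>{1..m}. einstein (F i) (nablaF i) (\<alpha>F i) \<and> (\<forall>t\<in>I. ?T t = \<alpha>) \<and> (\<forall>t\<in>I. ?S \<alpha>F i t = ?rhs)"
      by (rule exE)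
    have EF: "einstein (F i) (nablaF i) (\<alpha>F i)" if "i \<in> {1..m}" for i
      by (rule conjunct1[OF bspec[OF \<alpha>F that]])
    have T: "?T t = \<alpha>" if "t \<in> I" for t
    proof -
      \<comment> \<open>The time equation stands under the quantifier over the fibres, so one fibre
        is needed to extract it.\<close>
      have "1 \<in> {1..m}" using m by simp
      from bspec[OF conjunct1[OF conjunct2[OF bspec[OF \<alpha>F this]]] that] show ?thesis .
    qed
    have \<alpha>F_eq: "\<alpha>F i = (\<alpha> - w i t) * \<phi> t powr (2 * p i)" if i: "i \<in> {1..m}" and t: "t \<in> I" for i t
      using bspec[OF conjunct2[OF conjunct2[OF bspec[OF \<alpha>F i]]] t] unfolding S[OF t] .
    show "einstein M ?D \<alpha>"
      unfolding einstein_def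
    proof (intro allI impI ballI)
      fix W X Y q assume XY: "smooth_field_on M W X \<and> smooth_field_on M W Y" and q: "q \<in> W"
      have "openin (mtop M) W" using XY by (simp add: smooth_field_on_def)
      then have qM: "q \<in> topspace (mtop M)" using q openin_subset by blast
      obtain C where C: "kasner_connection I \<phi> m p F C nabla nablaF" "q \<in> kasner_pre_chart.U I m C"
        using point[OF qM] by blast
      interpret C: kasner_connection I \<phi> m p F C nabla nablaF by (rule C(1))
      have teq: "C.time_eq lam1 lam2 \<alpha> t \<longleftrightarrow> ?T t = \<alpha>" for t
        by (rule C.time_eq_iff[OF l \<zeta> \<eta> N])
      have weq: "C.warp_ricci lam1 lam2 i t = w i t" for i t
        unfolding w_def by (rule C.warp_ricci_eq[OF l \<zeta> \<eta> N])
      note t = C.U_D(1)[OF C(2)]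
      show "ricci M ?D X Y q = \<alpha> * mmetric M q (X q) (Y q)"
      proof (rule C.ricci_M_eq_metric[OF C(2) q])
        show "C.time_eq lam1 lam2 \<alpha> (fst q)"
          unfolding teq by (rule T[OF t])
        show "metric_chart.ricci_coeff (F i) (C.UF i) (C.cF i) (C.\<Gamma> i) a b (snd q i) =
            (\<alpha> - C.warp_ricci lam1 lam2 i (fst q)) * \<phi> (fst q) powr (2 * p i) * C.gF i a b (snd q i)"
          if i: "i \<in> {1..m}" and ab: "a \<in> midx (F i)" "b \<in> midx (F i)" for i a b
          unfolding C.F_einstein_coeffs[OF i EF[OF i] C.U_D(2)[OF C(2) i] ab] weq
            \<alpha>F_eq[OF i t] ..
      qed (use XY in blast)+
    qed
  qed
qed

end

theorem proposition4p16:
  fixes t1 t2 :: ereal and I :: "real set" and \<phi> :: "real \<Rightarrow> real"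
    and m nbar :: nat and l :: "nat \<Rightarrow> nat" and p :: "nat \<Rightarrow> real"
    and F :: "nat \<Rightarrow> ('a, 'k) manifold"
    and M :: "(real \<times> (nat \<Rightarrow> 'a), (nat \<times> 'k) option) manifold"
    and nabla :: "(real \<times> (nat \<Rightarrow> 'a)) vfield \<Rightarrow> (real \<times> (nat \<Rightarrow> 'a)) vfield \<Rightarrow> (real \<times> (nat \<Rightarrow> 'a)) vfield"
    and nablaF :: "nat \<Rightarrow> 'a vfield \<Rightarrow> 'a vfield \<Rightarrow> 'a vfield"
    and lam1 lam2 \<alpha> \<zeta> \<eta> :: real
  assumes "t1 < t2" and "I = einterval t1 t2"
    and "smooth_on_interval I \<phi>" and "\<And>t. t \<in> I \<Longrightarrow> \<phi> t > 0"
    and "m \<ge> 1"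
    and "\<And>i. i \<in> {1..m} \<Longrightarrow> riemannian_manifold (F i)"
    and "\<And>i. i \<in> {1..m} \<Longrightarrow> mdim (F i) = l i"
    and "\<And>i. i \<in> {1..m} \<Longrightarrow> l i \<ge> 1"
    and "\<And>i. i \<in> {1..m} \<Longrightarrow> levi_civita (F i) (nablaF i)"
    and "M = kasner I \<phi> m p F" and "mdim M = nbar"
    and "levi_civita M nabla"
    and "\<zeta> = (\<Sum>i=1..m. real (l i) * p i)"
    and "\<eta> = (\<Sum>i=1..m. real (l i) * (p i)\<^sup>2)"
    and "lam1 \<noteq> 0" and "lam2 \<noteq> 0"
  shows "einstein M (quarter_symmetric M (time_field M) lam1 lam2 nabla) \<alpha> \<longleftrightarrow>
    (\<exists>\<alpha>F :: nat \<Rightarrow> real. \<forall>i\<in>{1..m}.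
       einstein (F i) (nablaF i) (\<alpha>F i) \<and>
       (\<forall>t\<in>I. \<zeta> * (lam2 * (deriv \<phi> t / \<phi> t) - deriv (deriv \<phi>) t / \<phi> t)
               - (\<eta> - \<zeta>) * ((deriv \<phi> t)\<^sup>2 / (\<phi> t)\<^sup>2)
               + (lam1\<^sup>2 - lam1 * lam2) * (real nbar - 1) = \<alpha>) \<and>
       (\<forall>t\<in>I. \<alpha>F i / \<phi> t powr (2 * p i)
               - p i * (deriv (deriv \<phi>) t / \<phi> t)
               - (\<zeta> - 1) * p i * ((deriv \<phi> t)\<^sup>2 / (\<phi> t)\<^sup>2)
               + (lam2 * \<zeta> + ((real nbar - 1) * lam1 - lam2) * p i) * (deriv \<phi> t / \<phi> t)
             = \<alpha> - lam2\<^sup>2 + (real nbar - 1) * lam1 * lam2))"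
proof -
  \<comment> \<open>The end points may be infinite; density yields a real number between
    them.\<close>
  have nonempty: "I \<noteq> {}"
  proof -
    obtain r where "t1 < ereal r" "ereal r < t2" using ereal_dense2[OF assms(1)] by blast
    then show ?thesis unfolding assms(2) einterval_def by blast
  qed
  interpret K: kasner_spacetime I \<phi> m p F
    by unfold_locales (use assms(2-4,6) in simp_all)
  have l: "card (midx (F i)) = l i" if "i \<in> {1..m}" for i
    using assms(7)[OF that] by (simp add: mdim_def)
  \<comment> \<open>The index \<open>None\<close> of the time coordinate accounts for the 1 in
    \<open>real nbar - 1\<close>.\<close>
  have "real (card (midx K.M)) = (\<Sum>k\<in>midx K.M. 1)" by simp
  also have "\<dots> = 1 + (\<Sum>i=1..m. real (card (midx (F i))))" unfolding K.sum_idx by simp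
  also have "\<dots> = 1 + (\<Sum>i=1..m. real (l i))" using l by simp
  finally have N: "real nbar - 1 = (\<Sum>i=1..m. real (l i))"
    unfolding assms(11)[symmetric] mdim_def assms(10) by simp
  show ?thesis
    unfolding assms(10)
    by (rule K.einstein_iff[OF assms(12)[unfolded assms(10)] assms(9) assms(5) nonempty l assms(8,13,14) N])
qed

end
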